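(* Let $\mathcal H=(\mathcal V,\mathcal E)$ be a (finite) higraph and let $\widetilde{\mathcal A}$ be the path DGA of its bigraph $\widetilde{\mathcal H}$, with differential $\tilde\delta$, map $\tilde\partial$ and pairing $\langle\cdot,\cdot\rangle$ as defined in the context. Then $\langle\tilde\partial a,b\rangle=\langle a,\tilde\delta b\rangle$ for all $a,b\in\widetilde{\mathcal A}$. Furthermore $\tilde\partial^2=0$ and $\tilde\delta^2=0$.
   Context: $\mathbb F=\{0,1\}$ is the field with two elements. A directed hypergraph $\mathcal H=(\mathcal V,\mathcal E)$ has a vertex set $\mathcal V$ and an edge set $\mathcal E\subset 2^{\mathcal V}\times 2^{\mathcal V}$; an edge $\varepsilon=(I,J)$ has source $s(\varepsilon)=I$ and target $t(\varepsilon)=J$. It is a higraph if for all $\varepsilon,\varepsilon'\in\mathcal E$: (Transitive) if $t(\varepsilon)\cap s(\varepsilon')\neq\emptyset$ then $t(\varepsilon)\cap s(\varepsilon')=\{K\}$ for a single vertex $K$, the unions $s(\varepsilon)\cup(s(\varepsilon')\setminus\{K\})$ and $(t(\varepsilon)\setminus\{K\})\cup t(\varepsilon')$ are unions of disjoint sets, and the pair $(s(\varepsilon)\cup(s(\varepsilon')\setminus\{K\}),(t(\varepsilon)\setminus\{K\})\cup t(\varepsilon'))$ lies in $\mathcal E$; (Acyclic) if $t(\varepsilon)\cap s(\varepsilon')$ and $t(\varepsilon')\cap s(\varepsilon)$ are both non-empty then $\varepsilon=\varepsilon'=(\{K\},\{K\})$ for some $K$. The vertex set is finite. Bigraph: $\widetilde{\mathcal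 V}=\mathcal V\times\{o,u,s\}$ with projection $\eta:\widetilde{\mathcal V}\to\mathcal V$; a vertex $(K,X)$ has type $X$ ($o$ = interior, $u$ = unstable, $s$ = stable; $u,s$ are boundary). The edge set $\widetilde{\mathcal E}$ consists of triples $(\mu,\tilde I,\tilde J)$ with $\mu\in\mathbb F$, $\tilde I,\tilde J\subset\widetilde{\mathcal V}$, $\eta$ injective on $\tilde I$ and on $\tilde J$, $(\eta(\tilde I),\eta(\tilde J))\in\mathcal E$, and: if $\mu=0$ then $\tilde I$ contains no stable vertex and $\tilde J$ no unstable vertex; if $\mu=1$ then $\tilde I\cup\tilde J$ contains no interior vertex. Its source is $\tilde I$, target $\tilde J$; it is interior if $\mu=0$, boundary if $\mu=1$. Weight: $w=1$ for interior edges, and $w=2-(\#\text{stable vertices in }\tilde I)-(\#\text{unstable vertices in }\tilde J)$ for boundary edges. A path $\tilde\rho=(T,\tilde\rho)$ is a non-empty finite directed tree $T=(V,E)$ (a digraph whose underlying undirected graph is a tree; elements of $V$ are nodes, of $E$ arrows or breaks, arrow $e$ has source node $s(e)$ and target node $t(e)$) with a map $\tilde\rho:V\to\widetilde{\mathcal E}$ such that (1) for each arrow $e$, $t(\tilde\rho(s(e)))\cap s(\tilde\rho(t(e)))$ is a single vertex, denoted $\tilde\rho(e)$; (2) distinct arrows with the same source node, or with the same target node, have distinct values $\tilde\rho(e)$. Paths related by a digraph isomorphism of trees compatible with the labels are identified. Source $s(\tilde\rho)=\bigcup_{v}(s(\tilde\rho(v))\setminus\{\tilde\rho(e):t(e)=v\})$,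 target $t(\tilde\rho)=\bigcup_v(t(\tilde\rho(v))\setminus\{\tilde\rho(e):s(e)=v\})$; a vertex of $s(\tilde\rho)$ lying in $s(\tilde\rho(v))$ is said to be sourced by $v$, and a vertex of $t(\tilde\rho)$ lying in $t(\tilde\rho(v))$ targeted by $v$. A node is interior/boundary according to its edge, an arrow $e$ has the type of the vertex $\tilde\rho(e)$. The weight of a path is the sum of the weights of its edges; its length is its number of nodes; it is a boundary path if all its edges are boundary. A (sub)path is legal if its source contains no stable vertex and its target no unstable vertex. For a non-empty subtree $T'$, the subpath on $T'$ is the restriction of $\tilde\rho$. The interior star $\mathrm{Star}^o(v)$ of a node $v$ is the subtree induced by $v$ and the interior nodes adjacent to $v$. Gluing: contracting a subtree $T'$ to a node $v^*$ (arrows between $T'$ and the rest reattached to $v^*$, labels elsewhere unchanged) and labeling $v^*$ by $(\mu^*,s(\tilde\rho'),t(\tilde\rho'))$, $\tilde\rho'$ the subpath on $T'$. Moves: (Ia) at an arrow both of whose endpoints are interior nodes, contract that arrow, $\mu^*=0$; (Ib) at a boundary node $v$ whose interior-star subpath is legal, contract $\mathrm{Star}^o(v)$, $\mu^*=0$; (II) at an arrow both of whose endpoints are boundary nodes, contract that arrow, $\mu^*=1$. A marker (node or arrow) at which a move applies is valid; the result is $\tilde q(\tilde\rho,x)$ ($:=0$ for invalid $x$). Refinement $r((\tilde\rho,v),\tilde\rho'')$, for a node $v$ and a path $\tilde\rho''$ with $s(\tilde\rho'')=s(\tilde\rho(v))$, $t(\tilde\rho'')=t(\tilde\rho(v))$: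 replace $v$ by the tree of $\tilde\rho''$, each arrow $(a,v)$ by $(a,v'')$ with $v''$ the node of $\tilde\rho''$ sourcing $\tilde\rho((a,v))$, each arrow $(v,b)$ by $(v'',b)$ with $v''$ the node targeting $\tilde\rho((v,b))$, with labels from $\tilde\rho,\tilde\rho''$; it is $0$ otherwise. Path DGA: $\widetilde{\mathcal A}$ is the $\mathbb F$-vector space with basis the set of paths (graded by weight). $\tilde\delta\tilde\rho=\sum_{v\text{ interior}}\sum_{\tilde\rho'}r((\tilde\rho,v),\tilde\rho')+\sum_{v\text{ boundary}}\sum_{\bar\rho'}r((\tilde\rho,v),\bar\rho')$, the first inner sum over paths of weight $2$, the second over boundary paths of length $2$; $\tilde\partial\tilde\rho=\sum_{x\text{ marker}}\tilde q(\tilde\rho,x)$; both extended linearly. $\langle\tilde\rho_1,\tilde\rho_2\rangle=1$ if $\tilde\rho_1=\tilde\rho_2$ and $0$ otherwise, extended bilinearly. *)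

theory Defs
  imports Main
begin

section \<open>Higraphs\<close>

type_synonym 'v hedge = "'v set \<times> 'v set"

definition higraph :: "'v set \<Rightarrow> 'v hedge set \<Rightarrow> bool" where
  "higraph V E \<longleftrightarrow>
     finite V \<and> E \<subseteq> Pow V \<times> Pow V \<and>
     (\<forall>e\<in>E. \<forall>e'\<in>E. snd e \<inter> fst e' \<noteq> {} \<longrightarrow>
        (\<exists>K. snd e \<inter> fst e' = {K} \<and>
             fst e \<inter> (fst e' - {K}) = {} \<and>
             (snd e - {K}) \<inter> snd e' = {} \<and>
             (fst e \<union> (fst e' - {K}), (snd e - {K}) \<union> snd e') \<in> E)) \<and>
     (\<forall>e\<in>E. \<forall>e'\<in>E. snd e \<inter> fst e' \<noteq> {} \<and> snd e' \<inter> fst e \<noteq> {} \<longrightarrow>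
        (\<exists>K. e = ({K}, {K}) \<and> e' = ({K}, {K})))"

section \<open>The bigraph\<close>

datatype vty = Intr | Unst | Stab   (* o = interior, u = unstable, s = stable *)

type_synonym 'v bvert = "'v \<times> vty"
(* a bigraph edge (mu, I, J); mu = False means mu = 0 (interior), True means mu = 1 (boundary) *)
type_synonym 'v bedge = "bool \<times> 'v bvert set \<times> 'v bvert set"

definition bmu :: "'v bedge \<Rightarrow> bool" where "bmu e = fst e"
definition bsrc :: "'v bedge \<Rightarrow> 'v bvert set" where "bsrc e = fst (snd e)"
definition btgt :: "'v bedge \<Rightarrow> 'v bvert set" where "btgt e = snd (snd e)"

definition bedges :: "'v set \<Rightarrow> 'v hedge set \<Rightarrow> 'v bedge set" where
  "bedges V E = {(\<mu>, I, J). I \<subseteq> V \<times> UNIV \<and> J \<subseteq> V \<times> UNIV \<and>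
      inj_on fst I \<and> inj_on fst J \<and> (fst ` I, fst ` J) \<in> E \<and>
      (\<not> \<mu> \<longrightarrow> (\<forall>x\<in>I. snd x \<noteq> Stab) \<and> (\<forall>x\<in>J. snd x \<noteq> Unst)) \<and>
      (\<mu> \<longrightarrow> (\<forall>x\<in>I \<union> J. snd x \<noteq> Intr))}"

definition bweight :: "'v bedge \<Rightarrow> int" where
  "bweight e = (if \<not> bmu e then 1 else
     2 - int (card {x\<in>bsrc e. snd x = Stab}) - int (card {x\<in>btgt e. snd x = Unst}))"

section \<open>Paths (concrete representatives: node set, arrow set, labelling)\<close>

record 'v pth =
  nds :: "nat set"
  arcs :: "(nat \<times> nat) set"
  lab :: "nat \<Rightarrow> 'v bedge"

(* finite directed tree: connected underlying graph with |arrows| = |nodes| - 1 *)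
definition is_tree :: "nat set \<Rightarrow> (nat \<times> nat) set \<Rightarrow> bool" where
  "is_tree N A \<longleftrightarrow> finite N \<and> N \<noteq> {} \<and> A \<subseteq> N \<times> N \<and> card A + 1 = card N \<and>
     (\<forall>x\<in>N. \<forall>y\<in>N. (x, y) \<in> (A \<union> A\<inverse>)\<^sup>*)"

(* the vertex \<rho>(e) of an arrow e *)
definition arclab :: "'v pth \<Rightarrow> nat \<times> nat \<Rightarrow> 'v bvert" where
  "arclab p e = the_elem (btgt (lab p (fst e)) \<inter> bsrc (lab p (snd e)))"

definition is_path :: "'v bedge set \<Rightarrow> 'v pth \<Rightarrow> bool" where
  "is_path BE p \<longleftrightarrow> is_tree (nds p) (arcs p) \<and>
     (\<forall>v\<in>nds p. lab p v \<in> BE) \<and>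
     (\<forall>e\<in>arcs p. \<exists>k. btgt (lab p (fst e)) \<inter> bsrc (lab p (snd e)) = {k}) \<and>
     (\<forall>e\<in>arcs p. \<forall>e'\<in>arcs p. e \<noteq> e' \<and> fst e = fst e' \<longrightarrow> arclab p e \<noteq> arclab p e') \<and>
     (\<forall>e\<in>arcs p. \<forall>e'\<in>arcs p. e \<noteq> e' \<and> snd e = snd e' \<longrightarrow> arclab p e \<noteq> arclab p e')"

definition path_iso :: "'v pth \<Rightarrow> 'v pth \<Rightarrow> bool" where
  "path_iso p q \<longleftrightarrow> (\<exists>f. bij_betw f (nds p) (nds q) \<and>
     (\<forall>a\<in>nds p. \<forall>b\<in>nds p. (a, b) \<in> arcs p \<longleftrightarrow> (f a, f b) \<in> arcs q) \<and>
     (\<forall>v\<in>nds p. lab q (f v) = lab p v))"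

definition psrc :: "'v pth \<Rightarrow> 'v bvert set" where
  "psrc p = (\<Union>v\<in>nds p. bsrc (lab p v) - {arclab p e | e. e \<in> arcs p \<and> snd e = v})"

definition ptgt :: "'v pth \<Rightarrow> 'v bvert set" where
  "ptgt p = (\<Union>v\<in>nds p. btgt (lab p v) - {arclab p e | e. e \<in> arcs p \<and> fst e = v})"

definition pweight :: "'v pth \<Rightarrow> int" where
  "pweight p = (\<Sum>v\<in>nds p. bweight (lab p v))"

definition plength :: "'v pth \<Rightarrow> nat" where
  "plength p = card (nds p)"

definition boundary_path :: "'v pth \<Rightarrow> bool" where
  "boundary_path p \<longleftrightarrow> (\<forall>v\<in>nds p. bmu (lab p v))"

definition legal :: "'v pth \<Rightarrow> bool" where
  "legal p \<longleftrightarrow> (\<forall>x\<in>psrc p. snd x \<noteq> Stab) \<and> (\<forall>x\<in>ptgt p. snd x \<noteq> Unst)"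

definition subpath :: "'v pth \<Rightarrow> nat set \<Rightarrow> 'v pth" where
  "subpath p S = \<lparr>nds = S, arcs = arcs p \<inter> (S \<times> S), lab = lab p\<rparr>"

definition istar :: "'v pth \<Rightarrow> nat \<Rightarrow> nat set" where
  "istar p v = insert v {u\<in>nds p. ((u, v) \<in> arcs p \<or> (v, u) \<in> arcs p) \<and> \<not> bmu (lab p u)}"

section \<open>Gluing and moves\<close>

(* contract the (subtree on the) node set S to a single node labelled (mu, s, t) *)
definition contract :: "'v pth \<Rightarrow> nat set \<Rightarrow> bool \<Rightarrow> 'v pth" where
  "contract p S \<mu> = (let vs = Min S; g = (\<lambda>x. if x \<in> S then vs else x) in
     \<lparr>nds = g ` nds p,
      arcs = {(g a, g b) | a b. (a, b) \<in> arcs p \<and> \<not> (a \<in> S \<and> b \<in> S)},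
      lab = (\<lambda>x. if x = vs then (\<mu>, psrc (subpath p S), ptgt (subpath p S)) else lab p x)\<rparr>)"

datatype marker = MNode nat | MArc "nat \<times> nat"

definition markers :: "'v pth \<Rightarrow> marker set" where
  "markers p = MNode ` nds p \<union> MArc ` arcs p"

definition valid_marker :: "'v pth \<Rightarrow> marker \<Rightarrow> bool" where
  "valid_marker p x = (case x of
      MArc e \<Rightarrow> e \<in> arcs p \<and> bmu (lab p (fst e)) = bmu (lab p (snd e))
    | MNode v \<Rightarrow> v \<in> nds p \<and> bmu (lab p v) \<and> legal (subpath p (istar p v)))"

(* moves (Ia), (II) at arrows, (Ib) at boundary nodes *)
definition qmove :: "'v pth \<Rightarrow> marker \<Rightarrow> 'v pth" where
  "qmove p x = (case x of
      MArc e \<Rightarrow> contract p {fst e, snd e} (bmu (lab p (fst e)))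
    | MNode v \<Rightarrow> contract p (istar p v) False)"

section \<open>Refinement\<close>

definition srcnode :: "'v pth \<Rightarrow> 'v bvert \<Rightarrow> nat" where
  "srcnode p k = (SOME w. w \<in> nds p \<and> k \<in> bsrc (lab p w) \<and>
                    k \<notin> {arclab p e | e. e \<in> arcs p \<and> snd e = w})"

definition tgtnode :: "'v pth \<Rightarrow> 'v bvert \<Rightarrow> nat" where
  "tgtnode p k = (SOME w. w \<in> nds p \<and> k \<in> btgt (lab p w) \<and>
                    k \<notin> {arclab p e | e. e \<in> arcs p \<and> fst e = w})"

(* replace node v of p by the tree of p2 (nodes of p2 shifted to be fresh) *)
definition refine :: "'v pth \<Rightarrow> nat \<Rightarrow> 'v pth \<Rightarrow> 'v pth" where
  "refine p v p2 = (let m = Suc (Max (nds p)); h = (\<lambda>w. w + m) in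
     \<lparr>nds = (nds p - {v}) \<union> h ` nds p2,
      arcs = {e\<in>arcs p. fst e \<noteq> v \<and> snd e \<noteq> v}
           \<union> {(h a, h b) | a b. (a, b) \<in> arcs p2}
           \<union> {(a, h (srcnode p2 (arclab p (a, v)))) | a. (a, v) \<in> arcs p}
           \<union> {(h (tgtnode p2 (arclab p (v, b))), b) | b. (v, b) \<in> arcs p},
      lab = (\<lambda>x. if m \<le> x then lab p2 (x - m) else lab p x)\<rparr>)"

section \<open>The path DGA over F_2\<close>

definition paths :: "'v set \<Rightarrow> 'v hedge set \<Rightarrow> 'v pth set" where
  "paths V E = {p. is_path (bedges V E) p}"

(* basis of the path DGA: isomorphism classes of paths *)
definition pclasses :: "'v set \<Rightarrow> 'v hedge set \<Rightarrow> 'v pth set set" where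
  "pclasses V E = paths V E // {(p, q). p \<in> paths V E \<and> q \<in> paths V E \<and> path_iso p q}"

definition rep :: "'v pth set \<Rightarrow> 'v pth" where
  "rep C = (SOME p. p \<in> C)"

(* elements of the F_2-vector space: finitely supported F_2-valued coefficient functions
   on the basis; coefficient True = 1, addition is exclusive or *)
type_synonym 'v chain = "'v pth set \<Rightarrow> bool"

definition dga :: "'v set \<Rightarrow> 'v hedge set \<Rightarrow> 'v chain set" where
  "dga V E = {c. (\<forall>C. c C \<longrightarrow> C \<in> pclasses V E) \<and> finite {C. c C}}"

definition pairing :: "'v chain \<Rightarrow> 'v chain \<Rightarrow> bool" where
  "pairing a b = odd (card {C. a C \<and> b C})"

(* \<partial> extended linearly: coefficient of sigma counted mod 2 *)
definition bdry :: "'v set \<Rightarrow> 'v hedge set \<Rightarrow> 'v chain \<Rightarrow> 'v chain" where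
  "bdry V E a = (\<lambda>\<sigma>. \<sigma> \<in> pclasses V E \<and>
     odd (card {(C, x). a C \<and> C \<in> pclasses V E \<and> x \<in> markers (rep C) \<and>
                        valid_marker (rep C) x \<and> qmove (rep C) x \<in> \<sigma>}))"

(* \<delta> extended linearly *)
definition dlt :: "'v set \<Rightarrow> 'v hedge set \<Rightarrow> 'v chain \<Rightarrow> 'v chain" where
  "dlt V E b = (\<lambda>\<sigma>. \<sigma> \<in> pclasses V E \<and>
     odd (card {(C, v, D). b C \<and> C \<in> pclasses V E \<and> v \<in> nds (rep C) \<and> D \<in> pclasses V E \<and>
        (if bmu (lab (rep C) v)
         then boundary_path (rep D) \<and> plength (rep D) = 2
         else pweight (rep D) = 2) \<and>
        psrc (rep D) = bsrc (lab (rep C) v) \<and> ptgt (rep D) = btgt (lab (rep C) v) \<and>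
        refine (rep C) v (rep D) \<in> \<sigma>}))"

end

theory Submission
  imports Defs
begin

text \<open>The label of an arrow is recorded at both of its ends, as a \<open>port\<close> of either node. Ports of a
  connected set of nodes glue to a hyperedge without collisions, so gluing is a quotient construction:
  a quotient of a path is determined by its fibres and by the interior/boundary type of its nodes.
  Hence two successive moves may be compared by comparing partitions of the nodes. They commute unless
  both come from an arrow between boundary nodes \<open>v\<close>, \<open>w\<close>; there the pair "contract the arrow, then the star
  of the new node" cancels against "contract the star of \<open>v\<close>, then that of \<open>w\<close>" or the same with
  \<open>v\<close> and \<open>w\<close> exchanged, exactly one of which is possible, because the arrow is a bad port at exactly one of
  its ends. This gives \<open>\<partial>\<^sup>2 = 0\<close>. Moves and refinements are inverse to each other; since a path has no
  nontrivial automorphism, this is a bijection on isomorphism classes, which is the duality of the two maps,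
  and \<open>\<delta>\<^sup>2 = 0\<close> is the same count as \<open>\<partial>\<^sup>2 = 0\<close>. A move produces an interior node exactly from a path of
  weight 2, because a legal path has weight 1 + #(boundary nodes) + #(arrows between interior nodes).\<close>

section \<open>Connected graphs and trees\<close>

text \<open>All three claims concern one matrix modulo 2 on isomorphism classes: the entry at
  (\<open>C\<close>, \<sigma>) is \<open>card (moves C \<sigma>)\<close>, the number of markers of
  \<open>rep C\<close> whose move lands in \<sigma>. Its rows are finite, \<open>bdry\<close> adds
  up its rows, \<open>dlt\<close> its columns, and its square is even. The delicate point is that
  paths are concrete trees with named nodes and that \<open>rep\<close> is an arbitrary choice:
  moves are counted at one representative and refinements at another, and if paths had symmetries,
  the two counts could differ by the size of an orbit. This is why rigidity is needed. Trees enter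
  through connectedness and the identity "nodes = arrows + 1". The identity replaces all arguments
  with cycles: it makes quotients of trees trees, it allows only one arrow between disjoint
  connected parts, it produces a fixed node of every automorphism, and it gives the constant 1 in
  the weight of a legal path.\<close>

definition adj :: "'a rel \<Rightarrow> 'a \<Rightarrow> 'a \<Rightarrow> bool" where
  "adj A a b \<longleftrightarrow> (a, b) \<in> A \<or> (b, a) \<in> A"

text \<open>Connectedness without walks, so that \<open>connD\<close> acts as an induction rule for
  properties that spread along arrows. The empty set counts as connected.\<close>

definition conn :: "'a rel \<Rightarrow> 'a set \<Rightarrow> bool" where
  "conn A S \<longleftrightarrow> (\<forall>X\<subseteq>S. X \<noteq> {} \<longrightarrow> (\<forall>a\<in>X. \<forall>b\<in>S. adj A a b \<longrightarrow> b \<in> X) \<longrightarrow> X = S)"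

lemma adj_sym: "adj A a b \<longleftrightarrow> adj A b a"
  by (auto simp: adj_def)

lemma connD:
  assumes "conn A S" "X \<subseteq> S" "X \<noteq> {}" "\<And>a b. a \<in> X \<Longrightarrow> b \<in> S \<Longrightarrow> adj A a b \<Longrightarrow> b \<in> X"
  shows "X = S"
  using assms unfolding conn_def by blast

lemma conn_singleton [simp]: "conn A {v}"
  by (auto simp: conn_def subset_singleton_iff)

lemma conn_Un:
  assumes S: "conn A S" and T: "conn A T" and "a \<in> S" "b \<in> T" "a = b \<or> adj A a b"
  shows "conn A (S \<union> T)"
  unfolding conn_def
proof (intro allI impI)
  fix X assume X: "X \<subseteq> S \<union> T" "X \<noteq> {}" and cl: "\<forall>a\<in>X. \<forall>b\<in>S \<union> T. adj A a b \<longrightarrow> b \<in> X"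
  have XS: "X \<inter> S = {} \<or> X \<inter> S = S"
    using connD[OF S, of "X \<inter> S"] cl by blast
  have XT: "X \<inter> T = {} \<or> X \<inter> T = T"
    using connD[OF T, of "X \<inter> T"] cl by blast
  have "a \<in> X \<longleftrightarrow> b \<in> X"
  proof (cases "a = b")
    case False
    then have "adj A a b" "adj A b a" using assms(5) adj_sym[of A a b] by auto
    then show ?thesis using assms(3,4) cl by (meson UnCI)
  qed simp
  then have "X \<inter> S = S \<and> X \<inter> T = T" using X XS XT assms(3,4) by auto
  then show "X = S \<union> T" using X(1) by auto
qed

lemma conn_insert:
  assumes "conn A T" "a \<in> T" "adj A a w"
  shows "conn A (insert w T)"
  using conn_Un[OF assms(1) conn_singleton[of A w] assms(2), of w] assms(3) by simp

text \<open>The shape of every set contracted by a move: a hub \<open>v\<close>, which is the centre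
  of a star or one end of an arrow, and some of its neighbours.\<close>

lemma conn_Union:
  assumes "v \<in> S" "\<And>u. u \<in> S \<Longrightarrow> u = v \<or> adj A v u"
  shows "conn A S"
  unfolding conn_def
proof (intro allI impI)
  fix X assume X: "X \<subseteq> S" "X \<noteq> {}" and cl: "\<forall>a\<in>X. \<forall>b\<in>S. adj A a b \<longrightarrow> b \<in> X"
  from X obtain u where u: "u \<in> X" "u \<in> S" by blast
  have "v \<in> X" using assms u cl adj_sym[of A u v] by metis
  then show "X = S" using assms cl X by blast
qed

lemma conn_mono:
  assumes "conn A S" "A \<inter> S \<times> S \<subseteq> B"
  shows "conn B S"
  unfolding conn_def
proof (intro allI impI)
  fix X assume X: "X \<subseteq> S" "X \<noteq> {}" and cl: "\<forall>a\<in>X. \<forall>b\<in>S. adj B a b \<longrightarrow> b \<in> X"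
  show "X = S"
  proof (rule connD[OF assms(1) X])
    fix a b assume "a \<in> X" "b \<in> S" "adj A a b"
    then have "adj B a b" using X(1) assms(2) unfolding adj_def by blast
    then show "b \<in> X" using cl \<open>a \<in> X\<close> \<open>b \<in> S\<close> by simp
  qed
qed

text \<open>Among the connected subsets of \<open>S\<close> that contain \<open>r\<close> and
  satisfy \<open>P\<close> take a maximal one. If it were not \<open>S\<close>, it would miss a
  neighbour of one of its elements, and \<open>step\<close> would enlarge it.\<close>

lemma conn_induct [consumes 3, case_names root step]:
  assumes S: "finite S" "conn A S" "r \<in> S"
    and base: "P {r}"
    and step: "\<And>T a w. T \<subseteq> S \<Longrightarrow> conn A T \<Longrightarrow> P T \<Longrightarrow> a \<in> T \<Longrightarrow> w \<in> S \<Longrightarrow> w \<notin> T \<Longrightarrow>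
      adj A a w \<Longrightarrow> P (insert w T)"
  shows "P S"
proof -
  define F where "F = {T. T \<subseteq> S \<and> r \<in> T \<and> conn A T \<and> P T}"
  have "finite F" using S(1) by (auto simp: F_def intro: finite_subset[of _ "Pow S"])
  moreover have "{r} \<in> F" using S(3) base conn_singleton by (auto simp: F_def)
  ultimately obtain T where T: "T \<in> F" and max: "\<And>T'. T' \<in> F \<Longrightarrow> T \<subseteq> T' \<Longrightarrow> T' = T"
    using finite_has_maximal2[of F "{r}"] by metis
  have T': "T \<subseteq> S" "r \<in> T" "conn A T" "P T" using T by (auto simp: F_def)
  have "T = S"
  proof (rule connD[OF S(2)])
    show "T \<subseteq> S" "T \<noteq> {}" using T' by auto
    fix a b assume a: "a \<in> T" and b: "b \<in> S" "adj A a b"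
    show "b \<in> T"
    proof (rule ccontr)
      assume nb: "b \<notin> T"
      have "P (insert b T)" by (rule step[OF T'(1,3,4) a b(1) nb b(2)])
      then have "insert b T \<in> F"
        using T' b(1) conn_insert[OF T'(3) a b(2)] by (simp add: F_def)
      then have "insert b T = T" by (rule max) auto
      then show False using nb by auto
    qed
  qed
  then show ?thesis using T' by simp
qed

text \<open>Each newly attached vertex brings at least one new arrow, the one that attaches it. This
  is the half of the tree identity that holds in every connected graph.\<close>

lemma conn_card:
  assumes "finite S" "conn A S"
  shows "card S \<le> card (A \<inter> S \<times> S) + 1"
proof (cases "S = {}")
  case False
  then obtain r where "r \<in> S" by blast
  with assms show ?thesis
  proof (induction rule: conn_induct)
    case (step T a w)
    have fT: "finite T" using step.hyps(1) assms(1) finite_subset by blast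
    have "A \<inter> T \<times> T \<subset> A \<inter> insert w T \<times> insert w T"
      using step.hyps by (auto simp: adj_def)
    then have "card (A \<inter> T \<times> T) < card (A \<inter> insert w T \<times> insert w T)"
      using fT by (intro psubset_card_mono) auto
    then show ?case using step.IH step.hyps fT by simp
  qed simp
qed simp

lemma is_tree_iff:
  "is_tree N A \<longleftrightarrow> finite N \<and> N \<noteq> {} \<and> A \<subseteq> N \<times> N \<and> card A + 1 = card N \<and> conn A N"
proof (cases "A \<subseteq> N \<times> N")
  case A: True
  have "(\<forall>x\<in>N. \<forall>y\<in>N. (x, y) \<in> (A \<union> A\<inverse>)\<^sup>*) \<longleftrightarrow> conn A N"
  proof
    assume L: "\<forall>x\<in>N. \<forall>y\<in>N. (x, y) \<in> (A \<union> A\<inverse>)\<^sup>*"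
    show "conn A N"
      unfolding conn_def
    proof (intro allI impI)
      fix X assume X: "X \<subseteq> N" "X \<noteq> {}" and cl: "\<forall>a\<in>X. \<forall>b\<in>N. adj A a b \<longrightarrow> b \<in> X"
      from X obtain x where x: "x \<in> X" by blast
      have "y \<in> X" if "y \<in> N" for y
      proof -
        have "(x, y) \<in> (A \<union> A\<inverse>)\<^sup>*" using L x X that by blast
        then show "y \<in> X"
        proof (induction rule: rtrancl_induct)
          case (step y z)
          then show ?case using cl A unfolding adj_def by blast
        qed (rule x)
      qed
      then show "X = N" using X by blast
    qed
  next
    assume R: "conn A N"
    show "\<forall>x\<in>N. \<forall>y\<in>N. (x, y) \<in> (A \<union> A\<inverse>)\<^sup>*"
    proof (intro ballI)
      fix x y assume xy: "x \<in> N" "y \<in> N"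
      have "{y\<in>N. (x, y) \<in> (A \<union> A\<inverse>)\<^sup>*} = N"
        by (rule connD[OF R]) (use xy in \<open>auto simp: adj_def intro: rtrancl_into_rtrancl\<close>)
      then show "(x, y) \<in> (A \<union> A\<inverse>)\<^sup>*" using xy by blast
    qed
  qed
  then show ?thesis unfolding is_tree_def by blast
qed (auto simp: is_tree_def)

section \<open>Quotients of trees by connected fibres\<close>

definition fib :: "('a \<Rightarrow> 'b) \<Rightarrow> 'a set \<Rightarrow> 'b \<Rightarrow> 'a set" where
  "fib g N n = {v\<in>N. g v = n}"

definition qarcs :: "('a \<Rightarrow> 'b) \<Rightarrow> 'a rel \<Rightarrow> 'b rel" where
  "qarcs g A = {(g a, g b) | a b. (a, b) \<in> A \<and> g a \<noteq> g b}"

lemma qarcs_image: "qarcs g A = map_prod g g ` {e\<in>A. g (fst e) \<noteq> g (snd e)}"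
  by (force simp: qarcs_def)

lemma qarcsI: "(a, b) \<in> A \<Longrightarrow> g a \<noteq> g b \<Longrightarrow> (g a, g b) \<in> qarcs g A"
  unfolding qarcs_def by blast

lemma qarcsE:
  assumes "(m, n) \<in> qarcs g A"
  obtains a b where "(a, b) \<in> A" "g a = m" "g b = n" "m \<noteq> n"
  using assms unfolding qarcs_def by blast

lemma adj_qarcsI: "adj A a b \<Longrightarrow> g a \<noteq> g b \<Longrightarrow> adj (qarcs g A) (g a) (g b)"
  using qarcsI[of a b A g] qarcsI[of b a A g] by (auto simp: adj_def)

lemma adj_qarcsE:
  assumes "adj (qarcs g A) m n"
  obtains a b where "adj A a b" "g a = m" "g b = n"
  using assms that by (auto simp: adj_def elim!: qarcsE)

lemma conn_image:
  assumes "conn A N"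
  shows "conn (qarcs g A) (g ` N)"
  unfolding conn_def
proof (intro allI impI)
  fix X assume X: "X \<subseteq> g ` N" "X \<noteq> {}" and cl: "\<forall>a\<in>X. \<forall>b\<in>g ` N. adj (qarcs g A) a b \<longrightarrow> b \<in> X"
  have "{v\<in>N. g v \<in> X} = N"
  proof (rule connD[OF assms])
    fix a b assume ab: "a \<in> {v\<in>N. g v \<in> X}" "b \<in> N" "adj A a b"
    show "b \<in> {v\<in>N. g v \<in> X}"
    proof (cases "g a = g b")
      case False
      then have "adj (qarcs g A) (g a) (g b)" using ab adj_qarcsI[of A a b g] by blast
      then show ?thesis using cl ab by blast
    qed (use ab in auto)
  qed (use X in auto)
  then show "X = g ` N" using X by blast
qed

text \<open>A set closed under adjacency contains every fibre that it meets, as fibres are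
  connected. It is therefore the preimage of its image, and that image is closed in the quotient
  graph.\<close>

lemma conn_vimage:
  assumes B: "conn (qarcs g A) B" and fc: "\<And>n. n \<in> B \<Longrightarrow> conn A (fib g N n)"
    and A: "A \<subseteq> N \<times> N" and BN: "B \<subseteq> g ` N"
  shows "conn A {v\<in>N. g v \<in> B}"
  unfolding conn_def
proof (intro allI impI)
  fix X assume X: "X \<subseteq> {v\<in>N. g v \<in> B}" "X \<noteq> {}"
    and cl: "\<forall>a\<in>X. \<forall>b\<in>{v\<in>N. g v \<in> B}. adj A a b \<longrightarrow> b \<in> X"
  have full: "fib g N n \<subseteq> X" if n: "n \<in> g ` X" for n
  proof -
    have nB: "n \<in> B" using n X by blast
    have "X \<inter> fib g N n = fib g N n"
    proof (rule connD[OF fc[OF nB]])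
      show "X \<inter> fib g N n \<noteq> {}" using n X by (auto simp: fib_def)
    qed (use cl X nB in \<open>auto simp: fib_def\<close>)
    then show ?thesis by blast
  qed
  have "g ` X = B"
  proof (rule connD[OF B])
    fix m n assume mn: "m \<in> g ` X" "n \<in> B" "adj (qarcs g A) m n"
    then obtain a b where ab: "adj A a b" "g a = m" "g b = n" by (auto elim: adj_qarcsE)
    have "a \<in> N" "b \<in> N" using ab A by (auto simp: adj_def)
    then have "a \<in> X" using full[OF mn(1)] ab by (auto simp: fib_def)
    then have "b \<in> X" using cl ab mn \<open>b \<in> N\<close> by blast
    then show "n \<in> g ` X" using ab by blast
  qed (use X in auto)
  then show "X = {v\<in>N. g v \<in> B}" using full X by (auto simp: fib_def)
qed

text \<open>A squeeze by counting. Each fibre is connected and has at least (size - 1) internal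
  arrows; the quotient is connected and has at least (number of fibres - 1) arrows, all coming from
  crossing ones. A tree has just enough arrows in total, so every inequality is an equality: the
  quotient and all fibres are trees, and distinct crossing arrows stay distinct.\<close>

lemma tree_quot:
  assumes T: "is_tree N A" and fc: "\<And>n. n \<in> g ` N \<Longrightarrow> conn A (fib g N n)"
  shows "is_tree (g ` N) (qarcs g A)"
    and "inj_on (map_prod g g) {e\<in>A. g (fst e) \<noteq> g (snd e)}"
    and "n \<in> g ` N \<Longrightarrow> is_tree (fib g N n) (A \<inter> fib g N n \<times> fib g N n)"
proof -
  let ?F = "fib g N"
  let ?I = "\<lambda>n. A \<inter> ?F n \<times> ?F n"
  let ?X = "{e\<in>A. g (fst e) \<noteq> g (snd e)}"
  have N: "finite N" "N \<noteq> {}" "A \<subseteq> N \<times> N" "card A + 1 = card N" "conn A N"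
    using T by (auto simp: is_tree_iff)
  have fA: "finite A" using N finite_subset by blast
  have fF: "finite (?F n)" for n using N by (simp add: fib_def)
  have "A = (\<Union>n\<in>g ` N. ?I n) \<union> ?X" using N(3) by (force simp: fib_def)
  then have "card A = card (\<Union>n\<in>g ` N. ?I n) + card ?X"
    using card_Un_disjoint[of "\<Union>n\<in>g ` N. ?I n" ?X] fA N(1) by (fastforce simp: fib_def)
  also have "card (\<Union>n\<in>g ` N. ?I n) = (\<Sum>n\<in>g ` N. card (?I n))"
    using N(1) fA by (intro card_UN_disjoint) (auto simp: fib_def)
  finally have cA: "card A = (\<Sum>n\<in>g ` N. card (?I n)) + card ?X" .
  have "N = (\<Union>n\<in>g ` N. ?F n)" by (auto simp: fib_def)
  then have "card N = card (\<Union>n\<in>g ` N. ?F n)" by simp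
  also have "\<dots> = (\<Sum>n\<in>g ` N. card (?F n))"
    using N(1) by (intro card_UN_disjoint) (auto simp: fib_def)
  finally have cN: "card N = (\<Sum>n\<in>g ` N. card (?F n))" .
  have le: "card (?F n) \<le> card (?I n) + 1" if "n \<in> g ` N" for n
    using conn_card[OF fF fc[OF that]] .
  have s1: "(\<Sum>n\<in>g ` N. card (?F n)) \<le> (\<Sum>n\<in>g ` N. card (?I n) + 1)"
    using le by (rule sum_mono)
  have s2: "(\<Sum>n\<in>g ` N. card (?I n) + 1) = (\<Sum>n\<in>g ` N. card (?I n)) + card (g ` N)"
    by (subst sum.distrib) simp
  have fX: "finite ?X" using fA by simp
  have q1: "card (qarcs g A) \<le> card ?X" using fX by (simp add: qarcs_image card_image_le)
  have sub: "qarcs g A \<subseteq> g ` N \<times> g ` N" using N(3) by (auto simp: qarcs_def)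
  then have "qarcs g A \<inter> g ` N \<times> g ` N = qarcs g A" by blast
  with conn_card[OF _ conn_image[OF N(5), of g]] N(1)
  have q2: "card (g ` N) \<le> card (qarcs g A) + 1" by simp
  have eq: "card (qarcs g A) = card ?X" "card (qarcs g A) + 1 = card (g ` N)"
      "(\<Sum>n\<in>g ` N. card (?F n)) = (\<Sum>n\<in>g ` N. card (?I n) + 1)"
    using q1 q2 s1 s2 cA cN N(4) by linarith+
  show "is_tree (g ` N) (qarcs g A)"
    using eq sub N conn_image[OF N(5)] by (auto simp: is_tree_iff)
  show "inj_on (map_prod g g) ?X"
    using eq(1) fX by (simp add: qarcs_image eq_card_imp_inj_on)
  show "is_tree (?F n) (?I n)" if n: "n \<in> g ` N"
  proof -
    have "card (?F n) = card (?I n) + 1"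
    proof (rule ccontr)
      assume "card (?F n) \<noteq> card (?I n) + 1"
      then have "card (?F n) < card (?I n) + 1" using le[OF n] by simp
      then have "(\<Sum>n\<in>g ` N. card (?F n)) < (\<Sum>n\<in>g ` N. card (?I n) + 1)"
        using N(1) n le by (intro sum_strict_mono_ex1) auto
      then show False using eq(3) by simp
    qed
    then show ?thesis using fF[of n] n conn_mono[OF fc[OF n], of "?I n"]
      by (auto simp: is_tree_iff fib_def)
  qed
qed

text \<open>Collapsing \<open>S\<close> to one of its own points \<open>r\<close> makes
  \<open>S\<close> the fibre over \<open>r\<close> and all other fibres singletons, so the statement
  of \<open>tree_quot\<close> on fibres applies.\<close>

lemma subtree:
  assumes T: "is_tree N A" and S: "S \<subseteq> N" "S \<noteq> {}" "conn A S"
  shows "is_tree S (A \<inter> S \<times> S)"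
proof -
  obtain r where r: "r \<in> S" using S by blast
  let ?g = "\<lambda>x. if x \<in> S then r else x"
  have *: "fib ?g N n = (if n = r then S else {n})" if "n \<in> ?g ` N" for n
    using that S r by (auto simp: fib_def)
  have "conn A (fib ?g N n)" if "n \<in> ?g ` N" for n
    using S(3) by (simp add: *[OF that])
  moreover have "r \<in> ?g ` N" using r S by force
  ultimately have "is_tree (fib ?g N r) (A \<inter> fib ?g N r \<times> fib ?g N r)"
    using tree_quot(3)[OF T, of ?g r] by blast
  moreover have "fib ?g N r = S" using S r by (auto simp: fib_def)
  ultimately show ?thesis by simp
qed

text \<open>The union of \<open>S\<close> and \<open>R\<close> is connected through
  \<open>e\<close>, hence a subtree. Comparing its count of nodes and arrows with those of
  \<open>S\<close> and \<open>R\<close> leaves exactly one arrow between the two.\<close>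

lemma tree_cross:
  assumes T: "is_tree N A" and S: "S \<subseteq> N" "conn A S" and R: "R \<subseteq> N" "conn A R"
    and disj: "S \<inter> R = {}"
    and e: "e \<in> A" "e \<in> S \<times> R \<union> R \<times> S" and e': "e' \<in> A" "e' \<in> S \<times> R \<union> R \<times> S"
  shows "e = e'"
proof -
  have ne: "S \<noteq> {}" "R \<noteq> {}" using e by auto
  let ?I = "\<lambda>S. A \<inter> S \<times> S"
  let ?X = "A \<inter> (S \<times> R \<union> R \<times> S)"
  have f: "finite N" "A \<subseteq> N \<times> N" using T by (auto simp: is_tree_iff)
  have fA: "finite A" using f finite_subset by blast
  have "adj A (fst e) (snd e)" "adj A (snd e) (fst e)" using e(1) by (auto simp: adj_def)
  then have "conn A (S \<union> R)"
    using e(2) conn_Un[OF S(2) R(2), of "fst e" "snd e"] conn_Un[OF S(2) R(2), of "snd e" "fst e"]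
    by auto
  then have SR: "card (?I (S \<union> R)) + 1 = card (S \<union> R)"
    using subtree[OF T, of "S \<union> R"] S R ne by (auto simp: is_tree_iff)
  have cS: "card (?I S) + 1 = card S" "card (?I R) + 1 = card R"
    using subtree[OF T S(1) ne(1) S(2)] subtree[OF T R(1) ne(2) R(2)] by (auto simp: is_tree_iff)
  have "card (S \<union> R) = card S + card R"
    using disj S R f by (intro card_Un_disjoint) (auto intro: finite_subset)
  moreover have "?I (S \<union> R) = ?I S \<union> ?I R \<union> ?X" by blast
  moreover have "card (?I S \<union> ?I R \<union> ?X) = card (?I S \<union> ?I R) + card ?X"
    using fA disj by (intro card_Un_disjoint) auto
  moreover have "card (?I S \<union> ?I R) = card (?I S) + card (?I R)"
    using fA disj by (intro card_Un_disjoint) auto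
  ultimately have "card ?X = 1" using SR cS by simp
  then obtain z where "?X = {z}" by (rule card_1_singletonE)
  then show ?thesis using e e' by (metis IntI singletonD)
qed

lemma tree_irrefl: "is_tree N A \<Longrightarrow> (v, v) \<notin> A"
proof
  assume T: "is_tree N A" and v: "(v, v) \<in> A"
  then have "v \<in> N" by (auto simp: is_tree_iff)
  then have "is_tree {v} (A \<inter> {v} \<times> {v})" using subtree[OF T, of "{v}"] by simp
  moreover have "A \<inter> {v} \<times> {v} = {(v, v)}" using v by auto
  ultimately show False by (simp add: is_tree_def)
qed

section \<open>Ports and links\<close>

type_synonym 'v port = "bool \<times> 'v bvert"

text \<open>The port \<open>(True, k)\<close> stands for \<open>k\<close> in the source and \<open>(False, k)\<close> for \<open>k\<close> in the target. With
  \<open>flip\<close>, statements about sources and targets become one.\<close>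

definition ports :: "'v bedge \<Rightarrow> 'v port set" where
  "ports e = {\<pi>. snd \<pi> \<in> (if fst \<pi> then bsrc e else btgt e)}"

definition flip :: "'v port \<Rightarrow> 'v port" where
  "flip \<pi> = (\<not> fst \<pi>, snd \<pi>)"

text \<open>The port \<pi> of \<open>v\<close> is occupied by an arrow whose other end is
  \<open>u\<close>. The orientation is stored in the first component of \<pi>, so one argument
  covers both, and \<open>flip\<close> changes the end from which the arrow is seen.\<close>

definition link :: "'v pth \<Rightarrow> nat \<Rightarrow> 'v port \<Rightarrow> nat \<Rightarrow> bool" where
  "link p v \<pi> u \<longleftrightarrow> (if fst \<pi> then (u, v) \<in> arcs p \<and> arclab p (u, v) = snd \<pi>
                      else (v, u) \<in> arcs p \<and> arclab p (v, u) = snd \<pi>)"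

lemma flip_flip [simp]: "flip (flip \<pi>) = \<pi>"
  by (simp add: flip_def)

lemma edge_eq_iff: "e = e' \<longleftrightarrow> bmu e = bmu e' \<and> ports e = ports e'"
proof
  assume *: "bmu e = bmu e' \<and> ports e = ports e'"
  have "(True, k) \<in> ports e \<longleftrightarrow> (True, k) \<in> ports e'" "(False, k) \<in> ports e \<longleftrightarrow> (False, k) \<in> ports e'" for k
    using * by auto
  then have "bsrc e = bsrc e'" "btgt e = btgt e'" by (auto simp: ports_def)
  with * show "e = e'" by (simp add: prod_eq_iff bmu_def bsrc_def btgt_def)
qed simp

lemma link_flip: "link p v \<pi> u \<longleftrightarrow> link p u (flip \<pi>) v"
  by (auto simp: link_def flip_def)

lemma link_adj: "link p v \<pi> u \<Longrightarrow> adj (arcs p) v u"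
  by (auto simp: link_def adj_def split: if_splits)

lemma adj_link:
  assumes "adj (arcs p) v u"
  shows "\<exists>\<pi>. link p v \<pi> u"
proof (cases "(u, v) \<in> arcs p")
  case True
  then show ?thesis by (intro exI[of _ "(True, arclab p (u, v))"]) (simp add: link_def)
next
  case False
  then have "(v, u) \<in> arcs p" using assms by (simp add: adj_def)
  then show ?thesis by (intro exI[of _ "(False, arclab p (v, u))"]) (simp add: link_def)
qed

lemma is_path_tree: "is_path BE p \<Longrightarrow> is_tree (nds p) (arcs p)"
  by (simp add: is_path_def)

lemma is_path_arcs: "is_path BE p \<Longrightarrow> arcs p \<subseteq> nds p \<times> nds p"
  by (simp add: is_path_def is_tree_def)

lemma is_path_finite: "is_path BE p \<Longrightarrow> finite (nds p) \<and> finite (arcs p)"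
  by (auto simp: is_path_def is_tree_def intro: finite_subset)

lemma is_path_conn: "is_path BE p \<Longrightarrow> conn (arcs p) (nds p)"
  by (simp add: is_path_def is_tree_iff)

lemma arclab_eq:
  assumes "is_path BE p" "(a, b) \<in> arcs p"
  shows "btgt (lab p a) \<inter> bsrc (lab p b) = {arclab p (a, b)}"
proof -
  obtain k where "btgt (lab p a) \<inter> bsrc (lab p b) = {k}"
    using assms unfolding is_path_def by fastforce
  then show ?thesis by (simp add: arclab_def)
qed

lemma link_nds: "is_path BE p \<Longrightarrow> link p v \<pi> u \<Longrightarrow> v \<in> nds p \<and> u \<in> nds p"
  using is_path_arcs[of BE p] by (auto simp: link_def split: if_splits)

lemma link_neq: "is_path BE p \<Longrightarrow> link p v \<pi> u \<Longrightarrow> v \<noteq> u"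
  using tree_irrefl[OF is_path_tree, of BE p v] by (auto simp: link_def split: if_splits)

lemma link_ports: 
  assumes "is_path BE p" "link p v \<pi> u"
  shows "\<pi> \<in> ports (lab p v)"
proof (cases "fst \<pi>")
  case True
  then have *: "(u, v) \<in> arcs p" "arclab p (u, v) = snd \<pi>" using assms(2) by (auto simp: link_def)
  then show ?thesis using arclab_eq[OF assms(1) *(1)] True by (auto simp: ports_def)
next
  case False
  then have *: "(v, u) \<in> arcs p" "arclab p (v, u) = snd \<pi>" using assms(2) by (auto simp: link_def)
  then show ?thesis using arclab_eq[OF assms(1) *(1)] False by (auto simp: ports_def)
qed

text \<open>Condition (2) on paths in the language of ports: arrows that share a source node, or a
  target node, have distinct labels.\<close>

lemma link_fun:
  assumes p: "is_path BE p" and l: "link p v \<pi> u" "link p v \<pi> u'"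
  shows "u = u'"
proof (rule ccontr)
  assume ne: "u \<noteq> u'"
  have A: "\<And>e e'. e \<in> arcs p \<Longrightarrow> e' \<in> arcs p \<Longrightarrow> e \<noteq> e' \<Longrightarrow> fst e = fst e' \<Longrightarrow> arclab p e \<noteq> arclab p e'"
    and B: "\<And>e e'. e \<in> arcs p \<Longrightarrow> e' \<in> arcs p \<Longrightarrow> e \<noteq> e' \<Longrightarrow> snd e = snd e' \<Longrightarrow> arclab p e \<noteq> arclab p e'"
    using p by (simp_all add: is_path_def)
  show False
  proof (cases "fst \<pi>")
    case True
    then show False using B[of "(u, v)" "(u', v)"] l ne by (simp add: link_def)
  next
    case False
    then show False using A[of "(v, u)" "(v, u')"] l ne by (simp add: link_def)
  qed
qed

lemma link_cross:
  assumes p: "is_path BE p" and S: "S \<subseteq> nds p" "conn (arcs p) S" and R: "R \<subseteq> nds p" "conn (arcs p) R"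
    and disj: "S \<inter> R = {}" and l: "link p a \<pi> b" "a \<in> S" "b \<in> R" and l': "link p a' \<pi>' b'" "a' \<in> S" "b' \<in> R"
  shows "a = a' \<and> b = b' \<and> \<pi> = \<pi>'"
proof -
  \<comment> \<open>The arrow underlying a link: a port in the source of \<open>a\<close> is
    occupied by an arrow that arrives at \<open>a\<close>.\<close>
  define e where "e = (\<lambda>a \<pi> b. if fst (\<pi> :: 'a port) then (b :: nat, a :: nat) else (a, b))"
  have "e a \<pi> b = e a' \<pi>' b'"
    using l l' by (intro tree_cross[OF is_path_tree[OF p] S R disj]) (auto simp: e_def link_def split: if_splits)
  moreover have "a \<noteq> b'" "b \<noteq> a'" using l l' disj by auto
  ultimately show ?thesis using l l' by (auto simp: e_def link_def prod_eq_iff split: if_splits)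
qed

lemma link_uniq:
  assumes "is_path BE p" "link p v \<pi> u" "link p v \<pi>' u"
  shows "\<pi> = \<pi>'"
  using link_cross[OF assms(1), of "{v}" "{u}" v \<pi> u v \<pi>' u] assms link_nds[OF assms(1,2)] link_neq[OF assms(1,2)]
  by simp

text \<open>The nodes \<open>a\<close> and \<open>b\<close> form a connected set, to which
  \<open>c\<close> would be linked twice.\<close>

lemma no_triangle:
  assumes p: "is_path BE p" and "adj (arcs p) a b" "adj (arcs p) b c"
  shows "\<not> adj (arcs p) a c"
proof
  assume "adj (arcs p) a c"
  then obtain \<pi> \<pi>' \<rho> where l: "link p a \<pi> b" "link p b \<pi>' c" "link p a \<rho> c"
    using adj_link assms(2,3) by metis
  have "conn (arcs p) {b, a}" using conn_insert[OF conn_singleton _ assms(2), of a] by simp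
  then have "conn (arcs p) {a, b}" by (simp add: insert_commute)
  then show False
    using link_cross[OF p, of "{a, b}" "{c}" a \<rho> c b \<pi>' c] l link_nds[OF p] link_neq[OF p] by auto
qed

section \<open>Free ports and the gluing of hyperedges\<close>

definition free :: "'v pth \<Rightarrow> nat set \<Rightarrow> nat \<Rightarrow> 'v port set" where
  "free p S v = {\<pi> \<in> ports (lab p v). \<forall>u\<in>S. \<not> link p v \<pi> u}"

definition fports :: "'v pth \<Rightarrow> nat set \<Rightarrow> 'v port set" where
  "fports p S = (\<Union>v\<in>S. free p S v)"

lemma ports_triple: "ports (m, I, J) = {\<pi>. snd \<pi> \<in> (if fst \<pi> then I else J)}"
  by (simp add: ports_def bsrc_def btgt_def)

lemma ports_subpath: "ports (m, psrc (subpath p S), ptgt (subpath p S)) = fports p S"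
proof (rule set_eqI)
  fix \<pi> :: "'a port"
  have *: "arclab (subpath p S) = arclab p" by (simp add: fun_eq_iff arclab_def subpath_def)
  obtain d k where \<pi>: "\<pi> = (d, k)" by (cases \<pi>)
  show "\<pi> \<in> ports (m, psrc (subpath p S), ptgt (subpath p S)) \<longleftrightarrow> \<pi> \<in> fports p S"
    unfolding \<pi> ports_triple psrc_def ptgt_def * fports_def free_def
    by (cases d) (auto simp: subpath_def ports_def link_def)
qed

text \<open>The bigraph condition on an edge without the conditions on types. Unlike the latter, it survives
  the partial gluings of an interior star.\<close>

definition good :: "'v hedge set \<Rightarrow> 'v port set \<Rightarrow> bool" where
  "good E P \<longleftrightarrow> inj_on fst {k. (True, k) \<in> P} \<and> inj_on fst {k. (False, k) \<in> P} \<and>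
     (fst ` {k. (True, k) \<in> P}, fst ` {k. (False, k) \<in> P}) \<in> E"

definition gedges :: "'v hedge set \<Rightarrow> 'v bedge set" where
  "gedges E = {e. good E (ports e)}"

lemma higraph_trans:
  assumes "higraph V E" "e \<in> E" "e' \<in> E" "snd e \<inter> fst e' \<noteq> {}"
  shows "\<exists>K. snd e \<inter> fst e' = {K} \<and> fst e \<inter> (fst e' - {K}) = {} \<and> (snd e - {K}) \<inter> snd e' = {} \<and>
    (fst e \<union> (fst e' - {K}), (snd e - {K}) \<union> snd e') \<in> E"
  using assms by (simp add: higraph_def)

text \<open>Transitivity yields one common vertex \<open>K\<close> of the projected hyperedges, and
  injectivity of the projection on each source and target turns it into the single bigraph vertex
  \<open>k\<close>. The disjointness contained in transitivity keeps the projection injective on the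
  glued source and target.\<close>

lemma good_glue_aux:
  assumes H: "higraph V E" and g: "good E P" "good E Q" and k: "(False, k) \<in> P" "(True, k) \<in> Q"
  shows "good E ((P - {(False, k)}) \<union> (Q - {(True, k)}))"
    and "(P - {(False, k)}) \<inter> (Q - {(True, k)}) = {}"
    and "(False, j) \<in> P \<Longrightarrow> (True, j) \<in> Q \<Longrightarrow> j = k"
proof -
  define I J I' J' where "I = {k. (True, k) \<in> P}" "J = {k. (False, k) \<in> P}"
    "I' = {k. (True, k) \<in> Q}" "J' = {k. (False, k) \<in> Q}"
  note d = this
  have inj: "inj_on fst I" "inj_on fst J" "inj_on fst I'" "inj_on fst J'"
    and E: "(fst ` I, fst ` J) \<in> E" "(fst ` I', fst ` J') \<in> E"
    using g by (auto simp: good_def d)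
  have kk: "k \<in> J" "k \<in> I'" using k by (auto simp: d)
  have "snd (fst ` I, fst ` J) \<inter> fst (fst ` I', fst ` J') \<noteq> {}" using kk by auto
  then obtain K where K: "fst ` J \<inter> fst ` I' = {K}" "fst ` I \<inter> (fst ` I' - {K}) = {}"
      "(fst ` J - {K}) \<inter> fst ` J' = {}" "(fst ` I \<union> (fst ` I' - {K}), (fst ` J - {K}) \<union> fst ` J') \<in> E"
    using higraph_trans[OF H E] by auto
  have Kk: "K = fst k" using K(1) kk by (metis IntI image_eqI singletonD)
  have dI: "fst ` (I' - {k}) = fst ` I' - {K}" and dJ: "fst ` (J - {k}) = fst ` J - {K}"
    using inj kk unfolding Kk inj_on_def by blast+
  have e1: "{j. (True, j) \<in> (P - {(False, k)}) \<union> (Q - {(True, k)})} = I \<union> (I' - {k})"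
    and e2: "{j. (False, j) \<in> (P - {(False, k)}) \<union> (Q - {(True, k)})} = (J - {k}) \<union> J'"
    by (auto simp: d)
  have i1: "inj_on fst (I \<union> (I' - {k}))"
    using inj K(2) dI unfolding inj_on_Un by (auto intro: inj_on_subset)
  have i2: "inj_on fst ((J - {k}) \<union> J')"
    using inj K(3) dJ unfolding inj_on_Un by (auto intro: inj_on_subset)
  show "good E ((P - {(False, k)}) \<union> (Q - {(True, k)}))"
    unfolding good_def e1 e2 using i1 i2 K(4) by (simp add: image_Un dI dJ)
  have n1: "I \<inter> (I' - {k}) = {}" using K(2) dI by blast
  have n2: "(J - {k}) \<inter> J' = {}" using K(3) dJ by blast
  show "(P - {(False, k)}) \<inter> (Q - {(True, k)}) = {}"
  proof (rule equals0I)
    fix \<pi> assume \<pi>: "\<pi> \<in> (P - {(False, k)}) \<inter> (Q - {(True, k)})"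
    obtain b j where b: "\<pi> = (b, j)" by (cases \<pi>)
    show False using \<pi> n1 n2 unfolding b d by (cases b) auto
  qed
  show "j = k" if "(False, j) \<in> P" "(True, j) \<in> Q"
  proof -
    have "fst j \<in> fst ` J \<inter> fst ` I'" using that by (auto simp: d)
    then have "fst j = fst k" using K(1) Kk by blast
    moreover have "j \<in> J" using that by (simp add: d)
    ultimately show ?thesis using inj(2) kk(1) by (auto dest: inj_onD)
  qed
qed

text \<open>Both orientations of \<open>good_glue_aux\<close> in one statement. The third part
  compares only ports of the same direction as \<pi>, because transitivity speaks about one
  direction at a time.\<close>

lemma good_glue:
  assumes H: "higraph V E" and g: "good E P" "good E Q" and k: "\<pi> \<in> P" "flip \<pi> \<in> Q"
  shows "good E ((P - {\<pi>}) \<union> (Q - {flip \<pi>}))"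
    and "(P - {\<pi>}) \<inter> (Q - {flip \<pi>}) = {}"
    and "\<rho> \<in> P \<Longrightarrow> flip \<rho> \<in> Q \<Longrightarrow> fst \<rho> = fst \<pi> \<Longrightarrow> \<rho> = \<pi>"
proof -
  obtain k where \<pi>: "\<pi> = (True, k) \<or> \<pi> = (False, k)" by (cases \<pi>) auto
  from \<pi> have "good E ((P - {\<pi>}) \<union> (Q - {flip \<pi>})) \<and> (P - {\<pi>}) \<inter> (Q - {flip \<pi>}) = {} \<and>
    (\<rho> \<in> P \<longrightarrow> flip \<rho> \<in> Q \<longrightarrow> fst \<rho> = fst \<pi> \<longrightarrow> \<rho> = \<pi>)"
  proof
    assume *: "\<pi> = (False, k)"
    then have k': "(False, k) \<in> P" "(True, k) \<in> Q" using k by (auto simp: flip_def)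
    have f: "flip \<pi> = (True, k)" using * by (simp add: flip_def)
    have "\<rho> = \<pi>" if "\<rho> \<in> P" "flip \<rho> \<in> Q" "fst \<rho> = fst \<pi>"
      using good_glue_aux(3)[OF H g k', of "snd \<rho>"] that * by (cases \<rho>) (simp add: flip_def)
    then show ?thesis
      using good_glue_aux(1,2)[OF H g k'] unfolding f unfolding * by simp
  next
    assume *: "\<pi> = (True, k)"
    then have k': "(False, k) \<in> Q" "(True, k) \<in> P" using k by (auto simp: flip_def)
    have f: "flip \<pi> = (False, k)" using * by (simp add: flip_def)
    have "\<rho> = \<pi>" if "\<rho> \<in> P" "flip \<rho> \<in> Q" "fst \<rho> = fst \<pi>"
      using good_glue_aux(3)[OF H g(2,1) k', of "snd \<rho>"] that * by (cases \<rho>) (simp add: flip_def)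
    then show ?thesis
      using good_glue_aux(1,2)[OF H g(2,1) k'] unfolding f unfolding * by (simp add: Un_commute Int_commute)
  qed
  then show "good E ((P - {\<pi>}) \<union> (Q - {flip \<pi>}))"
    "(P - {\<pi>}) \<inter> (Q - {flip \<pi>}) = {}"
    "\<rho> \<in> P \<Longrightarrow> flip \<rho> \<in> Q \<Longrightarrow> fst \<rho> = fst \<pi> \<Longrightarrow> \<rho> = \<pi>" by auto
qed

text \<open>Labels keep only the hyperedge condition, so that this class is stable under all
  quotients with connected fibres.\<close>

abbreviation prepath :: "'v hedge set \<Rightarrow> 'v pth \<Rightarrow> bool" where
  "prepath E \<equiv> is_path (gedges E)"

lemma free_singleton:
  assumes "is_path BE p"
  shows "free p {v} v = ports (lab p v)" "fports p {v} = ports (lab p v)"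
  using link_neq[OF assms, of v _ v] unfolding free_def fports_def by auto

text \<open>The set grows by one node \<open>w\<close> at a time. A single link \<pi> attaches
  \<open>w\<close>, so passing from \<open>T\<close> to \<open>insert w T\<close> removes \<pi> on
  the side of \<open>T\<close> and \<open>flip \<pi>\<close> on the side of \<open>w\<close>, which
  is the situation of \<open>good_glue\<close>. Disjointness of the free ports has to be part of the
  induction: otherwise \<pi> might remain free at a node of \<open>T\<close> other than
  \<open>a\<close>.\<close>

lemma glue_conn:
  assumes H: "higraph V E" and p: "prepath E p" and S: "S \<subseteq> nds p" "S \<noteq> {}" "conn (arcs p) S"
  shows "good E (fports p S) \<and> (\<forall>v\<in>S. \<forall>w\<in>S. v \<noteq> w \<longrightarrow> free p S v \<inter> free p S w = {})"
proof -
  have fin: "finite S" using S(1) is_path_finite[OF p] finite_subset by blast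
  have lb: "good E (ports (lab p v))" if "v \<in> nds p" for v
    using p that by (simp add: is_path_def gedges_def)
  obtain r where r: "r \<in> S" using S by blast
  show ?thesis
    using fin S(3) r
  proof (induction rule: conn_induct)
    case root
    then show ?case using lb[of r] r S(1) by (auto simp: free_singleton[OF p])
  next
    case (step T a w)
    obtain \<pi> where l: "link p a \<pi> w" using adj_link step.hyps by metis
    have IH2: "free p T v \<inter> free p T v' = {}" if "v \<in> T" "v' \<in> T" "v \<noteq> v'" for v v'
      using step.IH that by simp
    have TN: "T \<subseteq> nds p" "w \<in> nds p" using step.hyps S by auto
    have un: "x = a \<and> \<rho> = \<pi>" if "link p x \<rho> w" "x \<in> T" for x \<rho>
      using link_cross[OF p TN(1) step.hyps(2), of "{w}" x \<rho> w a \<pi> w] TN step.hyps that l by auto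
    have un': "x = a \<and> \<rho> = flip \<pi>" if "link p w \<rho> x" "x \<in> T" for x \<rho>
      using un[of x "flip \<rho>"] that link_flip[of p w \<rho> x] by (metis flip_flip)
    have f1: "free p (insert w T) v = free p T v - (if v = a then {\<pi>} else {})" if "v \<in> T" for v
    proof (rule set_eqI)
      fix \<rho>
      have "link p v \<rho> w \<longleftrightarrow> v = a \<and> \<rho> = \<pi>" using un[of v \<rho>] that l by auto
      then show "\<rho> \<in> free p (insert w T) v \<longleftrightarrow> \<rho> \<in> free p T v - (if v = a then {\<pi>} else {})"
        by (auto simp: free_def)
    qed
    have f2: "free p (insert w T) w = ports (lab p w) - {flip \<pi>}"
      using un' link_flip[of p a \<pi> w] l step.hyps link_neq[OF p, of w _ w] unfolding free_def by blast
    have \<pi>: "\<pi> \<in> free p T a"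
      using link_ports[OF p l] link_fun[OF p l] step.hyps unfolding free_def by blast
    have \<pi>': "\<pi> \<notin> free p T v" if "v \<in> T" "v \<noteq> a" for v
      using IH2[OF that(1) step.hyps(3) that(2)] \<pi> by auto
    have fw: "flip \<pi> \<in> ports (lab p w)"
      using link_ports[OF p] l link_flip by metis
    have f3: "(\<Union>v\<in>T. free p (insert w T) v) = fports p T - {\<pi>}"
      using \<pi>' f1 step.hyps(3) unfolding fports_def by (auto split: if_splits)
    have f4: "fports p (insert w T) = (fports p T - {\<pi>}) \<union> (ports (lab p w) - {flip \<pi>})"
      using f2 f3 unfolding fports_def by auto
    have "\<pi> \<in> fports p T" using \<pi> step.hyps by (auto simp: fports_def)
    note glue = good_glue[OF H conjunct1[OF step.IH] lb[OF TN(2)] this fw]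
    have d1: "free p (insert w T) v \<inter> free p (insert w T) w = {}" if "v \<in> T" for v
      using glue(2) f2 f3 that by blast
    have d2: "free p (insert w T) v \<inter> free p (insert w T) v' = {}" if "v \<in> T" "v' \<in> T" "v \<noteq> v'" for v v'
      using IH2[OF that] f1 that by auto
    show ?case
      unfolding f4 using glue(1) d1 d2 by (auto simp: Int_commute)
  qed
qed

text \<open>A free port of a connected set determines its node. This makes \<open>srcnode\<close>
  and \<open>tgtnode\<close> unambiguous and the links of a quotient functional.\<close>

lemma free_disjoint:
  assumes "higraph V E" "prepath E p" "S \<subseteq> nds p" "conn (arcs p) S"
    "v \<in> S" "w \<in> S" "\<pi> \<in> free p S v" "\<pi> \<in> free p S w"
  shows "v = w"
  using glue_conn[OF assms(1-3) _ assms(4)] assms(5-) by blast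

section \<open>Quotient maps of paths\<close>

text \<open>The interior/boundary flag of the labels of \<open>q\<close> is left open here, because
  it depends on the kind of move and not on the fibres.\<close>

definition qmap :: "(nat \<Rightarrow> nat) \<Rightarrow> 'v pth \<Rightarrow> 'v pth \<Rightarrow> bool" where
  "qmap g p q \<longleftrightarrow> g ` nds p = nds q \<and> arcs q = qarcs g (arcs p) \<and>
     (\<forall>n\<in>nds q. conn (arcs p) (fib g (nds p) n) \<and> ports (lab q n) = fports p (fib g (nds p) n))"

lemma qmap_nds: "qmap g p q \<Longrightarrow> g ` nds p = nds q"
  and qmap_arcs: "qmap g p q \<Longrightarrow> arcs q = qarcs g (arcs p)"
  and qmap_conn: "qmap g p q \<Longrightarrow> n \<in> nds q \<Longrightarrow> conn (arcs p) (fib g (nds p) n)"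
  and qmap_ports: "qmap g p q \<Longrightarrow> n \<in> nds q \<Longrightarrow> ports (lab q n) = fports p (fib g (nds p) n)"
  by (simp_all add: qmap_def)

lemma fib_sub: "fib g N n \<subseteq> N"
  by (auto simp: fib_def)

lemma qmap_fib_ne: "qmap g p q \<Longrightarrow> n \<in> nds q \<Longrightarrow> fib g (nds p) n \<noteq> {}"
  using qmap_nds[of g p q, symmetric] by (auto simp: fib_def)

lemma ports_iff: "(True, k) \<in> ports e \<longleftrightarrow> k \<in> bsrc e" "(False, k) \<in> ports e \<longleftrightarrow> k \<in> btgt e"
  by (simp_all add: ports_def)

lemma qmap_good:
  assumes "higraph V E" "prepath E p" "qmap g p q" "n \<in> nds q"
  shows "good E (fports p (fib g (nds p) n))"
  using glue_conn[OF assms(1,2) fib_sub qmap_fib_ne[OF assms(3,4)] qmap_conn[OF assms(3,4)]] by simp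

lemma link_free:
  assumes "is_path BE p" "link p a \<pi> b" "b \<notin> S"
  shows "\<pi> \<in> free p S a"
  using link_ports[OF assms(1,2)] link_fun[OF assms(1,2)] assms(3) unfolding free_def by auto

lemma link_fports:
  assumes "is_path BE p" "link p a \<pi> b" "a \<in> S" "b \<notin> S"
  shows "\<pi> \<in> fports p S"
  using link_free[OF assms(1,2,4)] assms(3) unfolding fports_def by auto

text \<open>The ports at both ends of a crossing arrow stay free in their fibres, so its vertex is
  shared by the two glued edges; by \<open>good_glue\<close> they share no other vertex in this
  direction.\<close>

lemma qmap_arclab:
  assumes H: "higraph V E" and p: "prepath E p" and q: "qmap g p q"
    and e: "(a, b) \<in> arcs p" "g a \<noteq> g b"
  shows "btgt (lab q (g a)) \<inter> bsrc (lab q (g b)) = {arclab p (a, b)}"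
    and "arclab q (g a, g b) = arclab p (a, b)"
proof -
  let ?F = "\<lambda>n. fib g (nds p) n"
  let ?k = "arclab p (a, b)"
  have l: "link p b (True, ?k) a" "link p a (False, ?k) b" using e by (auto simp: link_def)
  have ab: "a \<in> nds p" "b \<in> nds p" using link_nds[OF p l(1)] by auto
  then have n: "g a \<in> nds q" "g b \<in> nds q" using qmap_nds[OF q] by auto
  have pa: "(False, ?k) \<in> fports p (?F (g a))" "flip (False, ?k) \<in> fports p (?F (g b))"
    using link_fports[OF p l(2), of "?F (g a)"] link_fports[OF p l(1), of "?F (g b)"] ab e
    by (auto simp: fib_def flip_def)
  have gd: "good E (fports p (?F n))" if "n \<in> nds q" for n
    by (rule qmap_good[OF H p q that])
  note gl = good_glue(3)[OF H gd[OF n(1)] gd[OF n(2)] pa]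
  have k: "?k \<in> btgt (lab q (g a))" "?k \<in> bsrc (lab q (g b))"
    using pa qmap_ports[OF q n(1)] qmap_ports[OF q n(2)] by (auto simp: ports_iff[symmetric] flip_def)
  have un: "j = ?k" if "j \<in> btgt (lab q (g a))" "j \<in> bsrc (lab q (g b))" for j
  proof -
    have "(False, j) \<in> ports (lab q (g a))" "(True, j) \<in> ports (lab q (g b))"
      using that by (auto simp: ports_def)
    then have "(False, j) = (False, ?k)"
      using gl[of "(False, j)"] qmap_ports[OF q n(1)] qmap_ports[OF q n(2)] by (simp add: flip_def)
    then show ?thesis by simp
  qed
  show 1: "btgt (lab q (g a)) \<inter> bsrc (lab q (g b)) = {?k}"
  proof (intro equalityI subsetI)
    show "j \<in> {?k}" if "j \<in> btgt (lab q (g a)) \<inter> bsrc (lab q (g b))" for j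
      using un[of j] that by simp
    show "j \<in> btgt (lab q (g a)) \<inter> bsrc (lab q (g b))" if "j \<in> {?k}" for j
      using k that by simp
  qed
  show "arclab q (g a, g b) = ?k" using 1 by (simp add: arclab_def)
qed

lemma qmap_link:
  assumes H: "higraph V E" and p: "prepath E p" and q: "qmap g p q"
  shows "link q m \<pi> n \<longleftrightarrow> m \<noteq> n \<and> (\<exists>v u. link p v \<pi> u \<and> g v = m \<and> g u = n)"
proof
  assume l: "link q m \<pi> n"
  show "m \<noteq> n \<and> (\<exists>v u. link p v \<pi> u \<and> g v = m \<and> g u = n)"
  proof (cases "fst \<pi>")
    case True
    then have "(n, m) \<in> qarcs g (arcs p)" and k: "arclab q (n, m) = snd \<pi>"
      using l qmap_arcs[OF q] by (auto simp: link_def)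
    then obtain a b where ab: "(a, b) \<in> arcs p" "g a = n" "g b = m" "n \<noteq> m" by (auto elim: qarcsE)
    then have "link p b \<pi> a" using qmap_arclab(2)[OF H p q ab(1)] k True by (simp add: link_def)
    then show ?thesis using ab by auto
  next
    case False
    then have "(m, n) \<in> qarcs g (arcs p)" and k: "arclab q (m, n) = snd \<pi>"
      using l qmap_arcs[OF q] by (auto simp: link_def)
    then obtain a b where ab: "(a, b) \<in> arcs p" "g a = m" "g b = n" "m \<noteq> n" by (auto elim: qarcsE)
    then have "link p a \<pi> b" using qmap_arclab(2)[OF H p q ab(1)] k False by (simp add: link_def)
    then show ?thesis using ab by auto
  qed
next
  assume "m \<noteq> n \<and> (\<exists>v u. link p v \<pi> u \<and> g v = m \<and> g u = n)"
  then obtain v u where l: "link p v \<pi> u" and ne: "g v \<noteq> g u" and mn: "m = g v" "n = g u" by auto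
  show "link q m \<pi> n"
    unfolding mn
    using l qmap_arclab(2)[OF H p q, of v u] qmap_arclab(2)[OF H p q, of u v]
      qarcsI[of v u "arcs p" g] qarcsI[of u v "arcs p" g] ne qmap_arcs[OF q]
    by (auto simp: link_def split: if_splits)
qed

lemma qmap_prepath:
  assumes H: "higraph V E" and p: "prepath E p" and q: "qmap g p q"
  shows "prepath E q"
proof -
  let ?F = "\<lambda>n. fib g (nds p) n"
  have arc: "\<exists>a b. (a, b) \<in> arcs p \<and> g a = fst e \<and> g b = snd e \<and> g a \<noteq> g b \<and> arclab p (a, b) = arclab q e \<and>
     btgt (lab q (fst e)) \<inter> bsrc (lab q (snd e)) = {arclab q e}" if eq: "e \<in> arcs q" for e
  proof -
    obtain a b where ab: "(a, b) \<in> arcs p" "g a = fst e" "g b = snd e" "fst e \<noteq> snd e"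
      using eq unfolding qmap_arcs[OF q] by (cases e) (auto elim: qarcsE)
    then show ?thesis using qmap_arclab[OF H p q ab(1)]
      by (intro exI[of _ a] exI[of _ b]) simp
  qed
  \<comment> \<open>Condition (2) for the quotient: equal ports at \<open>m\<close> come from free
    ports of the fibre over \<open>m\<close>, hence from one and the same node, and there links are
    functional.\<close>
  have lf: "n = n'" if l: "link q m \<pi> n" "link q m \<pi> n'" for m \<pi> n n'
  proof -
    obtain v u v' u' where lp: "link p v \<pi> u" "g v = m" "g u = n" "m \<noteq> n"
        "link p v' \<pi> u'" "g v' = m" "g u' = n'" "m \<noteq> n'"
      using l qmap_link[OF H p q] by metis
    have N: "v \<in> nds p" "v' \<in> nds p" using lp link_nds[OF p] by blast+
    have nm: "m \<in> nds q" using imageI[OF N(1), of g] lp(2) qmap_nds[OF q] by simp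
    have "\<pi> \<in> free p (?F m) v" "\<pi> \<in> free p (?F m) v'"
      using link_free[OF p lp(1), of "?F m"] link_free[OF p lp(5), of "?F m"] lp by (auto simp: fib_def)
    moreover have "v \<in> ?F m" "v' \<in> ?F m" using N lp(2,6) by (simp_all add: fib_def)
    ultimately have "v = v'"
      using free_disjoint[OF H p fib_sub qmap_conn[OF q nm]] by simp
    then show "n = n'" using link_fun[OF p lp(1), of u'] lp by simp
  qed
  have "is_tree (nds q) (arcs q)"
    using tree_quot(1)[OF is_path_tree[OF p], of g] qmap_conn[OF q] qmap_nds[OF q] qmap_arcs[OF q] by auto
  moreover have "lab q n \<in> gedges E" if n: "n \<in> nds q" for n
    using qmap_good[OF H p q n] qmap_ports[OF q n] by (simp add: gedges_def)
  moreover have "\<exists>k. btgt (lab q (fst e)) \<inter> bsrc (lab q (snd e)) = {k}" if "e \<in> arcs q" for e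
    using arc[OF that] by auto
  ultimately show ?thesis
    unfolding is_path_def
  proof (intro conjI ballI impI)
    fix e e' assume e: "e \<in> arcs q" "e' \<in> arcs q"
    have l: "link q (fst z) (False, arclab q z) (snd z)" "link q (snd z) (True, arclab q z) (fst z)"
      if "z \<in> arcs q" for z using that by (simp_all add: link_def)
    show "arclab q e \<noteq> arclab q e'" if ne: "e \<noteq> e' \<and> fst e = fst e'"
    proof
      assume "arclab q e = arclab q e'"
      then have "link q (fst e) (False, arclab q e) (snd e')" using l(1)[OF e(2)] ne by simp
      from lf[OF l(1)[OF e(1)] this] show False using ne by (simp add: prod_eq_iff)
    qed
    show "arclab q e \<noteq> arclab q e'" if ne: "e \<noteq> e' \<and> snd e = snd e'"
    proof
      assume "arclab q e = arclab q e'"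
      then have "link q (snd e) (True, arclab q e) (fst e')" using l(2)[OF e(2)] ne by simp
      from lf[OF l(2)[OF e(1)] this] show False using ne by (simp add: prod_eq_iff)
    qed
  qed
qed

text \<open>Gluing in two stages leaves the same free ports as gluing at once. In the inclusion from
  right to left, an arrow of \<open>q\<close> occupying \<pi> would come from a node of the fibre at
  which \<pi> is free; \<open>free_disjoint\<close> identifies this node with \<open>v\<close>,
  where no such arrow exists.\<close>

lemma qmap_fports:
  assumes H: "higraph V E" and p: "prepath E p" and q: "qmap g p q" and B: "B \<subseteq> nds q"
  shows "fports q B = fports p {v\<in>nds p. g v \<in> B}"
proof (intro set_eqI iffI)
  fix \<pi> assume "\<pi> \<in> fports q B"
  then obtain n where n: "n \<in> B" "\<pi> \<in> ports (lab q n)" and fr: "\<And>m. m \<in> B \<Longrightarrow> \<not> link q n \<pi> m"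
    by (auto simp: fports_def free_def)
  have "n \<in> nds q" using n B by auto
  then obtain v where v: "v \<in> nds p" "g v = n" "\<pi> \<in> ports (lab p v)"
      and fv: "\<And>u. u \<in> fib g (nds p) n \<Longrightarrow> \<not> link p v \<pi> u"
    using n qmap_ports[OF q] by (auto simp: fports_def free_def fib_def)
  have "\<not> link p v \<pi> u" if "u \<in> nds p" "g u \<in> B" for u
    using fv[of u] fr[of "g u"] qmap_link[OF H p q, of n \<pi> "g u"] that v by (auto simp: fib_def)
  then show "\<pi> \<in> fports p {v\<in>nds p. g v \<in> B}"
    using v n by (auto simp: fports_def free_def)
next
  fix \<pi> assume "\<pi> \<in> fports p {v\<in>nds p. g v \<in> B}"
  then obtain v where v: "v \<in> nds p" "g v \<in> B" "\<pi> \<in> ports (lab p v)"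
      and fv: "\<And>u. u \<in> nds p \<Longrightarrow> g u \<in> B \<Longrightarrow> \<not> link p v \<pi> u"
    by (auto simp: fports_def free_def)
  have n: "g v \<in> nds q" using v B by auto
  let ?F = "fib g (nds p) (g v)"
  have fr: "\<pi> \<in> free p ?F v" using v fv by (auto simp: free_def fib_def)
  have "\<not> link q (g v) \<pi> m" if "m \<in> B" for m
  proof
    assume "link q (g v) \<pi> m"
    then obtain v' u where l: "link p v' \<pi> u" "g v' = g v" "g u = m" "m \<noteq> g v"
      using qmap_link[OF H p q] by metis
    have "\<pi> \<in> free p ?F v'" using link_free[OF p l(1), of ?F] l by (auto simp: fib_def)
    moreover have "v' \<in> ?F" "v \<in> ?F" using l v link_nds[OF p l(1)] by (auto simp: fib_def)
    ultimately have "v' = v"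
      using free_disjoint[OF H p fib_sub qmap_conn[OF q n], of v' v \<pi>] fr by simp
    then show False using fv[of u] l that link_nds[OF p l(1)] by auto
  qed
  moreover have "\<pi> \<in> ports (lab q (g v))"
    using fr v qmap_ports[OF q n] by (auto simp: fports_def fib_def)
  ultimately show "\<pi> \<in> fports q B" using v by (auto simp: fports_def free_def)
qed

lemma fib_comp: "fib (h \<circ> g) N n = {v\<in>N. g v \<in> fib h (g ` N) n}"
  by (auto simp: fib_def)

lemma qarcs_comp: "qarcs (h \<circ> g) A = qarcs h (qarcs g A)"
  unfolding qarcs_def by force

lemma qmap_comp:
  assumes H: "higraph V E" and p: "prepath E p" and q: "qmap g p q" and r: "qmap h q r"
  shows "qmap (h \<circ> g) p r"
proof -
  have "conn (arcs p) (fib (h \<circ> g) (nds p) n) \<and> ports (lab r n) = fports p (fib (h \<circ> g) (nds p) n)"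
    if n: "n \<in> nds r" for n
  proof
    let ?B = "fib h (nds q) n"
    have e: "fib (h \<circ> g) (nds p) n = {v\<in>nds p. g v \<in> ?B}"
      using fib_comp[of h g "nds p" n] qmap_nds[OF q] by simp
    show "conn (arcs p) (fib (h \<circ> g) (nds p) n)"
      unfolding e
    proof (rule conn_vimage)
      show "conn (qarcs g (arcs p)) ?B" using qmap_conn[OF r n] qmap_arcs[OF q] by simp
      show "conn (arcs p) (fib g (nds p) m)" if "m \<in> ?B" for m
        using qmap_conn[OF q, of m] that by (simp add: fib_def)
      show "arcs p \<subseteq> nds p \<times> nds p" by (rule is_path_arcs[OF p])
      show "?B \<subseteq> g ` nds p" using qmap_nds[OF q] by (auto simp: fib_def)
    qed
    show "ports (lab r n) = fports p (fib (h \<circ> g) (nds p) n)"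
      unfolding e qmap_ports[OF r n] by (rule qmap_fports[OF H p q fib_sub])
  qed
  then show ?thesis
    unfolding qmap_def qarcs_comp image_comp[symmetric] using qmap_nds[OF q] qmap_nds[OF r] qmap_arcs[OF q] qmap_arcs[OF r]
    by simp
qed

section \<open>Isomorphisms, and uniqueness of quotients\<close>

definition isom :: "(nat \<Rightarrow> nat) \<Rightarrow> 'v pth \<Rightarrow> 'v pth \<Rightarrow> bool" where
  "isom f p q \<longleftrightarrow> bij_betw f (nds p) (nds q) \<and>
     (\<forall>a\<in>nds p. \<forall>b\<in>nds p. (a, b) \<in> arcs p \<longleftrightarrow> (f a, f b) \<in> arcs q) \<and>
     (\<forall>v\<in>nds p. lab q (f v) = lab p v)"

lemma path_iso_isom: "path_iso p q \<longleftrightarrow> (\<exists>f. isom f p q)"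
  by (simp add: path_iso_def isom_def)

text \<open>The kernel of a quotient map determines the fibres, and these determine the arrows and
  the ports of all labels; only the flags have to be compared separately. Every later isomorphism
  between results of moves is obtained from this.\<close>

lemma qmap_unique:
  assumes q: "qmap g p q" and q': "qmap g' p q'"
    and A: "arcs p \<subseteq> nds p \<times> nds p"
    and ker: "\<And>a b. a \<in> nds p \<Longrightarrow> b \<in> nds p \<Longrightarrow> g a = g b \<longleftrightarrow> g' a = g' b"
    and mu: "\<And>a. a \<in> nds p \<Longrightarrow> bmu (lab q (g a)) = bmu (lab q' (g' a))"
  obtains f where "isom f q q'" "\<And>a. a \<in> nds p \<Longrightarrow> f (g a) = g' a"
proof
  \<comment> \<open>Any preimage under \<open>g\<close> will do, because \<open>g\<close> and
    \<open>g'\<close> have the same kernel.\<close>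
  let ?f = "\<lambda>m. g' (inv_into (nds p) g m)"
  show f: "?f (g a) = g' a" if "a \<in> nds p" for a
    using ker[of "inv_into (nds p) g (g a)" a] that inv_into_into[of "g a" g "nds p"]
      f_inv_into_f[of "g a" g "nds p"] by auto
  have "bij_betw ?f (nds q) (nds q')"
    unfolding bij_betw_def qmap_nds[OF q, symmetric] qmap_nds[OF q', symmetric]
    using f ker by (auto intro!: inj_onI simp: image_image)
  moreover have "(g a, g b) \<in> arcs q \<longleftrightarrow> (g' a, g' b) \<in> arcs q'" if ab: "a \<in> nds p" "b \<in> nds p" for a b
  proof
    assume "(g a, g b) \<in> arcs q"
    then obtain a' b' where x: "(a', b') \<in> arcs p" "g a' = g a" "g b' = g b" "g a \<noteq> g b"
      unfolding qmap_arcs[OF q] by (elim qarcsE)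
    then have "a' \<in> nds p" "b' \<in> nds p" using A by auto
    then have y: "g' a' = g' a" "g' b' = g' b" "g' a' \<noteq> g' b'" using x ab ker by auto
    show "(g' a, g' b) \<in> arcs q'"
      using qarcsI[of a' b' "arcs p" g'] x(1) y unfolding qmap_arcs[OF q'] by simp
  next
    assume "(g' a, g' b) \<in> arcs q'"
    then obtain a' b' where x: "(a', b') \<in> arcs p" "g' a' = g' a" "g' b' = g' b" "g' a \<noteq> g' b"
      unfolding qmap_arcs[OF q'] by (elim qarcsE)
    then have "a' \<in> nds p" "b' \<in> nds p" using A by auto
    then have y: "g a' = g a" "g b' = g b" "g a' \<noteq> g b'" using x ab ker by auto
    show "(g a, g b) \<in> arcs q"
      using qarcsI[of a' b' "arcs p" g] x(1) y unfolding qmap_arcs[OF q] by simp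
  qed
  moreover have "lab q' (g' a) = lab q (g a)" if a: "a \<in> nds p" for a
  proof -
    have "g a \<in> nds q" "g' a \<in> nds q'" using a qmap_nds[OF q] qmap_nds[OF q'] by auto
    moreover have "fib g (nds p) (g a) = fib g' (nds p) (g' a)"
      using ker a by (auto simp: fib_def)
    ultimately show ?thesis
      using qmap_ports[OF q, of "g a"] qmap_ports[OF q', of "g' a"] mu[OF a] by (simp add: edge_eq_iff)
  qed
  ultimately show "isom ?f q q'"
    unfolding isom_def qmap_nds[OF q, symmetric] using f by (simp del: f_inv_into_f)
qed

lemma isom_arcs:
  assumes "isom f p q" "arcs p \<subseteq> nds p \<times> nds p" "arcs q \<subseteq> nds q \<times> nds q"
  shows "arcs q = map_prod f f ` arcs p"
proof -
  have b: "f ` nds p = nds q" and a: "\<And>a b. a \<in> nds p \<Longrightarrow> b \<in> nds p \<Longrightarrow> (a, b) \<in> arcs p \<longleftrightarrow> (f a, f b) \<in> arcs q"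
    using assms(1) by (auto simp: isom_def bij_betw_def)
  show ?thesis
  proof (intro set_eqI iffI)
    fix e assume e: "e \<in> arcs q"
    then obtain a' b' where ab: "a' \<in> nds p" "b' \<in> nds p" "e = (f a', f b')" using assms(3) unfolding b[symmetric] by blast
    then have "(a', b') \<in> arcs p" using a e by simp
    then show "e \<in> map_prod f f ` arcs p" using ab(3) by (metis map_prod_simp imageI)
  next
    fix e assume "e \<in> map_prod f f ` arcs p"
    then show "e \<in> arcs q" using a assms(2) by auto
  qed
qed

text \<open>An isomorphism is a quotient with singleton fibres, so all facts about
  \<open>qmap\<close> apply to it. The bound on \<open>arcs q\<close> is a separate assumption
  because \<open>isom\<close> sees only arrows between nodes.\<close>

lemma isom_qmap:
  assumes f: "isom f p q" and p: "is_path BE p" and q: "arcs q \<subseteq> nds q \<times> nds q"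
  shows "qmap f p q"
proof -
  have b: "f ` nds p = nds q" "inj_on f (nds p)" and l: "\<And>v. v \<in> nds p \<Longrightarrow> lab q (f v) = lab p v"
    using f by (auto simp: isom_def bij_betw_def)
  have ne: "f a \<noteq> f b" if "(a, b) \<in> arcs p" for a b
    using that is_path_arcs[OF p] tree_irrefl[OF is_path_tree[OF p]] b(2) by (auto dest: inj_onD)
  have "arcs q = qarcs f (arcs p)"
    unfolding isom_arcs[OF f is_path_arcs[OF p] q] qarcs_image
    using ne by (intro arg_cong[of _ _ "image _"]) auto
  moreover have "conn (arcs p) (fib f (nds p) n) \<and> ports (lab q n) = fports p (fib f (nds p) n)"
    if n: "n \<in> nds q" for n
  proof -
    obtain v where v: "v \<in> nds p" "n = f v" using n b(1)[symmetric] by auto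
    have "fib f (nds p) n = {v}" using v b by (auto simp: fib_def dest: inj_onD)
    then show ?thesis using l[OF v(1)] free_singleton[OF p] v by simp
  qed
  ultimately show ?thesis using b by (simp add: qmap_def)
qed

lemma isom_link:
  assumes f: "isom f p q" and v: "v \<in> nds p" "u \<in> nds p"
  shows "link q (f v) \<pi> (f u) \<longleftrightarrow> link p v \<pi> u"
  using f v unfolding link_def isom_def arclab_def by auto

lemma isom_refl: "isom id p p"
  by (simp add: isom_def)

lemma isom_trans: "isom f p q \<Longrightarrow> isom g q r \<Longrightarrow> isom (g \<circ> f) p r"
  unfolding isom_def by (auto intro: bij_betw_trans dest: bij_betwE)

lemma isom_sym:
  assumes "isom f p q"
  shows "isom (inv_into (nds p) f) q p"
proof -
  have b: "bij_betw f (nds p) (nds q)" using assms by (simp add: isom_def)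
  have i: "inv_into (nds p) f a \<in> nds p" "f (inv_into (nds p) f a) = a" if "a \<in> nds q" for a
    using b that by (metis bij_betw_def inv_into_into, metis bij_betw_inv_into_right)
  show ?thesis
    unfolding isom_def
  proof (intro conjI ballI)
    show "bij_betw (inv_into (nds p) f) (nds q) (nds p)" using b by (rule bij_betw_inv_into)
    fix a assume a: "a \<in> nds q"
    show "lab p (inv_into (nds p) f a) = lab q a" using assms i[OF a] unfolding isom_def by metis
    fix b assume b: "b \<in> nds q"
    show "(a, b) \<in> arcs q \<longleftrightarrow> (inv_into (nds p) f a, inv_into (nds p) f b) \<in> arcs p"
      using assms i[OF a] i[OF b] unfolding isom_def by metis
  qed
qed

section \<open>Contraction as a quotient, and the types of ports\<close>

definition cmap :: "nat set \<Rightarrow> nat \<Rightarrow> nat" where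
  "cmap S x = (if x \<in> S then Min S else x)"

lemma contract_simps:
  "nds (contract p S m) = cmap S ` nds p"
  "lab (contract p S m) = (\<lambda>x. if x = Min S then (m, psrc (subpath p S), ptgt (subpath p S)) else lab p x)"
  by (simp_all add: contract_def Let_def cmap_def[abs_def])

lemma cmap_eq_iff:
  assumes "finite S" "S \<noteq> {}"
  shows "cmap S a = cmap S b \<longleftrightarrow> a = b \<or> a \<in> S \<and> b \<in> S"
  using Min_in[OF assms] by (auto simp: cmap_def)

lemma contract_qmap:
  assumes p: "is_path BE p" and S: "S \<subseteq> nds p" "S \<noteq> {}" "conn (arcs p) S"
  shows "qmap (cmap S) p (contract p S m)"
    and "a \<in> nds p \<Longrightarrow> bmu (lab (contract p S m) (cmap S a)) = (if a \<in> S then m else bmu (lab p a))"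
proof -
  have fS: "finite S" using S(1) is_path_finite[OF p] finite_subset by auto
  note mi = Min_in[OF fS S(2)]
  have f1: "fib (cmap S) (nds p) (Min S) = S"
    using S mi by (auto simp: fib_def cmap_def split: if_splits)
  have f2: "fib (cmap S) (nds p) a = {a}" if "a \<in> nds p" "a \<notin> S" for a
    using that mi by (auto simp: fib_def cmap_def split: if_splits)
  have "arcs (contract p S m) = qarcs (cmap S) (arcs p)"
  proof -
    \<comment> \<open>As there are no loops, an arrow disappears under \<open>cmap S\<close> just
      when both of its ends lie in \<open>S\<close>.\<close>
    have "\<not> (a \<in> S \<and> b \<in> S) \<longleftrightarrow> cmap S a \<noteq> cmap S b" if "(a, b) \<in> arcs p" for a b
      using that tree_irrefl[OF is_path_tree[OF p]] cmap_eq_iff[OF fS S(2)] by auto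
    then have "{(cmap S a, cmap S b) | a b. (a, b) \<in> arcs p \<and> \<not> (a \<in> S \<and> b \<in> S)} = qarcs (cmap S) (arcs p)"
      unfolding qarcs_def by blast
    then show ?thesis by (simp add: contract_def Let_def cmap_def[abs_def])
  qed
  moreover have "conn (arcs p) (fib (cmap S) (nds p) n) \<and>
      ports (lab (contract p S m) n) = fports p (fib (cmap S) (nds p) n)"
    if n: "n \<in> cmap S ` nds p" for n
  proof (cases "n = Min S")
    case True
    then show ?thesis using S(3) by (simp add: f1 contract_simps ports_subpath)
  next
    case False
    then have "n \<in> nds p" "n \<notin> S" using n by (auto simp: cmap_def)
    then show ?thesis using False by (simp add: f2 contract_simps free_singleton[OF p])
  qed
  ultimately show "qmap (cmap S) p (contract p S m)"
    unfolding qmap_def by (simp add: contract_simps(1))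
  show "bmu (lab (contract p S m) (cmap S a)) = (if a \<in> S then m else bmu (lab p a))" if "a \<in> nds p"
    using mi by (auto simp: contract_simps cmap_def bmu_def)
qed

text \<open>Bad ports are those that a legal path must not leave free, and those that lower the weight of a
  boundary edge.\<close>

definition bad :: "'v port \<Rightarrow> bool" where
  "bad \<pi> \<longleftrightarrow> snd (snd \<pi>) = (if fst \<pi> then Stab else Unst)"

definition typed :: "'v bedge \<Rightarrow> bool" where
  "typed e \<longleftrightarrow> (\<not> bmu e \<longrightarrow> (\<forall>\<pi>\<in>ports e. \<not> bad \<pi>)) \<and> (bmu e \<longrightarrow> (\<forall>\<pi>\<in>ports e. snd (snd \<pi>) \<noteq> Intr))"

lemma bedges_iff:
  assumes "higraph V E"
  shows "e \<in> bedges V E \<longleftrightarrow> e \<in> gedges E \<and> typed e"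
proof -
  obtain m I J where e: "e = (m, I, J)" by (cases e)
  have sub: "I \<subseteq> V \<times> UNIV \<and> J \<subseteq> V \<times> UNIV" if "(fst ` I, fst ` J) \<in> E"
  proof -
    have "E \<subseteq> Pow V \<times> Pow V" using assms by (simp add: higraph_def)
    then have "fst ` I \<subseteq> V \<and> fst ` J \<subseteq> V" using that by blast
    then show ?thesis by (auto simp: image_subset_iff)
  qed
  have g: "e \<in> gedges E \<longleftrightarrow> inj_on fst I \<and> inj_on fst J \<and> (fst ` I, fst ` J) \<in> E"
    by (simp add: e gedges_def good_def ports_triple)
  have t: "typed e \<longleftrightarrow> (\<not> m \<longrightarrow> (\<forall>x\<in>I. snd x \<noteq> Stab) \<and> (\<forall>x\<in>J. snd x \<noteq> Unst)) \<and>
      (m \<longrightarrow> (\<forall>x\<in>I \<union> J. snd x \<noteq> Intr))"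
    by (cases m) (simp_all add: typed_def e ports_triple bad_def bmu_def Ball_def all_bool_eq, auto)
  show ?thesis unfolding g t using sub by (simp add: e bedges_def) blast
qed

section \<open>Moves\<close>

abbreviation bd :: "'v pth \<Rightarrow> nat \<Rightarrow> bool" where
  "bd p v \<equiv> bmu (lab p v)"

lemma path_iff:
  assumes "higraph V E"
  shows "is_path (bedges V E) p \<longleftrightarrow> prepath E p \<and> (\<forall>v\<in>nds p. typed (lab p v))"
  using bedges_iff[OF assms] unfolding is_path_def by auto

lemma path_prepath: "higraph V E \<Longrightarrow> is_path (bedges V E) p \<Longrightarrow> prepath E p"
  by (simp add: path_iff)

lemma path_typed: "higraph V E \<Longrightarrow> is_path (bedges V E) p \<Longrightarrow> v \<in> nds p \<Longrightarrow> typed (lab p v)"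
  by (simp add: path_iff)

lemma bad_interior:
  assumes "higraph V E" "is_path (bedges V E) p" "v \<in> nds p" "\<not> bd p v" "\<pi> \<in> ports (lab p v)"
  shows "\<not> bad \<pi>"
  using path_typed[OF assms(1-3)] assms(4,5) by (simp add: typed_def)

lemma bad_flip: "snd (snd \<pi>) \<noteq> Intr \<Longrightarrow> bad (flip \<pi>) \<longleftrightarrow> \<not> bad \<pi>"
  by (cases "snd (snd \<pi>)") (auto simp: bad_def flip_def)

text \<open>The label of an arrow with a boundary end is a stable or an unstable vertex, and such a
  vertex is bad on exactly one side: stable in a source, unstable in a target. An interior end is
  never the bad one.\<close>

lemma link_bad:
  assumes H: "higraph V E" and p: "is_path (bedges V E) p" and l: "link p v \<pi> u"
  shows "\<not> bd p v \<Longrightarrow> \<not> bad \<pi>"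
    and "\<not> bd p u \<Longrightarrow> \<not> bad (flip \<pi>)"
    and "bd p v \<or> bd p u \<Longrightarrow> bad (flip \<pi>) \<longleftrightarrow> \<not> bad \<pi>"
proof -
  have l': "link p u (flip \<pi>) v" using l link_flip by metis
  note n = link_nds[OF p l]
  note t = path_typed[OF H p conjunct1[OF n]] path_typed[OF H p conjunct2[OF n]]
  note P = link_ports[OF p l] link_ports[OF p l']
  show "\<not> bd p v \<Longrightarrow> \<not> bad \<pi>" "\<not> bd p u \<Longrightarrow> \<not> bad (flip \<pi>)"
    using t P by (simp_all add: typed_def)
  assume "bd p v \<or> bd p u"
  then have "snd (snd \<pi>) \<noteq> Intr" using t P by (auto simp: typed_def flip_def)
  then show "bad (flip \<pi>) \<longleftrightarrow> \<not> bad \<pi>" by (rule bad_flip)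
qed

lemma legal_fports: "legal (subpath p S) \<longleftrightarrow> (\<forall>\<pi>\<in>fports p S. \<not> bad \<pi>)"
  unfolding ports_subpath[of True, symmetric] ports_triple legal_def bad_def
  by (simp add: Ball_def all_bool_eq)

text \<open>The three moves in a common format: a set of nodes to contract, and with
  \<open>mtype\<close> the flag of the new node.\<close>

definition mnodes :: "'v pth \<Rightarrow> marker \<Rightarrow> nat set" where
  "mnodes p x = (case x of MNode v \<Rightarrow> istar p v | MArc e \<Rightarrow> {fst e, snd e})"

definition mtype :: "'v pth \<Rightarrow> marker \<Rightarrow> bool" where
  "mtype p x = (case x of MNode v \<Rightarrow> False | MArc e \<Rightarrow> bd p (fst e))"

abbreviation gm :: "'v pth \<Rightarrow> marker \<Rightarrow> nat \<Rightarrow> nat" where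
  "gm p x \<equiv> cmap (mnodes p x)"

lemma qmove_contract: "qmove p x = contract p (mnodes p x) (mtype p x)"
  by (simp add: qmove_def mnodes_def mtype_def split: marker.split)

lemma mnodes_simps [simp]:
  "mnodes p (MNode v) = istar p v" "mnodes p (MArc e) = {fst e, snd e}"
  "mtype p (MNode v) = False" "mtype p (MArc e) = bd p (fst e)"
  by (simp_all add: mnodes_def mtype_def)

lemma in_istar: "is_path BE p \<Longrightarrow> u \<in> istar p v \<longleftrightarrow> u = v \<or> adj (arcs p) v u \<and> \<not> bd p u"
  using is_path_arcs[of BE p] by (auto simp: istar_def adj_def)

definition saturated :: "'v pth \<Rightarrow> nat \<Rightarrow> bool" where
  "saturated p v \<longleftrightarrow> (\<forall>\<pi>\<in>ports (lab p v). bad \<pi> \<longrightarrow> (\<exists>u. link p v \<pi> u \<and> \<not> bd p u))"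

text \<open>Interior nodes have no bad ports, so legality of the star concerns only the bad ports of
  its centre, and such a port is not free in the star exactly when an interior neighbour occupies
  it.\<close>

lemma legal_istar:
  assumes H: "higraph V E" and p: "is_path (bedges V E) p" and v: "v \<in> nds p"
  shows "legal (subpath p (istar p v)) \<longleftrightarrow> saturated p v"
proof
  assume L: "legal (subpath p (istar p v))"
  show "saturated p v"
    unfolding saturated_def
  proof (intro ballI impI)
    fix \<pi> assume \<pi>: "\<pi> \<in> ports (lab p v)" "bad \<pi>"
    have "v \<in> istar p v" by (simp add: istar_def)
    with L \<pi> have "\<not> (\<forall>u\<in>istar p v. \<not> link p v \<pi> u)"
      unfolding legal_fports fports_def free_def by blast
    then obtain u where u: "u \<in> istar p v" "link p v \<pi> u" by auto
    then show "\<exists>u. link p v \<pi> u \<and> \<not> bd p u"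
      using link_neq[OF p u(2)] in_istar[OF p] by auto
  qed
next
  assume ok: "saturated p v"
  show "legal (subpath p (istar p v))"
    unfolding legal_fports
  proof (intro ballI notI)
    fix \<pi> assume "\<pi> \<in> fports p (istar p v)" and b: "bad \<pi>"
    then obtain w where w: "w \<in> istar p v" "\<pi> \<in> ports (lab p w)"
        and fr: "\<And>u. u \<in> istar p v \<Longrightarrow> \<not> link p w \<pi> u"
      by (auto simp: fports_def free_def)
    show False
    proof (cases "w = v")
      case True
      then obtain u where "link p v \<pi> u" "\<not> bd p u" using ok w b by (auto simp: saturated_def)
      then show False using fr[of u] True in_istar[OF p] link_adj by metis
    next
      case False
      then have "\<not> bd p w" "w \<in> nds p" using w(1) in_istar[OF p] by (auto simp: istar_def)
      then show False using bad_interior[OF H p _ _ w(2)] b by simp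
    qed
  qed
qed

lemma valid_node:
  assumes "higraph V E" "is_path (bedges V E) p"
  shows "valid_marker p (MNode v) \<longleftrightarrow> v \<in> nds p \<and> bd p v \<and> saturated p v"
  using legal_istar[OF assms] by (auto simp: valid_marker_def)

lemma valid_arc: "valid_marker p (MArc e) \<longleftrightarrow> e \<in> arcs p \<and> bd p (fst e) = bd p (snd e)"
  by (simp add: valid_marker_def)

lemma valid_markers: "valid_marker p x \<Longrightarrow> x \<in> markers p"
  by (auto simp: valid_marker_def markers_def split: marker.splits)

lemma finite_markers: "is_path BE p \<Longrightarrow> finite (markers p)"
  using is_path_finite[of BE p] by (simp add: markers_def)

lemma mnodes_props:
  assumes p: "is_path BE p" and x: "valid_marker p x"
  shows "mnodes p x \<subseteq> nds p" "mnodes p x \<noteq> {}" "conn (arcs p) (mnodes p x)" "finite (mnodes p x)"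
proof -
  show "conn (arcs p) (mnodes p x)"
  proof (cases x)
    case (MNode v)
    then show ?thesis using in_istar[OF p, of _ v] by (auto intro: conn_Union[of v])
  next
    case (MArc e)
    then have "adj (arcs p) (fst e) (snd e)" using x by (auto simp: valid_arc adj_def)
    then show ?thesis using MArc by (auto intro: conn_Union[of "fst e"])
  qed
  show "mnodes p x \<noteq> {}" by (cases x) (auto simp: istar_def)
  show s: "mnodes p x \<subseteq> nds p"
    using x is_path_arcs[OF p] by (cases x) (auto simp: istar_def valid_marker_def)
  show "finite (mnodes p x)" using s is_path_finite[OF p] finite_subset by auto
qed

lemma move_qmap:
  assumes "is_path BE p" "valid_marker p x"
  shows "qmap (gm p x) p (qmove p x)"
  unfolding qmove_contract by (rule contract_qmap(1)[OF assms(1) mnodes_props(1-3)[OF assms]])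

lemma gm_eq_iff:
  assumes "is_path BE p" "valid_marker p x"
  shows "gm p x a = gm p x b \<longleftrightarrow> a = b \<or> a \<in> mnodes p x \<and> b \<in> mnodes p x"
  by (rule cmap_eq_iff[OF mnodes_props(4,2)[OF assms]])

lemma gm_outside: "a \<notin> mnodes p x \<Longrightarrow> gm p x a = a"
  by (simp add: cmap_def)

lemma lab_outside: "a \<notin> mnodes p x \<Longrightarrow> finite (mnodes p x) \<Longrightarrow> mnodes p x \<noteq> {} \<Longrightarrow> lab (qmove p x) a = lab p a"
  using Min_in[of "mnodes p x"] by (cases "a = Min (mnodes p x)") (simp_all add: qmove_contract contract_simps)

text \<open>One formula for all moves: an arrow move joins nodes of equal type and keeps the type,
  and in a star move the centre is the only boundary node, which becomes interior.\<close>

lemma move_bmu: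
  assumes p: "is_path BE p" and x: "valid_marker p x" and u: "u \<in> nds p"
  shows "bd (qmove p x) (gm p x u) \<longleftrightarrow> bd p u \<and> x \<noteq> MNode u"
  unfolding qmove_contract contract_qmap(2)[OF p mnodes_props(1-3)[OF p x] u]
proof (cases x)
  case (MNode v)
  then show "(if u \<in> mnodes p x then mtype p x else bd p u) = (bd p u \<and> x \<noteq> MNode u)"
    using in_istar[OF p, of u v] by auto
next
  case (MArc e)
  then show "(if u \<in> mnodes p x then mtype p x else bd p u) = (bd p u \<and> x \<noteq> MNode u)"
    using x by (auto simp: valid_arc)
qed

lemma move_path:
  assumes H: "higraph V E" and p: "is_path (bedges V E) p" and x: "valid_marker p x"
  shows "is_path (bedges V E) (qmove p x)"
  unfolding path_iff[OF H]
proof (intro conjI ballI)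
  note q = move_qmap[OF p x]
  show "prepath E (qmove p x)" by (rule qmap_prepath[OF H path_prepath[OF H p] q])
  note mp = mnodes_props[OF p x]
  fix n assume "n \<in> nds (qmove p x)"
  then obtain u where u: "u \<in> nds p" "n = gm p x u" using qmap_nds[OF q] by auto
  show "typed (lab (qmove p x) n)"
  proof (cases "u \<in> mnodes p x")
    case False
    then show ?thesis using u path_typed[OF H p u(1)] lab_outside[OF False mp(4,2)] by (simp add: gm_outside)
  next
    case True
    then have n: "n = Min (mnodes p x)" using u by (simp add: cmap_def)
    have P: "ports (lab (qmove p x) n) = fports p (mnodes p x)" and m: "bd (qmove p x) n = mtype p x"
      by (simp_all add: n qmove_contract contract_simps ports_subpath bmu_def)
    show ?thesis
    proof (cases x)
      case (MNode v)
      then have "legal (subpath p (mnodes p x))" using x by (simp add: valid_marker_def)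
      then show ?thesis using P m MNode by (simp add: typed_def legal_fports)
    next
      case (MArc e)
      have t: "typed (lab p w)" if "w \<in> mnodes p x" for w using path_typed[OF H p] mp(1) that by auto
      have "bd p w = mtype p x" if "w \<in> mnodes p x" for w using that MArc x by (auto simp: valid_arc)
      then show ?thesis using t m unfolding typed_def P by (auto simp: fports_def free_def)
    qed
  qed
qed

text \<open>The number of boundary nodes tells the kinds of markers apart: exactly one in a star,
  namely its centre, but none or two at an arrow. Two arrows on the same pair of nodes coincide by
  \<open>tree_cross\<close>.\<close>

lemma mnodes_inj:
  assumes p: "is_path BE p" and x: "valid_marker p x" and y: "valid_marker p y" and e: "mnodes p x = mnodes p y"
  shows "x = y"
proof -
  have star: "{u \<in> istar p v. bd p u} = {v}" if "valid_marker p (MNode v)" for v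
    using that in_istar[OF p] by (auto simp: valid_marker_def)
  have arc: "{u \<in> {fst e, snd e}. bd p u} \<noteq> {v}" if "valid_marker p (MArc e)" for e v
  proof -
    have e: "fst e \<noteq> snd e" "bd p (fst e) = bd p (snd e)"
      using that tree_irrefl[OF is_path_tree[OF p], of "fst e"] by (cases e; auto simp: valid_arc)+
    then have "{u \<in> {fst e, snd e}. bd p u} = (if bd p (fst e) then {fst e, snd e} else {})" by auto
    then show ?thesis using e(1) by (auto simp: doubleton_eq_iff)
  qed
  show ?thesis
  proof (cases x)
    case v: (MNode v)
    show ?thesis
    proof (cases y)
      case (MNode w)
      then have "{v} = {w}" using star[of v] star[of w] x y v e by (metis mnodes_simps(1))
      then show ?thesis using v MNode by simp
    next
      case (MArc a)
      then show ?thesis using star[of v] arc[of a v] x y v e by (metis mnodes_simps(1,2))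
    qed
  next
    case a: (MArc a)
    show ?thesis
    proof (cases y)
      case (MNode w)
      then show ?thesis using star[of w] arc[of a w] x y a e by (metis mnodes_simps(1,2))
    next
      case b: (MArc b)
      have ab: "a \<in> arcs p" "b \<in> arcs p" using x y a b by (auto simp: valid_arc)
      have ne: "fst a \<noteq> snd a" using ab(1) tree_irrefl[OF is_path_tree[OF p]] by (metis prod.collapse)
      have ad: "{fst a} \<subseteq> nds p" "{snd a} \<subseteq> nds p" using ab is_path_arcs[OF p] by auto
      have "fst b = fst a \<and> snd b = snd a \<or> fst b = snd a \<and> snd b = fst a"
        using e a b ne by (auto simp: doubleton_eq_iff)
      then have "b \<in> {fst a} \<times> {snd a} \<union> {snd a} \<times> {fst a}" unfolding Un_iff mem_Times_iff by simp
      then have "a = b"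
        using tree_cross[OF is_path_tree[OF p] ad(1) conn_singleton ad(2) conn_singleton _ ab(1) _ ab(2)] ne
        by (simp add: mem_Times_iff)
      then show ?thesis using a b by simp
    qed
  qed
qed

section \<open>Markers and moves under isomorphism\<close>

definition map_marker :: "(nat \<Rightarrow> nat) \<Rightarrow> marker \<Rightarrow> marker" where
  "map_marker f x = (case x of MNode v \<Rightarrow> MNode (f v) | MArc e \<Rightarrow> MArc (f (fst e), f (snd e)))"

lemma map_marker_simps [simp]: "map_marker f (MNode v) = MNode (f v)" "map_marker f (MArc e) = MArc (f (fst e), f (snd e))"
  by (simp_all add: map_marker_def)

lemma isom_path:
  assumes H: "higraph V E" and f: "isom f p q" and p: "is_path (bedges V E) p" and q: "arcs q \<subseteq> nds q \<times> nds q"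
  shows "is_path (bedges V E) q"
proof -
  have "nds q = f ` nds p" using f by (auto simp: isom_def bij_betw_def)
  then have "\<forall>v\<in>nds q. typed (lab q v)"
    using f path_typed[OF H p] by (auto simp: isom_def)
  then show ?thesis
    using qmap_prepath[OF H path_prepath[OF H p] isom_qmap[OF f p q]] path_iff[OF H] by auto
qed

lemma isom_adj:
  assumes "isom f p q" "u \<in> nds p" "v \<in> nds p"
  shows "adj (arcs q) (f u) (f v) \<longleftrightarrow> adj (arcs p) u v"
  using assms by (auto simp: isom_def adj_def)

lemma isom_bd: "isom f p q \<Longrightarrow> v \<in> nds p \<Longrightarrow> bd q (f v) = bd p v"
  by (simp add: isom_def)

lemma isom_istar:
  assumes f: "isom f p q" and p: "is_path BE p" and q: "is_path BE q" and v: "v \<in> nds p"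
  shows "istar q (f v) = f ` istar p v"
proof (intro set_eqI iffI)
  have b: "f ` nds p = nds q" using f by (auto simp: isom_def bij_betw_def)
  have sub: "istar p v \<subseteq> nds p" using v by (auto simp: istar_def)
  have "f v \<in> nds q" using b v by auto
  then have sub': "istar q (f v) \<subseteq> nds q" by (auto simp: istar_def)
  fix n
  show "n \<in> f ` istar p v" if n: "n \<in> istar q (f v)"
  proof -
    obtain u where u: "u \<in> nds p" "n = f u" using sub' n b by auto
    have "f u = f v \<longleftrightarrow> u = v" using f u v by (auto simp: isom_def bij_betw_def dest: inj_onD)
    then have "u \<in> istar p v"
      using n in_istar[OF q, of n "f v"] in_istar[OF p, of u v] isom_adj[OF f v u(1)] isom_bd[OF f u(1)] u by auto
    then show ?thesis using u by auto
  qed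
  show "n \<in> istar q (f v)" if n: "n \<in> f ` istar p v"
  proof -
    obtain u where u: "u \<in> istar p v" "n = f u" using n by auto
    have uN: "u \<in> nds p" using u sub by auto
    then show ?thesis
      using u in_istar[OF q, of n "f v"] in_istar[OF p, of u v] isom_adj[OF f v uN] isom_bd[OF f uN] by auto
  qed
qed

lemma isom_fports:
  assumes H: "higraph V E" and f: "isom f p q" and p: "is_path (bedges V E) p" and q: "is_path (bedges V E) q"
    and S: "S \<subseteq> nds p"
  shows "fports q (f ` S) = fports p S"
proof -
  have b: "f ` nds p = nds q" and inj: "inj_on f (nds p)" using f by (auto simp: isom_def bij_betw_def)
  have "{v\<in>nds p. f v \<in> f ` S} = S" using S inj by (auto dest: inj_onD)
  moreover have "f ` S \<subseteq> nds q" using b S by auto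
  ultimately show ?thesis
    using qmap_fports[OF H path_prepath[OF H p] isom_qmap[OF f p is_path_arcs[OF q]], of "f ` S"] by simp
qed

lemma isom_marker:
  assumes H: "higraph V E" and f: "isom f p q" and p: "is_path (bedges V E) p" and q: "is_path (bedges V E) q"
    and x: "valid_marker p x"
  shows "valid_marker q (map_marker f x)" "mnodes q (map_marker f x) = f ` mnodes p x"
proof -
  have s: "mnodes p x \<subseteq> nds p" by (rule mnodes_props(1)[OF p x])
  show ms: "mnodes q (map_marker f x) = f ` mnodes p x"
    using isom_istar[OF f p q] x by (cases x) (auto simp: valid_marker_def)
  show "valid_marker q (map_marker f x)"
  proof (cases x)
    case (MNode v)
    have v: "v \<in> nds p" "bd p v" "legal (subpath p (istar p v))" using x MNode by (auto simp: valid_marker_def)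
    have "f v \<in> nds q" using f v by (auto simp: isom_def bij_betw_def)
    moreover have "fports q (istar q (f v)) = fports p (istar p v)"
      using isom_fports[OF H f p q s] ms MNode by simp
    ultimately show ?thesis using v isom_bd[OF f v(1)] MNode by (simp add: valid_marker_def legal_fports)
  next
    case (MArc e)
    then have e: "e \<in> arcs p" "bd p (fst e) = bd p (snd e)" using x by (auto simp: valid_arc)
    then have N: "fst e \<in> nds p" "snd e \<in> nds p" using is_path_arcs[OF p] by auto
    have "(f (fst e), f (snd e)) \<in> arcs q" using f e(1) N unfolding isom_def by (metis prod.collapse)
    then show ?thesis using e isom_bd[OF f] N MArc by (simp add: valid_arc)
  qed
qed

text \<open>Both results are quotients of \<open>p\<close>, the second one by way of
  \<open>q\<close>, so it suffices to compare kernels and flags.\<close>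

lemma isom_move:
  assumes H: "higraph V E" and f: "isom f p q" and p: "is_path (bedges V E) p" and q: "is_path (bedges V E) q"
    and x: "valid_marker p x"
  shows "\<exists>h. isom h (qmove p x) (qmove q (map_marker f x))"
proof -
  note x' = isom_marker[OF H f p q x]
  have fN: "f ` nds p = nds q" and inj: "inj_on f (nds p)" using f by (auto simp: isom_def bij_betw_def)
  have qm: "qmap (gm q (map_marker f x) \<circ> f) p (qmove q (map_marker f x))"
    by (rule qmap_comp[OF H path_prepath[OF H p] isom_qmap[OF f p is_path_arcs[OF q]] move_qmap[OF q x'(1)]])
  have "\<exists>h. isom h (qmove p x) (qmove q (map_marker f x)) \<and> True"
  proof (rule qmap_unique[OF move_qmap[OF p x] qm is_path_arcs[OF p]])
    fix a b assume ab: "a \<in> nds p" "b \<in> nds p"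
    have "f a \<in> f ` mnodes p x \<longleftrightarrow> a \<in> mnodes p x" if "a \<in> nds p" for a
      using inj that mnodes_props(1)[OF p x] by (auto dest: inj_onD)
    moreover have "f a = f b \<longleftrightarrow> a = b" using inj ab by (auto dest: inj_onD)
    ultimately show "gm p x a = gm p x b \<longleftrightarrow> (gm q (map_marker f x) \<circ> f) a = (gm q (map_marker f x) \<circ> f) b"
      using ab by (simp add: gm_eq_iff[OF p x] gm_eq_iff[OF q x'(1), unfolded x'(2)] x'(2))
  next
    fix a assume a: "a \<in> nds p"
    then have fa: "f a \<in> nds q" using fN by auto
    have "map_marker f x = MNode (f a) \<longleftrightarrow> x = MNode a"
      using a inj x by (cases x) (auto simp: valid_marker_def dest: inj_onD)
    then show "bd (qmove p x) (gm p x a) = bd (qmove q (map_marker f x)) ((gm q (map_marker f x) \<circ> f) a)"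
      using move_bmu[OF p x a] move_bmu[OF q x'(1) fa] isom_bd[OF f a] by simp
  qed blast
  then show ?thesis by simp
qed

section \<open>Pairs of successive moves\<close>

text \<open>The kernel of the contraction of \<open>S\<close> followed by that of the image of \<open>R\<close>.\<close>

definition glue_ker :: "'a set \<Rightarrow> 'a set \<Rightarrow> 'a \<Rightarrow> 'a \<Rightarrow> bool" where
  "glue_ker S R a b \<longleftrightarrow> a = b \<or> a \<in> S \<and> b \<in> S \<or> a \<in> R \<and> b \<in> R \<or> S \<inter> R \<noteq> {} \<and> a \<in> S \<union> R \<and> b \<in> S \<union> R"

lemma glue_ker_commute: "glue_ker S R a b \<longleftrightarrow> glue_ker R S a b"
  unfolding glue_ker_def by (auto simp: Int_commute)

lemma double_ker:
  assumes p: "is_path BE p" and x: "valid_marker p x"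
    and q: "is_path BE' (qmove p x)" and x': "valid_marker (qmove p x) x'"
    and S: "mnodes (qmove p x) x' = gm p x ` S"
  shows "(gm (qmove p x) x' \<circ> gm p x) a = (gm (qmove p x) x' \<circ> gm p x) b \<longleftrightarrow> glue_ker (mnodes p x) S a b"
proof -
  have m: "gm p x c \<in> gm p x ` S \<longleftrightarrow> c \<in> S \<or> c \<in> mnodes p x \<and> mnodes p x \<inter> S \<noteq> {}" for c
    using gm_eq_iff[OF p x, of c] by (auto simp: image_iff)
  show ?thesis
    unfolding comp_def gm_eq_iff[OF q x'] unfolding S m gm_eq_iff[OF p x] glue_ker_def by auto
qed

text \<open>Both double moves are quotients of \<open>p\<close>, compared by kernel and flag.
  \<open>S\<close> and \<open>R\<close> are sets of nodes of \<open>p\<close> whose images are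
  contracted in the second step; only the images are prescribed. A boundary node loses its type only
  as the centre of a star, in the first step or in the second, which is what \<open>mu\<close>
  compares.\<close>

lemma double_isom:
  assumes H: "higraph V E" and p: "is_path (bedges V E) p"
    and x: "valid_marker p x" and x': "valid_marker (qmove p x) x'" "mnodes (qmove p x) x' = gm p x ` S"
    and y: "valid_marker p y" and y': "valid_marker (qmove p y) y'" "mnodes (qmove p y) y' = gm p y ` R"
    and ker: "\<And>a b. a \<in> nds p \<Longrightarrow> b \<in> nds p \<Longrightarrow> glue_ker (mnodes p x) S a b \<longleftrightarrow> glue_ker (mnodes p y) R a b"
    and mu: "\<And>u. u \<in> nds p \<Longrightarrow> bd p u \<Longrightarrow>
        x = MNode u \<or> x' = MNode (gm p x u) \<longleftrightarrow> y = MNode u \<or> y' = MNode (gm p y u)"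
  shows "\<exists>h. isom h (qmove (qmove p x) x') (qmove (qmove p y) y')"
proof -
  note px = move_path[OF H p x] and py = move_path[OF H p y]
  note qx = move_qmap[OF p x] and qy = move_qmap[OF p y]
  note cx = qmap_comp[OF H path_prepath[OF H p] qx move_qmap[OF px x'(1)]]
  note cy = qmap_comp[OF H path_prepath[OF H p] qy move_qmap[OF py y'(1)]]
  have "\<exists>h. isom h (qmove (qmove p x) x') (qmove (qmove p y) y') \<and> True"
  proof (rule qmap_unique[OF cx cy is_path_arcs[OF p]])
    fix a b assume "a \<in> nds p" "b \<in> nds p"
    then show "(gm (qmove p x) x' \<circ> gm p x) a = (gm (qmove p x) x' \<circ> gm p x) b \<longleftrightarrow>
        (gm (qmove p y) y' \<circ> gm p y) a = (gm (qmove p y) y' \<circ> gm p y) b"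
      unfolding double_ker[OF p x px x'] double_ker[OF p y py y'] by (rule ker)
  next
    fix u assume u: "u \<in> nds p"
    then have "gm p x u \<in> nds (qmove p x)" "gm p y u \<in> nds (qmove p y)"
      using qmap_nds[OF qx] qmap_nds[OF qy] by auto
    then show "bd (qmove (qmove p x) x') ((gm (qmove p x) x' \<circ> gm p x) u) =
        bd (qmove (qmove p y) y') ((gm (qmove p y) y' \<circ> gm p y) u)"
      using mu[OF u] by (auto simp: move_bmu[OF px x'(1)] move_bmu[OF py y'(1)] move_bmu[OF p x u] move_bmu[OF p y u])
  qed blast
  then show ?thesis by simp
qed

lemma move_adj:
  assumes "is_path BE p" "valid_marker p x"
  shows "adj (arcs (qmove p x)) m n \<longleftrightarrow> m \<noteq> n \<and> (\<exists>v u. adj (arcs p) v u \<and> gm p x v = m \<and> gm p x u = n)"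
  unfolding qmap_arcs[OF move_qmap[OF assms]]
  by (auto simp: adj_def elim!: qarcsE intro: qarcsI)

lemma move_link:
  assumes "higraph V E" "is_path (bedges V E) p" "valid_marker p x"
  shows "link (qmove p x) m \<pi> n \<longleftrightarrow> m \<noteq> n \<and> (\<exists>v u. link p v \<pi> u \<and> gm p x v = m \<and> gm p x u = n)"
  by (rule qmap_link[OF assms(1) path_prepath[OF assms(1,2)] move_qmap[OF assms(2,3)]])

text \<open>Two moves interfere exactly when both come from one arrow between boundary nodes: contracting
  that arrow, or an interior star at one of its ends.\<close>

definition interfering :: "'v pth \<Rightarrow> marker \<Rightarrow> marker \<Rightarrow> bool" where
  "interfering p x y \<longleftrightarrow> (\<exists>v w. adj (arcs p) v w \<and> bd p v \<and> bd p w \<and>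
     x \<in> {MNode v, MNode w, MArc (v, w), MArc (w, v)} \<and> y \<in> {MNode v, MNode w, MArc (v, w), MArc (w, v)})"

lemma interfering_sym: "interfering p x y \<longleftrightarrow> interfering p y x"
  unfolding interfering_def by blast

lemma interferingI:
  "adj (arcs p) v w \<Longrightarrow> bd p v \<Longrightarrow> bd p w \<Longrightarrow> x \<in> {MNode v, MNode w, MArc (v, w), MArc (w, v)} \<Longrightarrow>
     y \<in> {MNode v, MNode w, MArc (v, w), MArc (w, v)} \<Longrightarrow> interfering p x y"
  unfolding interfering_def by blast

definition indep :: "'v pth \<Rightarrow> (marker \<times> marker) set" where
  "indep p = {(x, y). valid_marker p x \<and> valid_marker p y \<and> x \<noteq> y \<and> \<not> interfering p x y}"

lemma move_node:
  assumes H: "higraph V E" and p: "is_path (bedges V E) p" and x: "valid_marker p x"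
    and w: "w \<in> nds p" "w \<notin> mnodes p x"
  shows "gm p x w = w" "w \<in> nds (qmove p x)" "lab (qmove p x) w = lab p w"
    and "gm p x u = w \<longleftrightarrow> u = w"
    and "link (qmove p x) w \<pi> n \<longleftrightarrow> (\<exists>u. link p w \<pi> u \<and> gm p x u = n)"
    and "adj (arcs (qmove p x)) w n \<longleftrightarrow> (\<exists>u. adj (arcs p) w u \<and> gm p x u = n)"
proof -
  show g: "gm p x w = w" using w by (simp add: gm_outside)
  show "w \<in> nds (qmove p x)" using g w qmap_nds[OF move_qmap[OF p x]] by force
  show "lab (qmove p x) w = lab p w" by (rule lab_outside[OF w(2) mnodes_props(4,2)[OF p x]])
  show e: "gm p x u = w \<longleftrightarrow> u = w" for u using gm_eq_iff[OF p x, of u w] g w by auto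
  show "link (qmove p x) w \<pi> n \<longleftrightarrow> (\<exists>u. link p w \<pi> u \<and> gm p x u = n)"
    unfolding move_link[OF H p x] using e link_neq[OF p, of w \<pi> w] by metis
  show "adj (arcs (qmove p x)) w n \<longleftrightarrow> (\<exists>u. adj (arcs p) w u \<and> gm p x u = n)"
    unfolding move_adj[OF p x] using e link_neq[OF p] adj_link[of p w w] by metis
qed

text \<open>Away from the contracted set the ports of \<open>w\<close> are unchanged, and a
  neighbour \<open>u\<close> turns interior only through the star move centred at \<open>u\<close>
  itself.\<close>

lemma move_saturated:
  assumes H: "higraph V E" and p: "is_path (bedges V E) p" and x: "valid_marker p x"
    and w: "w \<in> nds p" "w \<notin> mnodes p x"
  shows "saturated (qmove p x) w \<longleftrightarrow>
    (\<forall>\<pi>\<in>ports (lab p w). bad \<pi> \<longrightarrow> (\<exists>u. link p w \<pi> u \<and> (bd p u \<longrightarrow> x = MNode u)))"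
proof -
  have "(\<exists>n. link (qmove p x) w \<pi> n \<and> \<not> bd (qmove p x) n) \<longleftrightarrow>
      (\<exists>u. link p w \<pi> u \<and> (bd p u \<longrightarrow> x = MNode u))" for \<pi>
    unfolding move_node(5)[OF H p x w]
    using link_nds[OF p] move_bmu[OF p x] by (metis (no_types, lifting))
  then show ?thesis unfolding saturated_def move_node(3)[OF H p x w] by simp
qed

text \<open>Moves that do not interfere leave each other applicable. An arrow \<open>y\<close> is
  not swallowed: distinct markers contract distinct sets, and a star containing both ends of
  \<open>y\<close> would produce a triangle or an arrow between ends of different type. A centre
  \<open>w\<close> is not swallowed either, and no neighbour of \<open>w\<close> changes its type,
  since \<open>x\<close> would then be a star at a boundary neighbour of \<open>w\<close>. Hence the
  interior star of \<open>w\<close> is simply carried along.\<close>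

lemma lift_marker:
  assumes H: "higraph V E" and p: "is_path (bedges V E) p" and xy: "(x, y) \<in> indep p"
  shows "valid_marker (qmove p x) (map_marker (gm p x) y)"
    and "mnodes (qmove p x) (map_marker (gm p x) y) = gm p x ` mnodes p y"
    and "u \<in> nds p \<Longrightarrow> map_marker (gm p x) y = MNode (gm p x u) \<longleftrightarrow> y = MNode u"
proof -
  have x: "valid_marker p x" and y: "valid_marker p y" and ne: "x \<noteq> y" and nc: "\<not> interfering p x y"
    using xy by (auto simp: indep_def)
  note q = move_path[OF H p x]
  have "valid_marker (qmove p x) (map_marker (gm p x) y) \<and> mnodes (qmove p x) (map_marker (gm p x) y) = gm p x ` mnodes p y \<and>
    (\<forall>u\<in>nds p. map_marker (gm p x) y = MNode (gm p x u) \<longleftrightarrow> y = MNode u)"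
  proof (cases y)
    case (MArc e)
    obtain a b where e: "e = (a, b)" by (cases e)
    have ab: "(a, b) \<in> arcs p" "bd p a = bd p b" using y MArc e by (auto simp: valid_arc)
    have adj: "adj (arcs p) a b" "adj (arcs p) b a" using ab by (auto simp: adj_def)
    have N: "a \<in> nds p" "b \<in> nds p" using ab is_path_arcs[OF p] by auto
    have nab: "a \<noteq> b" using ab tree_irrefl[OF is_path_tree[OF p]] by auto
    have "\<not> (a \<in> mnodes p x \<and> b \<in> mnodes p x)"
    proof (cases x)
      case (MNode v)
      have v: "bd p v" using x MNode by (simp add: valid_marker_def)
      show ?thesis
        using in_istar[OF p, of a v] in_istar[OF p, of b v] v ab nab no_triangle[OF p, of v a b] MNode adj
        by auto
    next
      case (MArc e')
      show ?thesis
      proof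
        assume "a \<in> mnodes p x \<and> b \<in> mnodes p x"
        then have "mnodes p x = mnodes p y" using nab \<open>y = MArc e\<close> e MArc by auto
        then show False using mnodes_inj[OF p x y] ne by simp
      qed
    qed
    then have gab: "gm p x a \<noteq> gm p x b" using gm_eq_iff[OF p x] nab by simp
    have "(gm p x a, gm p x b) \<in> arcs (qmove p x)"
      using qarcsI[of a b "arcs p" "gm p x"] ab gab qmap_arcs[OF move_qmap[OF p x]] by simp
    moreover have "bd (qmove p x) (gm p x a) = bd (qmove p x) (gm p x b)"
      unfolding move_bmu[OF p x N(1)] move_bmu[OF p x N(2)]
      using ab nc MArc e interferingI[OF adj(1), of x y] by auto
    ultimately show ?thesis using MArc e by (simp add: valid_arc)
  next
    case (MNode w)
    have w: "w \<in> nds p" "bd p w" "saturated p w" using y MNode valid_node[OF H p] by auto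
    have wx: "w \<notin> mnodes p x"
    proof (cases x)
      case (MNode v)
      then show ?thesis using in_istar[OF p, of w v] w ne \<open>y = MNode w\<close> by auto
    next
      case (MArc e)
      show ?thesis
      proof
        assume "w \<in> mnodes p x"
        moreover have e: "e \<in> arcs p" "bd p (fst e) = bd p (snd e)" using x MArc by (auto simp: valid_arc)
        moreover have "adj (arcs p) (fst e) (snd e)" using e by (simp add: adj_def)
        ultimately show False
          using nc interferingI[of p "fst e" "snd e" x y] MArc MNode w by auto
      qed
    qed
    note mn = move_node[OF H p x w(1) wx]
    have xw: "x \<noteq> MNode w" using ne MNode by simp
    have c: "x \<noteq> MNode u" if "adj (arcs p) w u" "bd p u" for u
      using interferingI[OF that(1) w(2) that(2), of x y] nc MNode by auto
    have "valid_marker (qmove p x) (MNode w)"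
      unfolding valid_node[OF H q] move_saturated[OF H p x w(1) wx]
      using mn w by (auto simp: saturated_def)
    moreover have "istar (qmove p x) w = gm p x ` istar p w"
    proof (intro set_eqI)
      fix n
      have "n \<in> istar (qmove p x) w \<longleftrightarrow> n = w \<or> (\<exists>u. adj (arcs p) w u \<and> gm p x u = n) \<and> \<not> bd (qmove p x) n"
        using in_istar[OF q] mn(6) by simp
      also have "\<dots> \<longleftrightarrow> n = w \<or> (\<exists>u. adj (arcs p) w u \<and> \<not> bd p u \<and> gm p x u = n)"
      proof -
        have "\<not> bd (qmove p x) (gm p x u) \<longleftrightarrow> \<not> bd p u" if "adj (arcs p) w u" for u
        proof -
          have "u \<in> nds p" using that is_path_arcs[OF p] by (auto simp: adj_def)
          then show ?thesis using move_bmu[OF p x] c[OF that] by auto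
        qed
        then show ?thesis by metis
      qed
      also have "\<dots> \<longleftrightarrow> n \<in> gm p x ` istar p w"
        unfolding image_iff Bex_def in_istar[OF p, of _ w] using mn(1) by metis
      finally show "n \<in> istar (qmove p x) w \<longleftrightarrow> n \<in> gm p x ` istar p w" .
    qed
    moreover have "w = gm p x u \<longleftrightarrow> w = u" for u using mn(4)[of u] by metis
    ultimately show ?thesis by (simp add: MNode mn(1))
  qed
  then show "valid_marker (qmove p x) (map_marker (gm p x) y)"
    "mnodes (qmove p x) (map_marker (gm p x) y) = gm p x ` mnodes p y"
    "u \<in> nds p \<Longrightarrow> map_marker (gm p x) y = MNode (gm p x u) \<longleftrightarrow> y = MNode u" by auto
qed

lemma indep_sym: "(x, y) \<in> indep p \<longleftrightarrow> (y, x) \<in> indep p"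
  using interfering_sym[of p x y] by (auto simp: indep_def)

lemma indep_swap:
  assumes H: "higraph V E" and p: "is_path (bedges V E) p" and xy: "(x, y) \<in> indep p"
  shows "\<exists>h. isom h (qmove (qmove p x) (map_marker (gm p x) y)) (qmove (qmove p y) (map_marker (gm p y) x))"
proof -
  have yx: "(y, x) \<in> indep p" using xy indep_sym by auto
  have x: "valid_marker p x" and y: "valid_marker p y" using xy by (auto simp: indep_def)
  note lx = lift_marker[OF H p xy] and ly = lift_marker[OF H p yx]
  show ?thesis
  proof (rule double_isom[OF H p x lx(1,2) y ly(1,2)])
    show "glue_ker (mnodes p x) (mnodes p y) a b \<longleftrightarrow> glue_ker (mnodes p y) (mnodes p x) a b" for a b
      by (rule glue_ker_commute)
    show "x = MNode u \<or> map_marker (gm p x) y = MNode (gm p x u) \<longleftrightarrow> y = MNode u \<or> map_marker (gm p y) x = MNode (gm p y u)"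
      if "u \<in> nds p" for u
      using lx(3)[OF that] ly(3)[OF that] by auto
  qed
qed

text \<open>For arrows this is the injectivity on crossing arrows from
  \<open>tree_quot\<close>.\<close>

lemma lift_inj:
  assumes H: "higraph V E" and p: "is_path (bedges V E) p" and y: "(x, y) \<in> indep p" "(x, z) \<in> indep p"
    and e: "map_marker (gm p x) y = map_marker (gm p x) z"
  shows "y = z"
proof (cases y)
  case (MNode w)
  then have "w \<in> nds p" using y by (auto simp: indep_def valid_marker_def)
  then show ?thesis using lift_marker(3)[OF H p y(2), of w] e MNode by auto
next
  case (MArc a)
  then obtain b where z: "z = MArc b" using e by (cases z) auto
  have x: "valid_marker p x" and v: "valid_marker p y" "valid_marker p z" using y by (auto simp: indep_def)
  have va: "a \<in> arcs p" "b \<in> arcs p" using v MArc z by (auto simp: valid_arc)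
  have "valid_marker (qmove p x) (MArc (gm p x (fst a), gm p x (snd a)))"
    using lift_marker(1)[OF H p y(1)] MArc by simp
  then have ne: "gm p x (fst a) \<noteq> gm p x (snd a)"
    using tree_irrefl[OF is_path_tree[OF move_path[OF H p x]]] by (auto simp: valid_arc)
  have ee: "gm p x (fst a) = gm p x (fst b)" "gm p x (snd a) = gm p x (snd b)" using e MArc z by auto
  note q = move_qmap[OF p x]
  have "inj_on (map_prod (gm p x) (gm p x)) {e\<in>arcs p. gm p x (fst e) \<noteq> gm p x (snd e)}"
    using tree_quot(2)[OF is_path_tree[OF p], of "gm p x"] qmap_conn[OF q] qmap_nds[OF q] by blast
  then have "a = b"
    using va ne ee by (auto dest!: inj_onD[of _ _ a b] simp: map_prod_def split_beta)
  then show ?thesis using MArc z by simp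
qed

lemma adj_neq: "is_path BE p \<Longrightarrow> adj (arcs p) v w \<Longrightarrow> v \<noteq> w"
  using adj_link[of p v w] link_neq[of BE p v] by metis

lemma adj_nds: "is_path BE p \<Longrightarrow> adj (arcs p) v w \<Longrightarrow> v \<in> nds p \<and> w \<in> nds p"
  using is_path_arcs[of BE p] by (auto simp: adj_def)

text \<open>Arrows of the contracted path always lift. A second star that does not lift is centred
  either at a boundary neighbour of the first centre, which may have become saturated because that
  centre turned interior, or at the node that arose from an arrow between boundary nodes.\<close>

lemma lift_surj:
  assumes H: "higraph V E" and p: "is_path (bedges V E) p" and x: "valid_marker p x"
    and y': "valid_marker (qmove p x) y'"
  shows "(\<exists>y. (x, y) \<in> indep p \<and> y' = map_marker (gm p x) y) \<or>
    (\<exists>v w. adj (arcs p) v w \<and> bd p v \<and> bd p w \<and>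
      (x = MNode v \<and> y' = MNode w \<or> x \<in> {MArc (v, w), MArc (w, v)} \<and> y' = MNode (gm p x v)))"
proof (cases y')
  case (MArc e')
  note q = move_qmap[OF p x]
  have e': "e' \<in> arcs (qmove p x)" "bd (qmove p x) (fst e') = bd (qmove p x) (snd e')"
    using y' MArc by (auto simp: valid_arc)
  then obtain a b where ab: "(a, b) \<in> arcs p" "gm p x a = fst e'" "gm p x b = snd e'" "fst e' \<noteq> snd e'"
    unfolding qmap_arcs[OF q] by (cases e') (auto elim: qarcsE)
  have N: "a \<in> nds p" "b \<in> nds p" using ab is_path_arcs[OF p] by auto
  have adj: "adj (arcs p) a b" "adj (arcs p) b a" using ab by (auto simp: adj_def)
  have mu: "bd p a \<and> x \<noteq> MNode a \<longleftrightarrow> bd p b \<and> x \<noteq> MNode b"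
    using e'(2) move_bmu[OF p x N(1)] move_bmu[OF p x N(2)] ab by simp
  have nin: "\<not> (a \<in> mnodes p x \<and> b \<in> mnodes p x)"
    using gm_eq_iff[OF p x, of a b] ab by auto
  have "(x, MArc (a, b)) \<in> indep p"
  proof (cases x)
    case v: (MNode v)
    have bv: "bd p v" using x v by (simp add: valid_marker_def)
    have "a \<noteq> v"
    proof
      assume a: "a = v"
      then have "\<not> bd p b" using mu v adj_neq[OF p adj(1)] by auto
      then show False using nin v a adj in_istar[OF p] by auto
    qed
    moreover have "b \<noteq> v"
    proof
      assume b: "b = v"
      then have "\<not> bd p a" using mu v adj_neq[OF p adj(1)] by auto
      then show False using nin v b adj in_istar[OF p] by auto
    qed
    ultimately show ?thesis using v x ab mu by (auto simp: indep_def valid_arc interfering_def)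
  next
    case e: (MArc e)
    have y: "valid_marker p (MArc (a, b))" using ab mu e by (simp add: valid_arc)
    have "mnodes p x \<noteq> mnodes p (MArc (a, b))" using nin by auto
    then show ?thesis using x y e by (auto simp: indep_def interfering_def insert_commute)
  qed
  then show ?thesis using ab MArc by (intro disjI1 exI[of _ "MArc (a, b)"]) simp
next
  case n: (MNode n)
  note vq = y'[unfolded n valid_node[OF H move_path[OF H p x]]]
  then obtain w where w: "w \<in> nds p" "n = gm p x w" using qmap_nds[OF move_qmap[OF p x]] by auto
  have bw: "bd p w" "x \<noteq> MNode w" using vq w move_bmu[OF p x w(1)] by auto
  show ?thesis
  proof (cases "w \<in> mnodes p x")
    case True
    show ?thesis
    proof (cases x)
      case (MNode v)
      then show ?thesis using True bw in_istar[OF p, of w v] by auto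
    next
      case (MArc e)
      have e: "e \<in> arcs p" "bd p (fst e) = bd p (snd e)" using x MArc by (auto simp: valid_arc)
      then have adj: "adj (arcs p) (fst e) (snd e)" "adj (arcs p) (snd e) (fst e)" by (auto simp: adj_def)
      consider "w = fst e" | "w = snd e" using True MArc by auto
      then show ?thesis
      proof cases
        case 1
        then show ?thesis using adj(1) e bw w n MArc
          by (intro disjI2 exI[of _ "fst e"] exI[of _ "snd e"]) auto
      next
        case 2
        then show ?thesis using adj(2) e bw w n MArc
          by (intro disjI2 exI[of _ "snd e"] exI[of _ "fst e"]) auto
      qed
    qed
  next
    case False
    note mn = move_node[OF H p x w(1) False]
    have nw: "n = w" using w mn(1) by simp
    show ?thesis
    proof (cases "\<exists>v. x = MNode v \<and> adj (arcs p) v w")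
      case True
      then obtain v where v: "x = MNode v" "adj (arcs p) v w" by auto
      then have "bd p v" using x by (simp add: valid_marker_def)
      then show ?thesis using v bw nw n by auto
    next
      case nadj: False
      have "x \<noteq> MNode u" if "link p w \<pi> u" for \<pi> u
        using nadj link_adj[OF that] adj_sym[of "arcs p" w u] by auto
      moreover have "saturated (qmove p x) w" using vq nw by simp
      ultimately have "saturated p w"
        unfolding move_saturated[OF H p x w(1) False] by (metis saturated_def)
      then have y: "valid_marker p (MNode w)" using bw w valid_node[OF H p] by simp
      have "\<not> interfering p x (MNode w)"
      proof
        assume "interfering p x (MNode w)"
        then obtain v u where c: "adj (arcs p) v u" "x \<in> {MNode v, MNode u, MArc (v, u), MArc (u, v)}" "w = v \<or> w = u"
          unfolding interfering_def by auto
        then have "x \<in> {MNode v, MNode u}" using False by auto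
        then show False using c nadj bw(2) adj_sym[of "arcs p" v u] by auto
      qed
      then have "(x, MNode w) \<in> indep p" using x y bw(2) by (simp add: indep_def)
      then show ?thesis using n w by (intro disjI1 exI[of _ "MNode w"]) simp
    qed
  qed
qed

section \<open>Two moves at an arrow between boundary nodes\<close>

definition saturated_off :: "'v pth \<Rightarrow> nat \<Rightarrow> nat \<Rightarrow> bool" where
  "saturated_off p v w \<longleftrightarrow> (\<forall>\<pi>\<in>ports (lab p v). bad \<pi> \<longrightarrow> \<not> link p v \<pi> w \<longrightarrow> (\<exists>u. link p v \<pi> u \<and> \<not> bd p u))"

text \<open>\<open>saturated_off p v w\<close> disregards the port of \<open>v\<close> towards
  \<open>w\<close>. When \<open>w\<close> is a boundary node, no interior neighbour occupies that
  port, so the whole difference from \<open>saturated p v\<close> is whether the port is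
  bad.\<close>

lemma saturated_saturated_off:
  assumes p: "is_path BE p" and l: "link p v \<pi> w" and w: "bd p w"
  shows "saturated p v \<longleftrightarrow> saturated_off p v w \<and> \<not> bad \<pi>"
proof -
  have "\<pi> \<in> ports (lab p v)" by (rule link_ports[OF p l])
  moreover have "u = w" if "link p v \<pi> u" for u using link_fun[OF p l that] by simp
  moreover have "\<rho> = \<pi>" if "link p v \<rho> w" for \<rho> using link_uniq[OF p l that] by simp
  ultimately show ?thesis unfolding saturated_def saturated_off_def using w by metis
qed

text \<open>After the star move at \<open>v\<close> the port of \<open>w\<close> towards it leads to
  an interior node and is harmless, bad or not; the other ports of \<open>w\<close> are judged as
  before.\<close>

lemma valid_star_star:
  assumes H: "higraph V E" and p: "is_path (bedges V E) p" and adj: "adj (arcs p) v w"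
    and bd: "bd p v" "bd p w" and ok: "saturated p v"
  shows "valid_marker (qmove p (MNode v)) (MNode w) \<longleftrightarrow> saturated_off p w v"
proof -
  have N: "v \<in> nds p" "w \<in> nds p" using adj_nds[OF p adj] by auto
  have x: "valid_marker p (MNode v)" using N bd ok valid_node[OF H p] by simp
  have ne: "v \<noteq> w" by (rule adj_neq[OF p adj])
  have w: "w \<notin> mnodes p (MNode v)" using in_istar[OF p, of w v] bd ne by simp
  note mn = move_node[OF H p x N(2) w]
  have "bd (qmove p (MNode v)) w" using move_bmu[OF p x N(2)] mn(1) bd ne by simp
  then have "valid_marker (qmove p (MNode v)) (MNode w) \<longleftrightarrow> saturated (qmove p (MNode v)) w"
    using mn(2) valid_node[OF H move_path[OF H p x]] by simp
  also have "\<dots> \<longleftrightarrow> saturated_off p w v"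
    unfolding move_saturated[OF H p x N(2) w] saturated_off_def by (metis marker.inject(1))
  finally show ?thesis .
qed

text \<open>Contracting the arrow removes the two ports that it occupies, and the remaining ports of
  both ends become the ports of the new node, without overlap by \<open>free_disjoint\<close>. So
  the condition on the new node splits into one for each end.\<close>

lemma valid_arc_star:
  assumes H: "higraph V E" and p: "is_path (bedges V E) p" and e: "e \<in> arcs p"
    and bd: "bd p (fst e)" "bd p (snd e)"
  shows "valid_marker (qmove p (MArc e)) (MNode (gm p (MArc e) (fst e))) \<longleftrightarrow>
    saturated_off p (fst e) (snd e) \<and> saturated_off p (snd e) (fst e)"
proof -
  obtain v w where vw: "e = (v, w)" by (cases e)
  let ?x = "MArc e" and ?q = "qmove p (MArc e)" and ?g = "gm p (MArc e)"
  have adj: "adj (arcs p) v w" using e vw by (simp add: adj_def)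
  have N: "v \<in> nds p" "w \<in> nds p" using adj_nds[OF p adj] by auto
  have x: "valid_marker p ?x" using e bd by (simp add: valid_arc)
  have ne: "v \<noteq> w" by (rule adj_neq[OF p adj])
  note q = move_path[OF H p x] and qm = move_qmap[OF p x]
  have geq: "?g u = ?g v \<longleftrightarrow> u = v \<or> u = w" for u using gm_eq_iff[OF p x, of u v] vw by auto
  have n: "?g v \<in> nds ?q" using N qmap_nds[OF qm] by auto
  have mu: "bd ?q (?g u) = bd p u" if "u \<in> nds p" for u using move_bmu[OF p x that] by simp
  have P: "ports (lab ?q (?g v)) = free p {v, w} v \<union> free p {v, w} w"
  proof -
    have "fib ?g (nds p) (?g v) = {v, w}" using geq N by (auto simp: fib_def)
    then show ?thesis using qmap_ports[OF qm n] by (simp add: fports_def)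
  qed
  have c: "conn (arcs p) {v, w}" using mnodes_props(3)[OF p x] vw by simp
  have dj: "\<rho> \<notin> free p {v, w} w" if "\<rho> \<in> free p {v, w} v" for \<rho>
    using free_disjoint[OF H path_prepath[OF H p] _ c, of v w \<rho>] that ne N by auto
  have lk: "(\<exists>m. link ?q (?g v) \<rho> m \<and> \<not> bd ?q m) \<longleftrightarrow>
      (\<exists>u. (link p v \<rho> u \<or> link p w \<rho> u) \<and> \<not> bd p u)" for \<rho>
  proof
    assume "\<exists>m. link ?q (?g v) \<rho> m \<and> \<not> bd ?q m"
    then obtain v' u where "link p v' \<rho> u" "?g v' = ?g v" "\<not> bd ?q (?g u)"
      unfolding move_link[OF H p x] by auto
    then show "\<exists>u. (link p v \<rho> u \<or> link p w \<rho> u) \<and> \<not> bd p u"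
      using geq mu link_nds[OF p] by metis
  next
    assume "\<exists>u. (link p v \<rho> u \<or> link p w \<rho> u) \<and> \<not> bd p u"
    then obtain v' u where u: "v' = v \<or> v' = w" "link p v' \<rho> u" "\<not> bd p u" by auto
    then have "u \<noteq> v" "u \<noteq> w" using bd vw by auto
    then have "link ?q (?g v) \<rho> (?g u)"
      unfolding move_link[OF H p x] using geq u by metis
    moreover have "\<not> bd ?q (?g u)" using mu u link_nds[OF p u(2)] by simp
    ultimately show "\<exists>m. link ?q (?g v) \<rho> m \<and> \<not> bd ?q m" by auto
  qed
  have out: "u \<notin> {v, w}" if "\<not> bd p u" for u using that bd vw by auto
  have "valid_marker ?q (MNode (?g v)) \<longleftrightarrow> saturated ?q (?g v)"
    using n bd vw mu[OF N(1)] valid_node[OF H q] by simp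
  also have "\<dots> \<longleftrightarrow> (\<forall>\<rho>\<in>free p {v, w} v. bad \<rho> \<longrightarrow> (\<exists>u. link p v \<rho> u \<and> \<not> bd p u)) \<and>
      (\<forall>\<rho>\<in>free p {v, w} w. bad \<rho> \<longrightarrow> (\<exists>u. link p w \<rho> u \<and> \<not> bd p u))"
  proof -
    have "(\<exists>u. (link p v \<rho> u \<or> link p w \<rho> u) \<and> \<not> bd p u) \<longleftrightarrow> (\<exists>u. link p v \<rho> u \<and> \<not> bd p u)"
      if "\<rho> \<in> free p {v, w} v" for \<rho>
      using dj[OF that] link_free[OF p, of w \<rho> _ "{v, w}"] out by blast
    moreover have "(\<exists>u. (link p v \<rho> u \<or> link p w \<rho> u) \<and> \<not> bd p u) \<longleftrightarrow> (\<exists>u. link p w \<rho> u \<and> \<not> bd p u)"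
      if "\<rho> \<in> free p {v, w} w" for \<rho>
      using dj that link_free[OF p, of v \<rho> _ "{v, w}"] out by blast
    ultimately show ?thesis unfolding saturated_def P lk ball_Un by simp
  qed
  also have "\<dots> \<longleftrightarrow> saturated_off p v w \<and> saturated_off p w v"
  proof -
    have "\<not> link p v \<rho> v" "\<not> link p w \<rho> w" for \<rho>
      using link_neq[OF p, of v \<rho> v] link_neq[OF p, of w \<rho> w] by auto
    then show ?thesis unfolding free_def saturated_off_def by auto
  qed
  finally show ?thesis using vw by simp
qed

text \<open>Either way the two interior stars and the arrow between their centres end up in a single
  interior node.\<close>

lemma interfering_isom:
  assumes H: "higraph V E" and p: "is_path (bedges V E) p" and e: "e \<in> arcs p" "e = (v, w) \<or> e = (w, v)"
    and bd: "bd p v" "bd p w" and ok: "saturated p v"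
    and va: "valid_marker (qmove p (MArc e)) (MNode (gm p (MArc e) (fst e)))"
    and vs: "valid_marker (qmove p (MNode v)) (MNode w)"
  shows "\<exists>h. isom h (qmove (qmove p (MArc e)) (MNode (gm p (MArc e) (fst e)))) (qmove (qmove p (MNode v)) (MNode w))"
proof -
  let ?x = "MArc e" and ?y = "MNode v"
  let ?g = "gm p (MArc e)" and ?n = "gm p (MArc e) (fst e)"
  have adj: "adj (arcs p) v w" "adj (arcs p) w v" using e by (auto simp: adj_def)
  have N: "v \<in> nds p" "w \<in> nds p" using adj_nds[OF p adj(1)] by auto
  have ne: "v \<noteq> w" by (rule adj_neq[OF p adj(1)])
  have x: "valid_marker p ?x" using e bd by (auto simp: valid_arc)
  have y: "valid_marker p ?y" using N bd ok valid_node[OF H p] by simp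
  have S: "mnodes p ?x = {v, w}" using e by auto
  have geq: "?g u = ?n \<longleftrightarrow> u = v \<or> u = w" for u using gm_eq_iff[OF p x, of u "fst e"] S e by auto
  have w: "w \<notin> mnodes p ?y" using in_istar[OF p, of w v] bd ne by simp
  note mn = move_node[OF H p y N(2) w]
  have 1: "mnodes (qmove p ?x) (MNode ?n) = ?g ` (istar p v \<union> istar p w)"
  proof (intro set_eqI)
    fix m
    have "m \<in> istar (qmove p ?x) ?n \<longleftrightarrow> m = ?n \<or>
        (\<exists>u. (adj (arcs p) v u \<or> adj (arcs p) w u) \<and> \<not> bd p u \<and> ?g u = m)"
    proof -
      have "adj (arcs (qmove p ?x)) ?n m \<and> \<not> bd (qmove p ?x) m \<longleftrightarrow> m \<noteq> ?n \<and>
         (\<exists>u. (adj (arcs p) v u \<or> adj (arcs p) w u) \<and> \<not> bd p u \<and> ?g u = m)"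
      proof -
        have "bd (qmove p ?x) (?g u) = bd p u" if "adj (arcs p) v' u" for v' u
          using move_bmu[OF p x, of u] adj_nds[OF p that] by simp
        then show ?thesis unfolding move_adj[OF p x] using geq by metis
      qed
      then show ?thesis unfolding in_istar[OF move_path[OF H p x]] by auto
    qed
    also have "\<dots> \<longleftrightarrow> m \<in> ?g ` (istar p v \<union> istar p w)"
      unfolding image_iff Bex_def Un_iff in_istar[OF p] using geq by metis
    finally show "m \<in> mnodes (qmove p ?x) (MNode ?n) \<longleftrightarrow> m \<in> ?g ` (istar p v \<union> istar p w)" by simp
  qed
  \<comment> \<open>After the first star move \<open>v\<close> is interior and so belongs to the
    star of \<open>w\<close>; its image stands for the whole star of \<open>v\<close>.\<close>
  have 2: "mnodes (qmove p ?y) (MNode w) = gm p ?y ` (insert v (istar p w))"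
  proof (intro set_eqI)
    fix m
    have mu: "bd (qmove p ?y) (gm p ?y u) \<longleftrightarrow> bd p u \<and> u \<noteq> v" if "adj (arcs p) w u" for u
      using move_bmu[OF p y, of u] adj_nds[OF p that] by auto
    have "m \<in> istar (qmove p ?y) w \<longleftrightarrow> m = w \<or> (\<exists>u. adj (arcs p) w u \<and> gm p ?y u = m) \<and> \<not> bd (qmove p ?y) m"
      unfolding in_istar[OF move_path[OF H p y]] mn(6) by simp
    also have "\<dots> \<longleftrightarrow> m = w \<or> (\<exists>u. adj (arcs p) w u \<and> gm p ?y u = m \<and> \<not> (bd p u \<and> u \<noteq> v))"
      using mu by metis
    also have "\<dots> \<longleftrightarrow> m \<in> gm p ?y ` (insert v (istar p w))"
      unfolding image_iff Bex_def insert_iff in_istar[OF p] using mn(1) adj(2) by metis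
    finally show "m \<in> mnodes (qmove p ?y) (MNode w) \<longleftrightarrow> m \<in> gm p ?y ` (insert v (istar p w))" by simp
  qed
  have vi: "v \<in> istar p v" "w \<in> istar p w" by (simp_all add: istar_def)
  show ?thesis
  proof (rule double_isom[OF H p x va 1 y vs 2])
    fix a b
    show "glue_ker (mnodes p ?x) (istar p v \<union> istar p w) a b \<longleftrightarrow> glue_ker (mnodes p ?y) (insert v (istar p w)) a b"
      using vi unfolding glue_ker_def S by auto
  next
    fix u
    have "w = gm p ?y u \<longleftrightarrow> u = w" using mn(4)[of u] by metis
    then show "?x = MNode u \<or> MNode ?n = MNode (?g u) \<longleftrightarrow> ?y = MNode u \<or> MNode w = MNode (gm p ?y u)"
      using geq[of u] by auto
  qed
qed

section \<open>Parity of the number of double moves\<close>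

lemma even_card_involution:
  assumes "finite A" "\<And>a. a \<in> A \<Longrightarrow> f a \<in> A" "\<And>a. a \<in> A \<Longrightarrow> f (f a) = a" "\<And>a. a \<in> A \<Longrightarrow> f a \<noteq> a"
  shows "even (card A)"
  using assms
proof (induction A rule: finite_psubset_induct)
  case (psubset A)
  show ?case
  proof (cases "A = {}")
    case False
    then obtain a where a: "a \<in> A" by auto
    let ?B = "A - {a, f a}"
    have fa: "f a \<in> A" "f a \<noteq> a" "f (f a) = a" using psubset.prems a by auto
    have "even (card ?B)"
    proof (rule psubset.IH)
      show "?B \<subset> A" using a by auto
      fix b assume b: "b \<in> ?B"
      have "f b \<noteq> a" using b psubset.prems(2)[of b] by auto
      moreover have "f b \<noteq> f a" using b psubset.prems(2)[of b] fa(3) by auto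
      ultimately show "f b \<in> ?B" using b psubset.prems(1) by auto
    qed (use psubset.prems in auto)
    moreover have "card A = card ?B + card {a, f a}"
      using psubset.hyps a fa card_Diff_subset[of "{a, f a}" A] card_mono[of A "{a, f a}"] by auto
    moreover have "card {a, f a} = 2" using fa by auto
    ultimately show ?thesis by simp
  qed simp
qed

text \<open>\<open>P\<close> stands for membership of the result in a fixed class. The double moves
  split into the lifts under \<Phi> of independent pairs \<open>U\<close>, which the exchange of the
  two moves matches up, and two copies of the set \<open>B\<close> of arrows between boundary nodes
  whose contraction can be followed by the star of the new node with a result in \<open>P\<close>:
  \<phi> lists these sequences, \<psi> the sequences of two stars with the same result. The total is
  \<open>card U\<close> plus twice \<open>card B\<close>.\<close>

lemma double_even:
  assumes H: "higraph V E" and p: "is_path (bedges V E) p"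
    and P: "\<And>q q' h. is_path (bedges V E) q \<Longrightarrow> is_path (bedges V E) q' \<Longrightarrow> isom h q q' \<Longrightarrow> P q = P q'"
  shows "even (card {(x, y). valid_marker p x \<and> valid_marker (qmove p x) y \<and> P (qmove (qmove p x) y)})"
proof -
  define M where "M = (\<lambda>x y. qmove (qmove p x) y)"
  define W where "W = {(x, y). valid_marker p x \<and> valid_marker (qmove p x) y \<and> P (M x y)}"
  have MP: "is_path (bedges V E) (M x y)" if "valid_marker p x" "valid_marker (qmove p x) y" for x y
    unfolding M_def using move_path[OF H move_path[OF H p that(1)] that(2)] .
  define U where "U = {(x, y). (x, y) \<in> indep p \<and> P (M x (map_marker (gm p x) y))}"
  define \<Phi> where "\<Phi> = (\<lambda>(x, y). (x, map_marker (gm p x) y))"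
  define \<phi> where "\<phi> = (\<lambda>e. (MArc e, MNode (gm p (MArc e) (fst e))))"
  \<comment> \<open>The first star sits at the saturated end. An arrow in \<open>B\<close> has
    exactly one such end: both ends satisfy \<open>saturated_off\<close>, and the arrow is bad at
    one of them.\<close>
  define \<psi> where "\<psi> = (\<lambda>e. if saturated p (fst e) then (MNode (fst e), MNode (snd e)) else (MNode (snd e), MNode (fst e)))"
  define B where "B = {e\<in>arcs p. bd p (fst e) \<and> bd p (snd e) \<and> \<phi> e \<in> W}"
  have "finite (markers p \<times> markers p)" using finite_markers[OF p] by simp
  moreover have "U \<subseteq> markers p \<times> markers p" by (auto simp: U_def indep_def dest: valid_markers)
  ultimately have fU: "finite U" by (rule rev_finite_subset)
  have fB: "finite B" using is_path_finite[OF p] by (simp add: B_def)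
  have eU: "even (card U)"
  proof (rule even_card_involution[where f = "\<lambda>(x, y). (y, x)"])
    fix z assume z: "z \<in> U"
    obtain x y where xy: "z = (x, y)" by (cases z)
    have i: "(x, y) \<in> indep p" "(y, x) \<in> indep p" using z xy indep_sym by (auto simp: U_def)
    have v: "valid_marker p x" "valid_marker p y" using i by (auto simp: indep_def)
    obtain h where "isom h (M x (map_marker (gm p x) y)) (M y (map_marker (gm p y) x))"
      using indep_swap[OF H p i(1)] by (auto simp: M_def)
    then have "P (M x (map_marker (gm p x) y)) = P (M y (map_marker (gm p y) x))"
      using P MP[OF v(1) lift_marker(1)[OF H p i(1)]] MP[OF v(2) lift_marker(1)[OF H p i(2)]] by blast
    then show "(case z of (x, y) \<Rightarrow> (y, x)) \<in> U" using z xy i by (auto simp: U_def)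
    show "(case z of (x, y) \<Rightarrow> (y, x)) \<noteq> z" using i xy by (auto simp: indep_def)
  qed (use fU in auto)
  have inj1: "inj_on \<Phi> U"
    using lift_inj[OF H p] by (auto simp: inj_on_def \<Phi>_def U_def)
  have inj2: "inj_on \<phi> B" by (auto simp: inj_on_def \<phi>_def)
  have inj3: "inj_on \<psi> B"
  proof (rule inj_onI)
    fix e e' assume e: "e \<in> B" "e' \<in> B" "\<psi> e = \<psi> e'"
    then have "{fst e, snd e} = {fst e', snd e'}" by (auto simp: \<psi>_def split: if_splits)
    moreover have "valid_marker p (MArc e)" "valid_marker p (MArc e')" using e by (auto simp: B_def valid_arc)
    ultimately have "MArc e = MArc e'" using mnodes_inj[OF p] by (metis mnodes_simps(2))
    then show "e = e'" by simp
  qed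
  have pair: "\<exists>v w. adj (arcs p) v w \<and> (e = (v, w) \<or> e = (w, v)) \<and> \<psi> e = (MNode v, MNode w) \<and> bd p v \<and> bd p w \<and>
      saturated p v \<and> \<psi> e \<in> W" if eB: "e \<in> B" for e
  proof -
    have e: "e \<in> arcs p" "bd p (fst e)" "bd p (snd e)" "\<phi> e \<in> W" using eB by (auto simp: B_def)
    then have s: "saturated_off p (fst e) (snd e)" "saturated_off p (snd e) (fst e)"
      using valid_arc_star[OF H p e(1-3)] by (auto simp: W_def \<phi>_def)
    have adj: "adj (arcs p) (fst e) (snd e)" "adj (arcs p) (snd e) (fst e)" using e by (auto simp: adj_def)
    obtain \<pi> where l: "link p (fst e) \<pi> (snd e)" using adj_link[OF adj(1)] by auto
    then have l': "link p (snd e) (flip \<pi>) (fst e)" using link_flip by metis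
    have ok: "saturated p (fst e) \<or> saturated p (snd e)"
      using saturated_saturated_off[OF p l e(3)] saturated_saturated_off[OF p l' e(2)] s link_bad(3)[OF H p l] e by auto
    obtain v w where vw: "v = fst e \<and> w = snd e \<or> v = snd e \<and> w = fst e" "saturated p v" "\<psi> e = (MNode v, MNode w)"
      using ok by (cases "saturated p (fst e)") (auto simp: \<psi>_def)
    have d: "adj (arcs p) v w" "bd p v" "bd p w" "saturated_off p w v" using vw(1) adj e s by auto
    have ee: "e = (v, w) \<or> e = (w, v)" using vw(1) by (cases e) auto
    have vs: "valid_marker (qmove p (MNode v)) (MNode w)" using valid_star_star[OF H p d(1-3) vw(2)] d by simp
    have va: "valid_marker (qmove p (MArc e)) (MNode (gm p (MArc e) (fst e)))" "valid_marker p (MArc e)"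
      and Pe: "P (M (MArc e) (MNode (gm p (MArc e) (fst e))))"
      using e(4) by (auto simp: W_def \<phi>_def)
    have y: "valid_marker p (MNode v)" using valid_node[OF H p] vw(2) d adj_nds[OF p d(1)] by simp
    obtain h where "isom h (M (MArc e) (MNode (gm p (MArc e) (fst e)))) (M (MNode v) (MNode w))"
      using interfering_isom[OF H p e(1) ee d(2,3) vw(2) va(1) vs] by (auto simp: M_def)
    then have "P (M (MNode v) (MNode w))" using P MP[OF va(2,1)] MP[OF y vs] Pe by blast
    then have "\<psi> e \<in> W" using vw(3) y vs by (simp add: W_def)
    then show ?thesis using vw ee d by auto
  qed
  have "W = \<Phi> ` U \<union> \<phi> ` B \<union> \<psi> ` B"
  proof (intro equalityI subsetI)
    fix z assume z: "z \<in> W"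
    obtain x y' where xy: "z = (x, y')" by (cases z)
    have v: "valid_marker p x" "valid_marker (qmove p x) y'" "P (M x y')" using z xy by (auto simp: W_def)
    consider (a) y where "(x, y) \<in> indep p" "y' = map_marker (gm p x) y"
      | (b) v w where "adj (arcs p) v w" "bd p v" "bd p w" "x = MNode v" "y' = MNode w"
      | (c) v w where "adj (arcs p) v w" "bd p v" "bd p w" "x \<in> {MArc (v, w), MArc (w, v)}" "y' = MNode (gm p x v)"
      using lift_surj[OF H p v(1,2)] by blast
    then show "z \<in> \<Phi> ` U \<union> \<phi> ` B \<union> \<psi> ` B"
    proof cases
      case a
      then have "(x, y) \<in> U" "z = \<Phi> (x, y)" using v xy by (auto simp: U_def \<Phi>_def)
      then show ?thesis by blast
    next
      case b
      obtain e where e: "e \<in> arcs p" "e = (v, w) \<or> e = (w, v)" using b(1) by (auto simp: adj_def)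
      have ok: "saturated p v" using v(1) b(4) valid_node[OF H p] by simp
      obtain \<pi> where l: "link p v \<pi> w" using adj_link[OF b(1)] by auto
      then have l': "link p w (flip \<pi>) v" using link_flip by metis
      \<comment> \<open>Since \<open>v\<close> is saturated, the arrow is not bad at
        \<open>v\<close>, so it is bad at \<open>w\<close>; hence \<open>w\<close> is not saturated,
        and \<psi> chooses the order of the given pair.\<close>
      have s: "saturated_off p v w" "saturated_off p w v" "\<not> saturated p w"
        using saturated_saturated_off[OF p l b(3)] saturated_saturated_off[OF p l' b(2)] ok valid_star_star[OF H p b(1-3) ok] v(2) b
          link_bad(3)[OF H p l] by auto
      have bde: "bd p (fst e)" "bd p (snd e)" using e b by auto
      have va: "valid_marker (qmove p (MArc e)) (MNode (gm p (MArc e) (fst e)))"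
        using valid_arc_star[OF H p e(1) bde] s e by auto
      have x: "valid_marker p (MArc e)" using e bde by (simp add: valid_arc)
      obtain h where "isom h (M (MArc e) (MNode (gm p (MArc e) (fst e)))) (M (MNode v) (MNode w))"
        using interfering_isom[OF H p e b(2,3) ok va] v(2) b(4,5) by (auto simp: M_def)
      then have "P (M (MArc e) (MNode (gm p (MArc e) (fst e))))"
        using P MP[OF x va] MP[OF v(1,2)] v(3) b(4,5) by blast
      then have "e \<in> B" using e bde x va by (auto simp: B_def W_def \<phi>_def)
      moreover have "\<psi> e = z" using e ok s(3) xy b by (auto simp: \<psi>_def)
      ultimately show ?thesis by blast
    next
      case c
      obtain e where e: "x = MArc e" "e = (v, w) \<or> e = (w, v)" using c(4) by auto
      have "gm p x v = gm p x (fst e)" using gm_eq_iff[OF p v(1)] e by auto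
      then have "z = \<phi> e" using xy c(5) e by (simp add: \<phi>_def)
      moreover have "e \<in> B" using v(1) e c z \<open>z = \<phi> e\<close> by (auto simp: B_def valid_arc)
      ultimately show ?thesis by blast
    qed
  next
    fix z assume "z \<in> \<Phi> ` U \<union> \<phi> ` B \<union> \<psi> ` B"
    then show "z \<in> W"
    proof (elim UnE imageE)
      fix u assume "z = \<Phi> u" "u \<in> U"
      then show "z \<in> W" using lift_marker(1)[OF H p] by (auto simp: \<Phi>_def U_def W_def indep_def)
    next
      fix e assume "z = \<phi> e" "e \<in> B"
      then show "z \<in> W" by (simp add: B_def)
    next
      fix e assume "z = \<psi> e" "e \<in> B"
      then show "z \<in> W" using pair by blast
    qed
  qed
  moreover have "\<Phi> ` U \<inter> (\<phi> ` B \<union> \<psi> ` B) = {}"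
  proof (rule equals0I)
    fix z assume "z \<in> \<Phi> ` U \<inter> (\<phi> ` B \<union> \<psi> ` B)"
    then obtain x y where xy: "(x, y) \<in> indep p" "z = (x, map_marker (gm p x) y)" and z: "z \<in> \<phi> ` B \<union> \<psi> ` B"
      by (auto simp: \<Phi>_def U_def)
    have nc: "\<not> interfering p x y" using xy by (simp add: indep_def)
    from z show False
    proof
      assume "z \<in> \<phi> ` B"
      then obtain e where e: "e \<in> B" "z = \<phi> e" by auto
      then have x: "x = MArc e" "map_marker (gm p x) y = MNode (gm p x (fst e))" using xy by (auto simp: \<phi>_def)
      have "e \<in> arcs p" "bd p (fst e)" "bd p (snd e)" using e by (auto simp: B_def)
      moreover from this have "fst e \<in> nds p" using is_path_arcs[OF p] by auto
      then have "y = MNode (fst e)" using lift_marker(3)[OF H p xy(1)] x by simp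
      ultimately show False using nc x interferingI[of p "fst e" "snd e" x y] by (simp add: adj_def)
    next
      assume "z \<in> \<psi> ` B"
      then obtain e where "e \<in> B" "z = \<psi> e" by auto
      with pair[of e] obtain v w where v: "adj (arcs p) v w" "z = (MNode v, MNode w)" "bd p v" "bd p w"
        by auto
      have x: "x = MNode v" "map_marker (gm p x) y = MNode w" using v xy by auto
      have "w \<notin> mnodes p x" using in_istar[OF p, of w v] v x adj_neq[OF p v(1)] by auto
      then have "map_marker (gm p x) y = MNode (gm p x w)" using x(2) by (simp add: gm_outside)
      then have "y = MNode w" using lift_marker(3)[OF H p xy(1)] adj_nds[OF p v(1)] by blast
      then show False using nc x v interferingI[of p v w x y] by simp
    qed
  qed
  moreover have "\<phi> ` B \<inter> \<psi> ` B = {}" by (auto simp: \<phi>_def \<psi>_def)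
  ultimately have "card W = card U + (card B + card B)"
    using fU fB inj1 inj2 inj3 by (simp add: card_Un_disjoint card_image Un_assoc)
  then have "even (card W)" using eU by simp
  then show ?thesis by (simp add: W_def M_def)
qed

section \<open>Rigidity of paths\<close>

text \<open>Agreement spreads along arrows: isomorphisms preserve ports, and a port leads to at most
  one node.\<close>

lemma isom_agree:
  assumes p: "is_path BE p" and q: "is_path BE' q" and f: "isom f p q" "isom f' p q"
    and v: "v \<in> nds p" "f v = f' v" and u: "u \<in> nds p"
  shows "f u = f' u"
proof -
  have "{u\<in>nds p. f u = f' u} = nds p"
  proof (rule connD[OF is_path_conn[OF p]])
    fix a b assume a: "a \<in> {u\<in>nds p. f u = f' u}" and b: "b \<in> nds p" "adj (arcs p) a b"
    obtain \<pi> where "link p a \<pi> b" using adj_link[OF b(2)] by auto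
    then have "link q (f a) \<pi> (f b)" "link q (f' a) \<pi> (f' b)"
      using a b isom_link[OF f(1), of a b \<pi>] isom_link[OF f(2), of a b \<pi>] by auto
    then show "b \<in> {u\<in>nds p. f u = f' u}" using a b link_fun[OF q] by auto
  qed (use v in auto)
  then show ?thesis using u by auto
qed

text \<open>The orbits partition \<open>X\<close>, and each has exactly \<open>n\<close> elements.
  Only forward iterates occur; periodicity supplies the inverses that make the orbit relation
  symmetric.\<close>

lemma orbit_card_dvd:
  assumes X: "finite X" "\<And>x. x \<in> X \<Longrightarrow> h x \<in> X" and n: "n > 0"
    and per: "\<And>x. x \<in> X \<Longrightarrow> (h ^^ n) x = x"
    and free: "\<And>x i. x \<in> X \<Longrightarrow> 0 < i \<Longrightarrow> i < n \<Longrightarrow> (h ^^ i) x \<noteq> x"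
  shows "n dvd card X"
proof -
  define r where "r = {(x, (h ^^ i) x) | x i. x \<in> X}"
  have hX: "(h ^^ i) x \<in> X" if "x \<in> X" for x i using that X(2) by (induction i) auto
  have mult: "(h ^^ (n * i)) x = x" if "x \<in> X" for x i
    using that per by (induction i) (simp_all add: funpow_add)
  have "equiv X r"
  proof (rule equivI)
    show "r \<subseteq> X \<times> X" using hX by (auto simp: r_def)
    show "refl_on X r" unfolding r_def by (auto intro!: refl_onI exI[of _ 0])
    show "sym r"
    proof (rule symI)
      fix x y assume "(x, y) \<in> r"
      then obtain i where i: "x \<in> X" "y = (h ^^ i) x" by (auto simp: r_def)
      have "i \<le> n * i" using n by simp
      then have "(h ^^ (n * i - i)) y = (h ^^ (n * i)) x" unfolding i(2)
        by (metis comp_apply funpow_add le_add_diff_inverse2)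
      then have "x = (h ^^ (n * i - i)) y" using mult[OF i(1)] by simp
      moreover have "y \<in> X" using i hX by simp
      ultimately show "(y, x) \<in> r" unfolding r_def by blast
    qed
    show "trans r"
    proof (rule transI)
      fix x y z assume "(x, y) \<in> r" "(y, z) \<in> r"
      then obtain i j where "x \<in> X" "y = (h ^^ i) x" "z = (h ^^ j) y" by (auto simp: r_def)
      then have "x \<in> X" "z = (h ^^ (j + i)) x" by (auto simp: funpow_add)
      then show "(x, z) \<in> r" unfolding r_def by blast
    qed
  qed
  moreover have "n dvd card C" if C: "C \<in> X // r" for C
  proof -
    obtain x where x: "x \<in> X" "C = r `` {x}" using C by (auto elim: quotientE)
    have red: "(h ^^ i) x = (h ^^ (i mod n)) x" for i
    proof -
      have "(h ^^ i) x = (h ^^ (i mod n + n * (i div n))) x" by simp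
      also have "\<dots> = (h ^^ (i mod n)) x" using mult[OF x(1)] by (simp only: funpow_add comp_apply)
      finally show ?thesis .
    qed
    have "C = range (\<lambda>i. (h ^^ i) x)" using x by (auto simp: r_def)
    moreover have "range (\<lambda>i. (h ^^ i) x) \<subseteq> (\<lambda>i. (h ^^ i) x) ` {..<n}"
    proof (rule image_subsetI)
      fix i
      show "(h ^^ i) x \<in> (\<lambda>i. (h ^^ i) x) ` {..<n}"
        using n by (subst red) (intro imageI, simp)
    qed
    ultimately have "C = (\<lambda>i. (h ^^ i) x) ` {..<n}" by auto
    moreover have "inj_on (\<lambda>i. (h ^^ i) x) {..<n}"
    proof (rule linorder_inj_onI')
      fix i j assume ij: "i \<in> {..<n}" "j \<in> {..<n}" "i < j"
      show "(h ^^ i) x \<noteq> (h ^^ j) x"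
      proof
        assume "(h ^^ i) x = (h ^^ j) x"
        then have "(h ^^ (n - i)) ((h ^^ i) x) = (h ^^ (n - i)) ((h ^^ j) x)" by simp
        moreover have "(h ^^ (n - i)) ((h ^^ i) x) = (h ^^ n) x"
          using ij by (metis comp_apply funpow_add le_add_diff_inverse2 lessThan_iff less_imp_le)
        moreover have "(h ^^ (n - i)) ((h ^^ j) x) = (h ^^ (j - i)) ((h ^^ n) x)"
        proof -
          have "n - i + j = j - i + n" using ij by auto
          then show ?thesis by (metis comp_apply funpow_add)
        qed
        ultimately have "(h ^^ (j - i)) x = x" using per[OF x(1)] by simp
        then show False using free[OF x(1), of "j - i"] ij by (auto simp: less_imp_diff_less)
      qed
    qed
    ultimately have "card C = n" by (simp add: card_image)
    then show ?thesis by simp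
  qed
  ultimately show ?thesis using X(1) by (auto intro: equiv_imp_dvd_card[of X r])
qed

text \<open>If no node is fixed, then all orbits, on nodes as well as on arrows, have the same length \<open>n\<close>,
  and \<open>n\<close> divides \<open>card N - card A = 1\<close>.\<close>

lemma automorphism_fixpoint:
  assumes p: "is_path BE p" and f: "isom f p p"
  shows "\<exists>v\<in>nds p. f v = v"
proof -
  have fin: "finite (nds p)" "finite (arcs p)" and ne: "nds p \<noteq> {}" and cd: "card (arcs p) + 1 = card (nds p)"
    and A: "arcs p \<subseteq> nds p \<times> nds p"
    using is_path_tree[OF p] is_path_finite[OF p] by (auto simp: is_tree_def)
  have fi: "isom (f ^^ i) p p" for i
  proof (induction i)
    case 0
    show ?case using isom_refl by (simp add: id_def)
  next
    case (Suc i)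
    then show ?case using isom_trans[OF Suc f] by (simp add: comp_def)
  qed
  have b: "inj_on (f ^^ i) (nds p)" "(f ^^ i) ` nds p = nds p" for i
    using fi[of i] by (auto simp: isom_def bij_betw_def)
  obtain v where v: "v \<in> nds p" using ne by auto
  have "\<exists>n>0. \<exists>v\<in>nds p. (f ^^ n) v = v"
  proof -
    have "(f ^^ i) v \<in> nds p" for i using b(2)[of i] v by auto
    then have "finite (range (\<lambda>i. (f ^^ i) v))" using fin(1) by (auto intro: finite_subset)
    then have "\<not> inj (\<lambda>i. (f ^^ i) v)" using finite_imageD by blast
    then obtain i j where ij: "i < j" "(f ^^ i) v = (f ^^ j) v"
      by (metis linorder_inj_onI')
    have "j = i + (j - i)" using ij by simp
    then have "(f ^^ j) v = (f ^^ i) ((f ^^ (j - i)) v)" by (metis comp_apply funpow_add)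
    moreover have "(f ^^ (j - i)) v \<in> nds p" using b(2)[of "j - i"] v by auto
    ultimately have "(f ^^ (j - i)) v = v" using inj_onD[OF b(1)[of i] _ _ v] ij(2) by simp
    then show ?thesis using ij(1) v by (intro exI[of _ "j - i"]) auto
  qed
  \<comment> \<open>The least positive exponent for which some node is fixed. That power agrees with
    the identity at one node and hence everywhere, by \<open>isom_agree\<close>, while smaller
    positive powers fix no node; so all orbits have length exactly \<open>n\<close>.\<close>
  then obtain n where n: "n > 0" "\<exists>v\<in>nds p. (f ^^ n) v = v"
      and least: "\<And>m. m < n \<Longrightarrow> \<not> (m > 0 \<and> (\<exists>v\<in>nds p. (f ^^ m) v = v))"
    using exists_least_iff[THEN iffD1, of "\<lambda>n. n > 0 \<and> (\<exists>v\<in>nds p. (f ^^ n) v = v)"]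
    by (elim exE conjE) auto
  have per: "(f ^^ n) u = u" if "u \<in> nds p" for u
  proof -
    from n(2) obtain w where w: "w \<in> nds p" "(f ^^ n) w = id w" by auto
    show ?thesis using isom_agree[OF p p fi[of n] isom_refl w that] by simp
  qed
  have free: "(f ^^ i) u \<noteq> u" if "u \<in> nds p" "0 < i" "i < n" for u i
    using least[OF that(3)] that(1,2) by blast
  have fN: "f u \<in> nds p" if "u \<in> nds p" for u using b(2)[of 1] that by auto
  have "n dvd card (nds p)"
    using orbit_card_dvd[OF fin(1) fN n(1) per free] by simp
  moreover have "n dvd card (arcs p)"
  proof (rule orbit_card_dvd[OF fin(2) _ n(1)])
    have m: "(map_prod f f ^^ i) e = ((f ^^ i) (fst e), (f ^^ i) (snd e))" for i e
      by (induction i) (auto simp: map_prod_def split_beta)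
    show "map_prod f f e \<in> arcs p" if "e \<in> arcs p" for e
      using isom_arcs[OF f A A] that by blast
    show "(map_prod f f ^^ n) e = e" if "e \<in> arcs p" for e
      using that A per by (auto simp: m)
    show "(map_prod f f ^^ i) e \<noteq> e" if "e \<in> arcs p" "0 < i" "i < n" for e i
      using that A free[OF _ that(2,3), of "fst e"] by (cases e) (auto simp: m)
  qed
  ultimately have "n dvd 1" using cd by (metis dvd_add_right_iff)
  then show ?thesis using n(2) by simp
qed

text \<open>One isomorphism followed by the inverse of the other is an automorphism; at its fixed
  node the two agree, hence they agree everywhere.\<close>

lemma isom_unique:
  assumes p: "is_path BE p" and q: "is_path BE' q" and f: "isom f p q" "isom f' p q" and u: "u \<in> nds p"
  shows "f u = f' u"
proof -
  let ?i = "inv_into (nds p) f'"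
  have "isom (?i \<circ> f) p p" by (rule isom_trans[OF f(1) isom_sym[OF f(2)]])
  from automorphism_fixpoint[OF p this] obtain v where v: "v \<in> nds p" "?i (f v) = v" by auto
  have "f v \<in> f' ` nds p" using f v by (auto simp: isom_def bij_betw_def)
  then have "f v = f' v" using v(2) by (metis f_inv_into_f)
  then show ?thesis using isom_agree[OF p q f v(1) _ u] by simp
qed

section \<open>Refinement inverts gluing\<close>

lemma subpath_simps [simp]:
  "nds (subpath p S) = S" "arcs (subpath p S) = arcs p \<inter> S \<times> S" "lab (subpath p S) = lab p"
  by (simp_all add: subpath_def)

lemma arclab_subpath [simp]: "arclab (subpath p S) = arclab p"
  by (simp add: fun_eq_iff arclab_def)

lemma subpath_self: "is_path BE p \<Longrightarrow> subpath p (nds p) = p"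
  using is_path_arcs[of BE p] by (simp add: subpath_def Int_absorb2)

lemma subpath_path:
  assumes p: "is_path BE p" and S: "S \<subseteq> nds p" "S \<noteq> {}" "conn (arcs p) S"
  shows "is_path BE (subpath p S)"
  unfolding is_path_def arclab_subpath
  using subtree[OF is_path_tree[OF p] S] S(1) p unfolding is_path_def by auto

lemma link_subpath: "link (subpath p S) v \<pi> u \<longleftrightarrow> link p v \<pi> u \<and> v \<in> S \<and> u \<in> S"
  by (auto simp: link_def)

lemma free_subpath: "T \<subseteq> S \<Longrightarrow> v \<in> S \<Longrightarrow> free (subpath p S) T v = free p T v"
  by (auto simp: free_def link_subpath)

lemma fports_subpath: "fports (subpath p S) S = fports p S"
  unfolding fports_def using free_subpath[of S S _ p] by simp

lemma psrc_ptgt_iff: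
  assumes "is_path BE p"
  shows "psrc p = bsrc e \<and> ptgt p = btgt e \<longleftrightarrow> fports p (nds p) = ports e"
proof -
  have "fports p (nds p) = ports (bmu e, psrc p, ptgt p)"
    using ports_subpath[of "bmu e" p "nds p"] subpath_self[OF assms] by simp
  then have "fports p (nds p) = ports e \<longleftrightarrow> (bmu e, psrc p, ptgt p) = e"
    unfolding edge_eq_iff[of "(bmu e, psrc p, ptgt p)" e] by (simp add: bmu_def)
  also have "\<dots> \<longleftrightarrow> psrc p = bsrc e \<and> ptgt p = btgt e"
    by (auto simp: prod_eq_iff bmu_def bsrc_def btgt_def)
  finally show ?thesis by simp
qed

section \<open>Subpaths that may be exchanged for a single node, and their weight\<close>

definition fits :: "'v pth \<Rightarrow> 'v bedge \<Rightarrow> bool" where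
  "fits D e \<longleftrightarrow> (if bmu e then boundary_path D \<and> plength D = 2 else pweight D = 2) \<and>
     psrc D = bsrc e \<and> ptgt D = btgt e"

lemma isom_fits:
  assumes H: "higraph V E" and f: "isom f p q" and p: "is_path (bedges V E) p" and q: "is_path (bedges V E) q"
  shows "fits p e \<longleftrightarrow> fits q e"
proof -
  have b: "nds q = f ` nds p" "inj_on f (nds p)" and l: "\<And>v. v \<in> nds p \<Longrightarrow> lab q (f v) = lab p v"
    using f by (auto simp: isom_def bij_betw_def)
  have "boundary_path q = boundary_path p" "plength q = plength p" "pweight q = pweight p"
    using l by (simp_all add: boundary_path_def plength_def pweight_def b(1) card_image[OF b(2)] sum.reindex[OF b(2)])
  moreover have "fports q (nds q) = fports p (nds p)"
    using isom_fports[OF H f p q subset_refl] b(1) by simp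
  ultimately show ?thesis
    unfolding fits_def psrc_ptgt_iff[OF p] psrc_ptgt_iff[OF q] by simp
qed

text \<open>In a legal path every bad port of a node is linked, and each arrow with a boundary end carries
  exactly one bad port.\<close>

lemma legal_pweight:
  assumes H: "higraph V E" and p: "is_path (bedges V E) p" and leg: "\<And>\<pi>. \<pi> \<in> fports p (nds p) \<Longrightarrow> \<not> bad \<pi>"
  shows "pweight p = 1 + int (card {v\<in>nds p. bd p v}) +
    int (card {e\<in>arcs p. \<not> bd p (fst e) \<and> \<not> bd p (snd e)})"
proof -
  define B where "B = (\<lambda>v. {\<pi>\<in>ports (lab p v). bad \<pi>})"
  define A' where "A' = {e\<in>arcs p. bd p (fst e) \<or> bd p (snd e)}"
  \<comment> \<open>Sends an arrow to its bad port: a stable label is bad in the source of the node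
    at the head, an unstable one in the target of the node at the tail. Labels of arrows in
    \<open>A'\<close> are never of interior type.\<close>
  define \<gamma> where "\<gamma> = (\<lambda>e. if snd (arclab p e) = Stab then (snd e, (True, arclab p e)) else (fst e, (False, arclab p e)))"
  have fin: "finite (nds p)" "finite (arcs p)" using is_path_finite[OF p] by auto
  have fA: "finite A'" using fin by (simp add: A'_def)
  have lk: "link p b (True, arclab p (a, b)) a" "link p a (False, arclab p (a, b)) b" if "(a, b) \<in> arcs p" for a b
    using that by (simp_all add: link_def)
  have "bij_betw \<gamma> A' (Sigma (nds p) B)"
  proof (rule bij_betwI')
    fix e e' assume e: "e \<in> A'" "e' \<in> A'"
    show "\<gamma> e = \<gamma> e' \<longleftrightarrow> e = e'"
    proof
      assume eq: "\<gamma> e = \<gamma> e'"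
      obtain a b a' b' where ab: "e = (a, b)" "e' = (a', b')" by (cases e; cases e')
      have arc: "(a, b) \<in> arcs p" "(a', b') \<in> arcs p" using e ab by (auto simp: A'_def)
      have k: "arclab p e = arclab p e'" using eq by (auto simp: \<gamma>_def split: if_splits)
      show "e = e'"
      proof (cases "snd (arclab p e) = Stab")
        case True
        then have "b = b'" using eq k ab by (auto simp: \<gamma>_def)
        then show ?thesis using link_fun[OF p lk(1)[OF arc(1)], of a'] lk(1)[OF arc(2)] k ab by simp
      next
        case False
        then have "a = a'" using eq k ab by (auto simp: \<gamma>_def)
        then show ?thesis using link_fun[OF p lk(2)[OF arc(1)], of b'] lk(2)[OF arc(2)] k ab by simp
      qed
    qed simp
  next
    fix e assume e: "e \<in> A'"
    obtain a b where ab: "e = (a, b)" by (cases e)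
    have arc: "(a, b) \<in> arcs p" "bd p a \<or> bd p b" using e ab by (auto simp: A'_def)
    have "bad (flip (True, arclab p e)) \<longleftrightarrow> \<not> bad (True, arclab p e)"
      using link_bad(3)[OF H p lk(1)[OF arc(1)]] arc(2) ab by auto
    then show "\<gamma> e \<in> Sigma (nds p) B"
      using link_ports[OF p lk(1)[OF arc(1)]] link_ports[OF p lk(2)[OF arc(1)]] link_nds[OF p lk(1)[OF arc(1)]] ab
      by (auto simp: \<gamma>_def B_def bad_def flip_def)
  next
    fix z assume z: "z \<in> Sigma (nds p) B"
    then obtain v d k where v: "z = (v, (d, k))" "v \<in> nds p" "(d, k) \<in> ports (lab p v)" "bad (d, k)"
      by (auto simp: B_def)
    have "(d, k) \<notin> free p (nds p) v" using v leg[of "(d, k)"] by (auto simp: fports_def)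
    then obtain u where l: "link p v (d, k) u" using v by (auto simp: free_def)
    have bv: "bd p v" using link_bad(1)[OF H p l] v(4) by auto
    show "\<exists>e\<in>A'. z = \<gamma> e"
    proof (cases d)
      case True
      then show ?thesis using l v bv
        by (intro bexI[of _ "(u, v)"]) (auto simp: \<gamma>_def A'_def link_def bad_def)
    next
      case False
      then show ?thesis using l v bv
        by (intro bexI[of _ "(v, u)"]) (auto simp: \<gamma>_def A'_def link_def bad_def)
    qed
  qed
  then have cA: "card A' = card (Sigma (nds p) B)" and fS: "finite (Sigma (nds p) B)"
    using fA by (auto simp: bij_betw_same_card bij_betw_finite)
  \<comment> \<open>Finiteness of the sets of bad ports is read off from the bijection with the
    finite set \<open>A'\<close>.\<close>
  have fB: "finite (B v)" if "v \<in> nds p" for v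
    using finite_imageI[OF fS, of snd] that by (rule_tac finite_subset[of _ "snd ` Sigma (nds p) B"]) (auto simp: image_iff)
  have w: "bweight (lab p v) = 1 + (if bd p v then 1 else 0) - int (card (B v))" if v: "v \<in> nds p" for v
  proof (cases "bd p v")
    case False
    then have "B v = {}" using bad_interior[OF H p v] by (auto simp: B_def)
    then show ?thesis using False by (simp add: bweight_def)
  next
    case True
    let ?S = "{x \<in> bsrc (lab p v). snd x = Stab}" and ?U = "{x \<in> btgt (lab p v). snd x = Unst}"
    have Bv: "B v = Pair True ` ?S \<union> Pair False ` ?U"
      by (auto simp: B_def ports_def bad_def image_iff split: if_splits)
    then have "finite (Pair True ` ?S)" "finite (Pair False ` ?U)" using fB[OF v] by auto
    then have "card (B v) = card (Pair True ` ?S) + card (Pair False ` ?U)"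
      unfolding Bv by (intro card_Un_disjoint) auto
    also have "\<dots> = card ?S + card ?U" by (simp add: card_image inj_on_def)
    finally show ?thesis using True by (simp add: bweight_def)
  qed
  have "pweight p = int (card (nds p)) + (\<Sum>v\<in>nds p. if bd p v then 1 else 0) - (\<Sum>v\<in>nds p. int (card (B v)))"
    unfolding pweight_def using w by (simp add: sum.distrib sum_subtractf)
  also have "(\<Sum>v\<in>nds p. if bd p v then 1 else 0) = int (card {v\<in>nds p. bd p v})"
    using fin by (simp add: sum.inter_filter[symmetric])
  also have "(\<Sum>v\<in>nds p. int (card (B v))) = int (card A')"
    using cA card_SigmaI[OF fin(1), of B] fB by (simp flip: of_nat_sum)
  finally have 1: "pweight p = int (card (nds p)) + int (card {v\<in>nds p. bd p v}) - int (card A')" .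
  \<comment> \<open>By the tree identity, the number of nodes minus the number of arrows with a
    boundary end is 1 plus the number of arrows between interior nodes.\<close>
  have "arcs p = A' \<union> {e\<in>arcs p. \<not> bd p (fst e) \<and> \<not> bd p (snd e)}" by (auto simp: A'_def)
  then have "card (arcs p) = card A' + card {e\<in>arcs p. \<not> bd p (fst e) \<and> \<not> bd p (snd e)}"
    using card_Un_disjoint[of A' "{e\<in>arcs p. \<not> bd p (fst e) \<and> \<not> bd p (snd e)}"] fin fA by (auto simp: A'_def)
  moreover have "card (arcs p) + 1 = card (nds p)" using is_path_tree[OF p] by (simp add: is_tree_def)
  ultimately show ?thesis using 1 by linarith
qed

lemma Min_mnodes_nds:
  assumes p: "is_path BE p" and x: "valid_marker p x"
  shows "Min (mnodes p x) \<in> nds (qmove p x)"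
proof -
  have "Min (mnodes p x) \<in> mnodes p x" using mnodes_props(2,4)[OF assms] by simp
  then show ?thesis
    using mnodes_props(1)[OF assms] qmap_nds[OF move_qmap[OF assms]] by (force simp: cmap_def)
qed

text \<open>In a star the weight formula sees one boundary node and, as there are no triangles, no
  arrow between interior nodes, which gives weight 2. Two interior nodes have weight 1 each.\<close>

lemma marker_fits:
  assumes H: "higraph V E" and p: "is_path (bedges V E) p" and x: "valid_marker p x"
  shows "fits (subpath p (mnodes p x)) (lab (qmove p x) (Min (mnodes p x)))"
proof -
  let ?S = "mnodes p x"
  let ?e = "lab (qmove p x) (Min ?S)"
  note sp = subpath_path[OF p mnodes_props(1-3)[OF p x]]
  have e: "?e = (mtype p x, psrc (subpath p ?S), ptgt (subpath p ?S))"
    by (simp add: qmove_contract contract_simps)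
  have "if mtype p x then boundary_path (subpath p ?S) \<and> plength (subpath p ?S) = 2 else pweight (subpath p ?S) = 2"
  proof (cases x)
    case (MArc a)
    then have a: "a \<in> arcs p" "bd p (fst a) = bd p (snd a)" using x by (auto simp: valid_arc)
    then have "fst a \<noteq> snd a" using adj_neq[OF p, of "fst a" "snd a"] by (auto simp: adj_def)
    then show ?thesis using a MArc by (auto simp: boundary_path_def plength_def pweight_def bweight_def)
  next
    case (MNode c)
    have c: "bd p c" "legal (subpath p (istar p c))" using x MNode by (auto simp: valid_marker_def)
    then have leg: "\<not> bad \<pi>" if "\<pi> \<in> fports (subpath p ?S) (nds (subpath p ?S))" for \<pi>
      using that MNode by (auto simp: legal_fports fports_subpath)
    have "{v \<in> ?S. bd p v} = {c}" using MNode c in_istar[OF p, of _ c] by auto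
    moreover have "{e \<in> arcs p \<inter> ?S \<times> ?S. \<not> bd p (fst e) \<and> \<not> bd p (snd e)} = {}"
    proof (rule equals0I)
      fix e assume "e \<in> {e \<in> arcs p \<inter> ?S \<times> ?S. \<not> bd p (fst e) \<and> \<not> bd p (snd e)}"
      then have ee: "e \<in> arcs p" "fst e \<in> istar p c" "snd e \<in> istar p c" "\<not> bd p (fst e)" "\<not> bd p (snd e)"
        using MNode by (auto simp: mem_Times_iff)
      then have "adj (arcs p) c (fst e)" "adj (arcs p) c (snd e)" "adj (arcs p) (fst e) (snd e)"
        using in_istar[OF p] c by (auto simp: adj_def)
      then show False using no_triangle[OF p] by blast
    qed
    moreover have "pweight (subpath p ?S) = 1 + int (card {v \<in> ?S. bd p v}) +
        int (card {e \<in> arcs p \<inter> ?S \<times> ?S. \<not> bd p (fst e) \<and> \<not> bd p (snd e)})"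
      using legal_pweight[OF H sp leg] unfolding subpath_simps .
    ultimately have "pweight (subpath p ?S) = 2" by (simp only: card.empty) simp
    then show ?thesis using MNode by simp
  qed
  then show ?thesis unfolding e fits_def by (simp add: bmu_def bsrc_def btgt_def)
qed

text \<open>For an interior label, weight 2 leaves two cases of the weight formula. With no boundary
  node and one arrow there are just two nodes. With one boundary node \<open>c\<close> and no arrow
  between interior nodes, connectedness makes every other node a neighbour of \<open>c\<close>; and
  \<open>S\<close> contains all interior neighbours of \<open>c\<close>, because the port towards a
  missing one would be free and, its interior end not being the bad one, bad at
  \<open>c\<close>.\<close>

lemma fits_marker:
  assumes H: "higraph V E" and p: "is_path (bedges V E) p" and S: "S \<subseteq> nds p" "S \<noteq> {}" "conn (arcs p) S"
    and e: "fits (subpath p S) e" "typed e"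
  shows "\<exists>x. valid_marker p x \<and> mnodes p x = S \<and> mtype p x = bmu e"
proof -
  note sp = subpath_path[OF p S]
  have P: "fports p S = ports e"
    using e(1) psrc_ptgt_iff[OF sp, of e] by (simp add: fits_def fports_subpath)
  have fS: "finite S" using S(1) is_path_finite[OF p] finite_subset by auto
  have nbr: "\<exists>b\<in>S. adj (arcs p) a b" if "a \<in> S" "S \<noteq> {a}" for a
  proof (rule ccontr)
    assume "\<not> (\<exists>b\<in>S. adj (arcs p) a b)"
    then have "{a} = S" using that(1) by (intro connD[OF S(3)]) auto
    then show False using that(2) by simp
  qed
  show ?thesis
  proof (cases "bmu e")
    case True
    then have b: "\<And>v. v \<in> S \<Longrightarrow> bd p v" "card S = 2"
      using e(1) by (auto simp: fits_def boundary_path_def plength_def)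
    obtain a b where ab: "S = {a, b}" "a \<noteq> b" using b(2) by (auto simp: card_2_iff)
    have "adj (arcs p) a b" using nbr[of a] ab adj_neq[OF p, of a a] by auto
    then obtain x where x: "x \<in> arcs p" "x = (a, b) \<or> x = (b, a)" by (auto simp: adj_def)
    moreover have "bd p a" "bd p b" using b(1) ab(1) by simp_all
    ultimately have "valid_marker p (MArc x) \<and> mnodes p (MArc x) = S \<and> mtype p (MArc x) = bmu e"
      unfolding ab(1) using True by (auto simp: valid_arc)
    then show ?thesis by blast
  next
    case False
    have nb: "\<not> bad \<pi>" if "\<pi> \<in> fports p S" for \<pi>
      using that e(2) False P by (simp add: typed_def)
    let ?I = "{a \<in> arcs p \<inter> S \<times> S. \<not> bd p (fst a) \<and> \<not> bd p (snd a)}"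
    have "pweight (subpath p S) = 2" using e(1) False by (simp add: fits_def)
    then have "card {v\<in>S. bd p v} + card ?I = 1"
      using legal_pweight[OF H sp] nb fports_subpath[of p S] by simp
    then consider (a) "card {v\<in>S. bd p v} = 0" "card ?I = 1" | (c) "card {v\<in>S. bd p v} = 1" "card ?I = 0"
      by linarith
    then show ?thesis
    proof cases
      case a
      have int: "\<not> bd p v" if "v \<in> S" for v using a(1) fS that by auto
      then have "?I = arcs p \<inter> S \<times> S" by auto
      then have "card (arcs p \<inter> S \<times> S) = 1" using a(2) by simp
      moreover have "card (arcs p \<inter> S \<times> S) + 1 = card S"
        using is_path_tree[OF sp] by (simp add: is_tree_def)
      ultimately have "card S = 2" by simp
      then obtain u w where uw: "S = {u, w}" "u \<noteq> w" by (auto simp: card_2_iff)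
      have "adj (arcs p) u w" using nbr[of u] uw adj_neq[OF p, of u u] by auto
      then obtain x where x: "x \<in> arcs p" "x = (u, w) \<or> x = (w, u)" by (auto simp: adj_def)
      moreover have "\<not> bd p u" "\<not> bd p w" using int uw(1) by simp_all
      ultimately have "valid_marker p (MArc x) \<and> mnodes p (MArc x) = S \<and> mtype p (MArc x) = bmu e"
        unfolding uw(1) using False by (auto simp: valid_arc)
      then show ?thesis by blast
    next
      case c
      from c(1) obtain c where cc: "{v\<in>S. bd p v} = {c}" by (rule card_1_singletonE)
      then have c': "c \<in> S" "bd p c" "\<And>v. v \<in> S \<Longrightarrow> bd p v \<Longrightarrow> v = c" by auto
      have "finite (arcs p)" using is_path_finite[OF p] by simp
      then have noint: "?I = {}" using c(2) by auto
      have star: "{w\<in>S. w = c \<or> adj (arcs p) c w} = S"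
      proof (rule connD[OF S(3)])
        fix a b assume a: "a \<in> {w\<in>S. w = c \<or> adj (arcs p) c w}" and b: "b \<in> S" "adj (arcs p) a b"
        show "b \<in> {w\<in>S. w = c \<or> adj (arcs p) c w}"
        proof (cases "a = c \<or> b = c")
          case True
          then show ?thesis using b by auto
        next
          case False
          then have "\<not> bd p a" "\<not> bd p b" using c'(3) a b by auto
          then have "(a, b) \<in> ?I \<or> (b, a) \<in> ?I" using a b by (auto simp: adj_def)
          then show ?thesis using noint by auto
        qed
      qed (use c'(1) in auto)
      have sub: "S \<subseteq> istar p c"
      proof
        fix u assume u: "u \<in> S"
        then have "u \<in> {w\<in>S. w = c \<or> adj (arcs p) c w}" using star by simp
        then have "u = c \<or> adj (arcs p) c u" by simp
        then show "u \<in> istar p c" using in_istar[OF p, of u c] c'(3)[OF u] by blast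
      qed
      have "istar p c \<subseteq> S"
      proof
        fix u assume u: "u \<in> istar p c"
        show "u \<in> S"
        proof (rule ccontr)
          assume n: "u \<notin> S"
          then have "adj (arcs p) c u" "\<not> bd p u" using u n c'(1) in_istar[OF p, of u c] by auto
          then obtain \<pi> where l: "link p c \<pi> u" using adj_link by metis
          have "\<not> bad \<pi>" using nb link_fports[OF p l c'(1) n] by auto
          then show False using link_bad(2,3)[OF H p l] c'(2) \<open>\<not> bd p u\<close> by auto
        qed
      qed
      then have "istar p c = S" using sub by auto
      then have "valid_marker p (MNode c) \<and> mnodes p (MNode c) = S \<and> mtype p (MNode c) = bmu e"
        using c'(1,2) S(1) nb False by (auto simp: valid_marker_def legal_fports)
      then show ?thesis by blast
    qed
  qed
qed

section \<open>The tree of a refinement\<close>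

definition shift :: "'v pth \<Rightarrow> nat \<Rightarrow> nat" where
  "shift r w = w + Suc (Max (nds r))"

lemma shift_inj: "inj_on (shift r) A"
  by (simp add: shift_def inj_on_def)

lemma refine_simps:
  "nds (refine r v D) = (nds r - {v}) \<union> shift r ` nds D"
  "arcs (refine r v D) = {e\<in>arcs r. fst e \<noteq> v \<and> snd e \<noteq> v}
     \<union> {(shift r a, shift r b) | a b. (a, b) \<in> arcs D}
     \<union> {(a, shift r (srcnode D (arclab r (a, v)))) | a. (a, v) \<in> arcs r}
     \<union> {(shift r (tgtnode D (arclab r (v, b))), b) | b. (v, b) \<in> arcs r}"
  "lab (refine r v D) x = (if Suc (Max (nds r)) \<le> x then lab D (x - Suc (Max (nds r))) else lab r x)"
  by (simp_all add: refine_def Let_def shift_def)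

lemma shift_fresh:
  assumes "is_path BE r" "n \<in> nds r"
  shows "n \<noteq> shift r w" "shift r w \<noteq> n" "n < Suc (Max (nds r))"
  using Max_ge[OF conjunct1[OF is_path_finite[OF assms(1)]] assms(2)] by (auto simp: shift_def)

lemma refine_lab:
  assumes "is_path BE r"
  shows "lab (refine r v D) (shift r w) = lab D w" "n \<in> nds r \<Longrightarrow> lab (refine r v D) n = lab r n"
  using shift_fresh(3)[OF assms, of n] by (auto simp: refine_simps(3) shift_def)

lemma refine_arcs_new:
  assumes r: "is_path BE r"
  shows "(shift r w, shift r u) \<in> arcs (refine r v D) \<longleftrightarrow> (w, u) \<in> arcs D"
proof -
  have "(shift r w, y) \<notin> arcs r" "(y, shift r w) \<notin> arcs r" for w y
    using is_path_arcs[OF r] shift_fresh(1)[OF r, of "shift r w" w] by auto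
  moreover have "shift r x = shift r y \<longleftrightarrow> x = y" for x y by (simp add: shift_def)
  ultimately show ?thesis by (auto simp: refine_simps)
qed

lemma refine_arcs:
  assumes r: "is_path BE r" and D: "is_path BE' D" and ab: "a \<in> nds r" "b \<in> nds r" "a \<noteq> v" "b \<noteq> v"
  shows "(a, b) \<in> arcs (refine r v D) \<longleftrightarrow> (a, b) \<in> arcs r"
    and "(a, shift r w) \<in> arcs (refine r v D) \<longleftrightarrow> (a, v) \<in> arcs r \<and> srcnode D (arclab r (a, v)) = w"
    and "(shift r w, b) \<in> arcs (refine r v D) \<longleftrightarrow> (v, b) \<in> arcs r \<and> tgtnode D (arclab r (v, b)) = w"
proof -
  have fr: "n \<noteq> shift r w" "shift r w \<noteq> n" if "n \<in> nds r" for n w using shift_fresh[OF r that] by auto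
  have A: "\<And>x y. (x, y) \<in> arcs r \<Longrightarrow> x \<in> nds r \<and> y \<in> nds r" using is_path_arcs[OF r] by auto
  have i: "shift r x = shift r y \<longleftrightarrow> x = y" for x y by (simp add: shift_def)
  note f = fr[OF ab(1)] fr[OF ab(2)]
  show "(a, b) \<in> arcs (refine r v D) \<longleftrightarrow> (a, b) \<in> arcs r"
    using f ab by (auto simp: refine_simps)
  show "(a, shift r w) \<in> arcs (refine r v D) \<longleftrightarrow> (a, v) \<in> arcs r \<and> srcnode D (arclab r (a, v)) = w"
    using A fr f ab by (auto simp: refine_simps i)
  show "(shift r w, b) \<in> arcs (refine r v D) \<longleftrightarrow> (v, b) \<in> arcs r \<and> tgtnode D (arclab r (v, b)) = w"
    using A fr f ab by (auto simp: refine_simps i)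
qed

lemma conn_map:
  assumes "conn A N" "inj h" "\<And>a b. (a, b) \<in> A \<Longrightarrow> a \<noteq> b"
    and "\<And>a b. (a, b) \<in> A \<Longrightarrow> (h a, h b) \<in> B"
  shows "conn B (h ` N)"
  by (rule conn_mono[OF conn_image[OF assms(1), of h]]) (use assms(4) in \<open>auto elim!: qarcsE\<close>)

definition rmap :: "'v pth \<Rightarrow> nat \<Rightarrow> nat \<Rightarrow> nat" where
  "rmap r v n = (if Suc (Max (nds r)) \<le> n then v else n)"

text \<open>A refinement is undone by a quotient: \<open>rmap\<close> sends the inserted tree back
  to \<open>v\<close>. The copy of \<open>D\<close> is a connected fibre, and its free ports are the
  ports of \<open>v\<close> because source and target match.\<close>

lemma refine_qmap:
  assumes H: "higraph V E" and r: "is_path (bedges V E) r" and D: "is_path (bedges V E) D"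
    and v: "v \<in> nds r" and fits: "fports D (nds D) = ports (lab r v)"
    and R: "is_path (bedges V E) (refine r v D)"
  shows "qmap (rmap r v) (refine r v D) r"
    and "isom (shift r) D (subpath (refine r v D) (shift r ` nds D))"
    and "conn (arcs (refine r v D)) (shift r ` nds D)"
    and "a \<in> nds (refine r v D) \<Longrightarrow> rmap r v a = (if a \<in> shift r ` nds D then v else a)"
proof -
  let ?R = "refine r v D" and ?H = "shift r ` nds D" and ?\<rho> = "rmap r v"
  have neD: "nds D \<noteq> {}" using is_path_tree[OF D] by (simp add: is_tree_def)
  have HR: "?H \<subseteq> nds ?R" by (auto simp: refine_simps)
  have \<rho>1: "?\<rho> (shift r w) = v" for w by (simp add: rmap_def shift_def)
  have \<rho>2: "?\<rho> n = n" if "n \<in> nds r" for n using shift_fresh(3)[OF r that] by (simp add: rmap_def)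
  have nH: "n \<notin> ?H" if "n \<in> nds r" for n using shift_fresh[OF r that] by auto
  have A: "\<And>x y. (x, y) \<in> arcs r \<Longrightarrow> x \<in> nds r \<and> y \<in> nds r \<and> x \<noteq> y"
    using is_path_arcs[OF r] tree_irrefl[OF is_path_tree[OF r]] by auto
  have irr: "a \<noteq> b" if "(a, b) \<in> arcs D" for a b using that tree_irrefl[OF is_path_tree[OF D]] by auto
  have aD: "(a, b) \<in> arcs D \<Longrightarrow> (shift r a, shift r b) \<in> arcs ?R" for a b by (auto simp: refine_simps)
  show cH: "conn (arcs ?R) ?H"
    by (rule conn_map[OF is_path_conn[OF D] shift_inj irr aD])
  show iD: "isom (shift r) D (subpath ?R ?H)"
  proof -
    have "(a, b) \<in> arcs D \<longleftrightarrow> (shift r a, shift r b) \<in> arcs ?R" for a b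
      using refine_arcs_new[OF r] by simp
    then show ?thesis
      using refine_lab(1)[OF r] by (auto simp: isom_def bij_betw_def shift_inj)
  qed
  show \<rho>: "?\<rho> a = (if a \<in> ?H then v else a)" if "a \<in> nds ?R" for a
    using that \<rho>1 \<rho>2 nH by (auto simp: refine_simps(1))
  have im: "?\<rho> ` nds ?R = nds r"
  proof (intro equalityI subsetI)
    show "n \<in> nds r" if "n \<in> ?\<rho> ` nds ?R" for n using that v \<rho>1 \<rho>2 by (auto simp: refine_simps(1))
    show "n \<in> ?\<rho> ` nds ?R" if n: "n \<in> nds r" for n
    proof (cases "n = v")
      case True
      obtain w where "w \<in> nds D" using neD by auto
      then show ?thesis using True \<rho>1[of w] HR by (intro image_eqI[of _ _ "shift r w"]) auto
    next
      case False
      then show ?thesis using n \<rho>2[OF n] by (intro image_eqI[of _ _ n]) (auto simp: refine_simps(1))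
    qed
  qed
  have ar: "arcs r = qarcs ?\<rho> (arcs ?R)"
  proof (intro equalityI subrelI)
    fix a b assume ab: "(a, b) \<in> arcs r"
    note N = A[OF ab]
    have "\<exists>a' b'. (a', b') \<in> arcs ?R \<and> ?\<rho> a' = a \<and> ?\<rho> b' = b"
    proof -
      consider "a \<noteq> v" "b \<noteq> v" | "b = v" | "a = v" by blast
      then show ?thesis
      proof cases
        case 1
        then have "(a, b) \<in> arcs ?R" using ab by (simp add: refine_simps)
        then show ?thesis using N \<rho>2 by blast
      next
        case 2
        then have "(a, shift r (srcnode D (arclab r (a, v)))) \<in> arcs ?R" using ab by (auto simp: refine_simps)
        then show ?thesis using N \<rho>1 \<rho>2 2 by blast
      next
        case 3
        then have "(shift r (tgtnode D (arclab r (v, b))), b) \<in> arcs ?R" using ab by (auto simp: refine_simps)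
        then show ?thesis using N \<rho>1 \<rho>2 3 by blast
      qed
    qed
    then show "(a, b) \<in> qarcs ?\<rho> (arcs ?R)" using N unfolding qarcs_def by blast
  next
    fix m n assume "(m, n) \<in> qarcs ?\<rho> (arcs ?R)"
    then obtain a b where ab: "(a, b) \<in> arcs ?R" "?\<rho> a = m" "?\<rho> b = n" "m \<noteq> n" by (elim qarcsE)
    from ab(1) show "(m, n) \<in> arcs r"
      unfolding refine_simps(2)
    proof (elim UnE CollectE conjE exE)
      assume "(a, b) \<in> arcs r"
      then show ?thesis using A \<rho>2 ab by metis
    next
      fix a' b' assume "(a, b) = (shift r a', shift r b')"
      then show ?thesis using \<rho>1 ab by simp
    next
      fix a' assume "(a, b) = (a', shift r (srcnode D (arclab r (a', v))))" "(a', v) \<in> arcs r"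
      then show ?thesis using A \<rho>1 \<rho>2 ab by (metis prod.inject)
    next
      fix b' assume "(a, b) = (shift r (tgtnode D (arclab r (v, b'))), b')" "(v, b') \<in> arcs r"
      then show ?thesis using A \<rho>1 \<rho>2 ab by (metis prod.inject)
    qed
  qed
  have fb: "conn (arcs ?R) (fib ?\<rho> (nds ?R) n) \<and> ports (lab r n) = fports ?R (fib ?\<rho> (nds ?R) n)"
    if n: "n \<in> nds r" for n
  proof (cases "n = v")
    case True
    have "fib ?\<rho> (nds ?R) v = ?H"
    proof (intro set_eqI)
      fix a
      have "a \<in> ?H \<or> a \<noteq> v" if "a \<in> nds ?R" using that by (auto simp: refine_simps(1))
      then show "a \<in> fib ?\<rho> (nds ?R) v \<longleftrightarrow> a \<in> ?H" unfolding fib_def using \<rho>[of a] HR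
        by (auto split: if_splits)
    qed
    moreover have "fports ?R ?H = fports D (nds D)"
    proof -
      have ne: "?H \<noteq> {}" using neD by simp
      have "fports (subpath ?R ?H) ?H = fports D (nds D)"
        by (rule isom_fports[OF H iD D subpath_path[OF R HR ne cH] subset_refl])
      then show ?thesis by (simp add: fports_subpath)
    qed
    ultimately show ?thesis using cH fits True by simp
  next
    case False
    have "fib ?\<rho> (nds ?R) n = {n}"
      unfolding fib_def using \<rho> False n nH[OF n] by (auto simp: refine_simps(1))
    then show ?thesis using refine_lab(2)[OF r n] free_singleton[OF R] by simp
  qed
  show "qmap ?\<rho> ?R r" unfolding qmap_def using im ar fb by simp
qed

text \<open>The choice made by \<open>srcnode\<close> has only one candidate, by
  \<open>free_disjoint\<close>.\<close>

lemma srcnode_eq: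
  assumes H: "higraph V E" and D: "is_path (bedges V E) D" and w: "w \<in> nds D" "(True, k) \<in> free D (nds D) w"
  shows "srcnode D k = w"
proof -
  have eq: "k \<in> bsrc (lab D u) \<and> k \<notin> {arclab D e | e. e \<in> arcs D \<and> snd e = u} \<longleftrightarrow> (True, k) \<in> free D (nds D) u"
    if "u \<in> nds D" for u
    using is_path_arcs[OF D] by (auto simp: free_def ports_iff link_def)
  have "u = w" if "u \<in> nds D" "(True, k) \<in> free D (nds D) u" for u
    using free_disjoint[OF H path_prepath[OF H D] subset_refl is_path_conn[OF D] that(1) w(1) that(2) w(2)] .
  then show ?thesis
    unfolding srcnode_def using w eq by (intro some_equality) blast+
qed

lemma tgtnode_eq:
  assumes H: "higraph V E" and D: "is_path (bedges V E) D" and w: "w \<in> nds D" "(False, k) \<in> free D (nds D) w"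
  shows "tgtnode D k = w"
proof -
  have eq: "k \<in> btgt (lab D u) \<and> k \<notin> {arclab D e | e. e \<in> arcs D \<and> fst e = u} \<longleftrightarrow> (False, k) \<in> free D (nds D) u"
    if "u \<in> nds D" for u
    using is_path_arcs[OF D] by (auto simp: free_def ports_iff link_def)
  have "u = w" if "u \<in> nds D" "(False, k) \<in> free D (nds D) u" for u
    using free_disjoint[OF H path_prepath[OF H D] subset_refl is_path_conn[OF D] that(1) w(1) that(2) w(2)] .
  then show ?thesis
    unfolding tgtnode_def using w eq by (intro some_equality) blast+
qed

text \<open>Since \<open>isom\<close> ignores arrows that leave the node set, this has to be known
  before \<open>is_path\<close> can be carried over to a refinement. The new arrows end in the
  inserted tree because their labels are free ports of \<open>D\<close>.\<close>

lemma refine_sub: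
  assumes H: "higraph V E" and r: "is_path (bedges V E) r" and D: "is_path (bedges V E) D"
    and fits: "fports D (nds D) = ports (lab r v)"
  shows "arcs (refine r v D) \<subseteq> nds (refine r v D) \<times> nds (refine r v D)"
proof -
  have s: "srcnode D (arclab r (a, v)) \<in> nds D" if "(a, v) \<in> arcs r" for a
  proof -
    have "(True, arclab r (a, v)) \<in> fports D (nds D)"
      using link_ports[OF r, of v _ a] that fits by (simp add: link_def)
    then obtain w where "w \<in> nds D" "(True, arclab r (a, v)) \<in> free D (nds D) w" by (auto simp: fports_def)
    then show ?thesis using srcnode_eq[OF H D] by metis
  qed
  have t: "tgtnode D (arclab r (v, a)) \<in> nds D" if "(v, a) \<in> arcs r" for a
  proof -
    have "(False, arclab r (v, a)) \<in> fports D (nds D)"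
      using link_ports[OF r, of v _ a] that fits by (simp add: link_def)
    then obtain w where "w \<in> nds D" "(False, arclab r (v, a)) \<in> free D (nds D) w" by (auto simp: fports_def)
    then show ?thesis using tgtnode_eq[OF H D] by metis
  qed
  show ?thesis
    using s t is_path_arcs[OF r] is_path_arcs[OF D] tree_irrefl[OF is_path_tree[OF r]] by (auto simp: refine_simps)
qed

lemma isom_free:
  assumes f: "isom f p q" and v: "v \<in> nds p"
  shows "free q (nds q) (f v) = free p (nds p) v"
proof -
  have "nds q = f ` nds p" "lab q (f v) = lab p v" using f v by (auto simp: isom_def bij_betw_def)
  then show ?thesis using isom_link[OF f v] by (auto simp: free_def)
qed

text \<open>Inserting a copy of the contracted subpath at the new node restores \<open>p\<close>.
  The isomorphism is \<psi> on the inserted tree and the inverse of \<open>f\<close> elsewhere. An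
  outside arrow returns to its old end since its label is a port of \<open>D\<close> that is free at
  one node only, the one that \<open>srcnode\<close> or \<open>tgtnode\<close> selects.\<close>

lemma refine_move:
  assumes H: "higraph V E" and p: "is_path (bedges V E) p" and x: "valid_marker p x"
    and r: "is_path (bedges V E) r" and f: "isom f (qmove p x) r"
    and D: "is_path (bedges V E) D" and \<psi>: "isom \<psi> D (subpath p (mnodes p x))"
  shows "\<exists>\<phi>. isom \<phi> (refine r (f (Min (mnodes p x))) D) p \<and> \<phi> ` shift r ` nds D = mnodes p x"
proof -
  let ?S = "mnodes p x" and ?q = "qmove p x"
  note mp = mnodes_props[OF p x]
  note qm = move_qmap[OF p x] and q = move_path[OF H p x]
  note sp = subpath_path[OF p mp(1-3)]
  define vs where "vs = Min ?S"
  define v where "v = f vs"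
  define f' where "f' = inv_into (nds ?q) f"
  have vsS: "vs \<in> ?S" unfolding vs_def using mp by simp
  have vsN: "vs \<in> nds ?q" using vsS mp(1) qmap_nds[OF qm] by (auto simp: cmap_def vs_def image_iff)
  have i': "isom f' r ?q" unfolding f'_def by (rule isom_sym[OF f])
  have fb: "inj_on f (nds ?q)" "f ` nds ?q = nds r" using f by (auto simp: isom_def bij_betw_def)
  have vN: "v \<in> nds r" unfolding v_def using fb vsN by auto
  have f'v: "f' v = vs" unfolding f'_def v_def by (rule inv_into_f_f[OF fb(1) vsN])
  have f'b: "inj_on f' (nds r)" "f' ` nds r = nds ?q" using i' by (auto simp: isom_def bij_betw_def)
  \<comment> \<open>Contraction keeps the names of the nodes outside \<open>?S\<close>, so the
    inverse of \<open>f\<close> already takes values in \<open>nds p\<close> there.\<close>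
  have qN: "nds ?q = insert vs (nds p - ?S)"
    using qmap_nds[OF qm] vsS mp(1) by (auto simp: cmap_def vs_def image_iff)
  have f'im: "f' ` (nds r - {v}) = nds p - ?S"
  proof -
    have "f' ` (nds r - {v}) = nds ?q - {vs}"
      using inj_on_image_set_diff[OF f'b(1), of "nds r" "{v}"] vN f'b(2) f'v by simp
    then show ?thesis using qN vsS by auto
  qed
  have f'o: "f' n \<in> nds p" "f' n \<notin> ?S" if "n \<in> nds r" "n \<noteq> v" for n using f'im that by auto
  have \<psi>b: "inj_on \<psi> (nds D)" "\<psi> ` nds D = ?S" using \<psi> by (auto simp: isom_def bij_betw_def)
  have \<psi>S: "\<psi> w \<in> ?S" "\<psi> w \<in> nds p" if "w \<in> nds D" for w using \<psi>b that mp(1) by auto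
  define \<phi> where "\<phi> = (\<lambda>n. if Suc (Max (nds r)) \<le> n then \<psi> (n - Suc (Max (nds r))) else f' n)"
  have \<phi>1: "\<phi> (shift r w) = \<psi> w" for w by (simp add: \<phi>_def shift_def)
  have \<phi>2: "\<phi> n = f' n" if "n \<in> nds r" for n using shift_fresh(3)[OF r that] by (simp add: \<phi>_def)
  let ?R = "refine r v D"
  have R: "nds ?R = (nds r - {v}) \<union> shift r ` nds D" by (rule refine_simps)
  have g1: "gm p x n = n" if "n \<notin> ?S" for n using that by (rule gm_outside)
  have g2: "gm p x n = vs" if "n \<in> ?S" for n using that by (simp add: cmap_def vs_def)
  have gS: "gm p x n = vs \<longleftrightarrow> n \<in> ?S" for n using g1 g2 vsS by metis
  have lq: "link ?q vs \<pi> n \<longleftrightarrow> (\<exists>s\<in>?S. link p s \<pi> n)" if "n \<notin> ?S" for \<pi> n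
    unfolding move_link[OF H p x] using g1 g2 gS that vsS by metis
  have lr: "link r v \<pi> n \<longleftrightarrow> (\<exists>s\<in>?S. link p s \<pi> (f' n))" if "n \<in> nds r" "n \<noteq> v" for \<pi> n
    using isom_link[OF i' vN that(1)] lq[OF f'o(2)[OF that]] f'v by simp
  have fr: "\<pi> \<in> free D (nds D) w" if "w \<in> nds D" "link p (\<psi> w) \<pi> n" "n \<notin> ?S" for w \<pi> n
  proof -
    have "\<pi> \<in> free p ?S (\<psi> w)" by (rule link_free[OF p that(2,3)])
    then have "\<pi> \<in> free (subpath p ?S) ?S (\<psi> w)" using free_subpath[of ?S ?S "\<psi> w" p] \<psi>S that(1) by simp
    then show ?thesis using isom_free[OF \<psi> that(1)] by simp
  qed
  have arcr: "(a, b) \<in> arcs r \<longleftrightarrow> (f' a, f' b) \<in> arcs p" if "a \<in> nds r" "b \<in> nds r" "a \<noteq> v" "b \<noteq> v" for a b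
  proof -
    have "(a, b) \<in> arcs r \<longleftrightarrow> (f' a, f' b) \<in> qarcs (gm p x) (arcs p)"
      using i' that qmap_arcs[OF qm] by (auto simp: isom_def)
    also have "\<dots> \<longleftrightarrow> (f' a, f' b) \<in> arcs p"
    proof
      assume "(f' a, f' b) \<in> qarcs (gm p x) (arcs p)"
      then obtain a' b' where "(a', b') \<in> arcs p" "gm p x a' = f' a" "gm p x b' = f' b" by (elim qarcsE)
      moreover have "a' = f' a" "b' = f' b"
        using calculation f'o that g1 g2 vsS by metis+
      ultimately show "(f' a, f' b) \<in> arcs p" by simp
    next
      assume ab: "(f' a, f' b) \<in> arcs p"
      then have "f' a \<noteq> f' b" using tree_irrefl[OF is_path_tree[OF p]] by auto
      then show "(f' a, f' b) \<in> qarcs (gm p x) (arcs p)"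
        using qarcsI[of "f' a" "f' b" "arcs p" "gm p x"] ab g1[OF f'o(2)] that by simp
    qed
    finally show ?thesis .
  qed
  have arcin: "(a, shift r w) \<in> arcs ?R \<longleftrightarrow> (f' a, \<psi> w) \<in> arcs p" if a: "a \<in> nds r" "a \<noteq> v" and w: "w \<in> nds D" for a w
  proof -
    have "(a, shift r w) \<in> arcs ?R \<longleftrightarrow> (a, v) \<in> arcs r \<and> srcnode D (arclab r (a, v)) = w"
      by (rule refine_arcs(2)[OF r D a(1) a(1) a(2) a(2)])
    also have "\<dots> \<longleftrightarrow> (f' a, \<psi> w) \<in> arcs p"
    proof
      assume *: "(a, v) \<in> arcs r \<and> srcnode D (arclab r (a, v)) = w"
      let ?k = "arclab r (a, v)"
      have "link r v (True, ?k) a" using * by (simp add: link_def)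
      then obtain s where s: "s \<in> ?S" "link p s (True, ?k) (f' a)" using lr[OF a] by auto
      obtain u where u: "u \<in> nds D" "s = \<psi> u" using s(1) \<psi>b by auto
      have "srcnode D ?k = u" using srcnode_eq[OF H D u(1) fr[OF u(1)]] s u f'o[OF a] by auto
      then show "(f' a, \<psi> w) \<in> arcs p" using * s(2) u by (simp add: link_def)
    next
      assume ar: "(f' a, \<psi> w) \<in> arcs p"
      let ?k = "arclab p (f' a, \<psi> w)"
      have l: "link p (\<psi> w) (True, ?k) (f' a)" using ar by (simp add: link_def)
      then have "link r v (True, ?k) a" using lr[OF a] \<psi>S[OF w] by auto
      then have "(a, v) \<in> arcs r" "arclab r (a, v) = ?k" by (auto simp: link_def)
      then show "(a, v) \<in> arcs r \<and> srcnode D (arclab r (a, v)) = w"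
        using srcnode_eq[OF H D w fr[OF w l f'o(2)[OF a]]] by simp
    qed
    finally show ?thesis .
  qed
  have arcout: "(shift r w, b) \<in> arcs ?R \<longleftrightarrow> (\<psi> w, f' b) \<in> arcs p" if b: "b \<in> nds r" "b \<noteq> v" and w: "w \<in> nds D" for b w
  proof -
    have "(shift r w, b) \<in> arcs ?R \<longleftrightarrow> (v, b) \<in> arcs r \<and> tgtnode D (arclab r (v, b)) = w"
      by (rule refine_arcs(3)[OF r D b(1) b(1) b(2) b(2)])
    also have "\<dots> \<longleftrightarrow> (\<psi> w, f' b) \<in> arcs p"
    proof
      assume *: "(v, b) \<in> arcs r \<and> tgtnode D (arclab r (v, b)) = w"
      let ?k = "arclab r (v, b)"
      have "link r v (False, ?k) b" using * by (simp add: link_def)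
      then obtain s where s: "s \<in> ?S" "link p s (False, ?k) (f' b)" using lr[OF b] by auto
      obtain u where u: "u \<in> nds D" "s = \<psi> u" using s(1) \<psi>b by auto
      have "tgtnode D ?k = u" using tgtnode_eq[OF H D u(1) fr[OF u(1)]] s u f'o[OF b] by auto
      then show "(\<psi> w, f' b) \<in> arcs p" using * s(2) u by (simp add: link_def)
    next
      assume ar: "(\<psi> w, f' b) \<in> arcs p"
      let ?k = "arclab p (\<psi> w, f' b)"
      have l: "link p (\<psi> w) (False, ?k) (f' b)" using ar by (simp add: link_def)
      then have "link r v (False, ?k) b" using lr[OF b] \<psi>S[OF w] by auto
      then have "(v, b) \<in> arcs r" "arclab r (v, b) = ?k" by (auto simp: link_def)
      then show "(v, b) \<in> arcs r \<and> tgtnode D (arclab r (v, b)) = w"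
        using tgtnode_eq[OF H D w fr[OF w l f'o(2)[OF b]]] by simp
    qed
    finally show ?thesis .
  qed
  have arcD: "(shift r w, shift r u) \<in> arcs ?R \<longleftrightarrow> (\<psi> w, \<psi> u) \<in> arcs p" if "w \<in> nds D" "u \<in> nds D" for w u
  proof -
    have "(shift r w, shift r u) \<in> arcs ?R \<longleftrightarrow> (w, u) \<in> arcs D" by (rule refine_arcs_new[OF r])
    also have "\<dots> \<longleftrightarrow> (\<psi> w, \<psi> u) \<in> arcs p"
      using \<psi> that \<psi>S by (auto simp: isom_def)
    finally show ?thesis .
  qed
  have "isom \<phi> ?R p"
    unfolding isom_def
  proof (intro conjI ballI)
    have "inj_on \<phi> (nds r - {v})" using f'b(1) \<phi>2 by (auto simp: inj_on_def)
    moreover have "inj_on \<phi> (shift r ` nds D)" using \<psi>b(1) \<phi>1 by (auto simp: inj_on_def)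
    moreover have im: "\<phi> ` (nds r - {v}) = nds p - ?S" "\<phi> ` shift r ` nds D = ?S"
      using f'im \<psi>b(2) \<phi>1 \<phi>2 by (simp_all add: image_image)
    ultimately have "inj_on \<phi> (nds ?R)" unfolding R inj_on_Un by blast
    moreover have "\<phi> ` nds ?R = nds p" unfolding R image_Un im using mp(1) by auto
    ultimately show "bij_betw \<phi> (nds ?R) (nds p)" by (simp add: bij_betw_def)
  next
    fix a assume a: "a \<in> nds ?R"
    show "lab p (\<phi> a) = lab ?R a"
    proof (cases "a \<in> shift r ` nds D")
      case True
      then obtain w where w: "w \<in> nds D" "a = shift r w" by auto
      have "lab p (\<psi> w) = lab D w" using \<psi> w(1) by (simp add: isom_def)
      then show ?thesis using w \<phi>1 refine_lab(1)[OF r] by simp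
    next
      case False
      then have n: "a \<in> nds r" "a \<noteq> v" using a R by auto
      have "lab p (f' a) = lab ?q (f' a)" using lab_outside[OF f'o(2)[OF n] mp(4,2)] by simp
      also have "\<dots> = lab r a" using i' n by (simp add: isom_def)
      finally show ?thesis using n \<phi>2 refine_lab(2)[OF r n(1)] by simp
    qed
    fix b assume b: "b \<in> nds ?R"
    have cs: "(\<exists>w\<in>nds D. c = shift r w) \<or> c \<in> nds r \<and> c \<noteq> v" if "c \<in> nds ?R" for c using that R by auto
    show "(a, b) \<in> arcs ?R \<longleftrightarrow> (\<phi> a, \<phi> b) \<in> arcs p"
      using cs[OF a] cs[OF b]
    proof (elim disjE bexE conjE)
      fix w u assume "w \<in> nds D" "a = shift r w" "u \<in> nds D" "b = shift r u"
      then show ?thesis using arcD \<phi>1 by simp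
    next
      fix w assume "w \<in> nds D" "a = shift r w" "b \<in> nds r" "b \<noteq> v"
      then show ?thesis using arcout \<phi>1 \<phi>2 by simp
    next
      fix u assume "a \<in> nds r" "a \<noteq> v" "u \<in> nds D" "b = shift r u"
      then show ?thesis using arcin \<phi>1 \<phi>2 by simp
    next
      assume "a \<in> nds r" "a \<noteq> v" "b \<in> nds r" "b \<noteq> v"
      then show ?thesis using arcr refine_arcs(1)[OF r D, of a b v] \<phi>2 by simp
    qed
  qed
  moreover have "\<phi> ` shift r ` nds D = ?S" using \<psi>b(2) \<phi>1 by (simp add: image_image)
  ultimately show ?thesis unfolding v_def vs_def by blast
qed

text \<open>The map \<phi> carries the inserted tree to a connected set \<open>S\<close> that
  satisfies \<open>fits\<close>, so \<open>fits_marker\<close> provides a move contracting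
  \<open>S\<close>. Its result and \<open>r\<close> are both quotients of the refinement, with equal
  kernels and flags, hence isomorphic.\<close>

lemma move_refine:
  assumes H: "higraph V E" and p: "is_path (bedges V E) p"
    and r: "is_path (bedges V E) r" and D: "is_path (bedges V E) D"
    and v: "v \<in> nds r" and fits: "fits D (lab r v)" and \<phi>: "isom \<phi> (refine r v D) p"
  shows "\<exists>x f \<psi>. valid_marker p x \<and> mnodes p x = \<phi> ` shift r ` nds D \<and> isom f (qmove p x) r \<and>
    f (Min (mnodes p x)) = v \<and> isom \<psi> D (subpath p (mnodes p x))"
proof -
  let ?R = "refine r v D" and ?H = "shift r ` nds D"
  define S where "S = \<phi> ` ?H"
  have neD: "nds D \<noteq> {}" using is_path_tree[OF D] by (simp add: is_tree_def)
  have fpD: "fports D (nds D) = ports (lab r v)" using fits psrc_ptgt_iff[OF D] by (simp add: fits_def)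
  note sub = refine_sub[OF H r D fpD]
  have R: "is_path (bedges V E) ?R" by (rule isom_path[OF H isom_sym[OF \<phi>] p sub])
  note rq = refine_qmap[OF H r D v fpD R]
  have HR: "?H \<subseteq> nds ?R" by (auto simp: refine_simps)
  have b: "\<phi> ` nds ?R = nds p" "inj_on \<phi> (nds ?R)" using \<phi> by (auto simp: isom_def bij_betw_def)
  have S: "S \<subseteq> nds p" "S \<noteq> {}" using HR b neD by (auto simp: S_def)
  have cS: "conn (arcs p) S"
  proof -
    have "conn (qarcs \<phi> (arcs ?R \<inter> ?H \<times> ?H)) (\<phi> ` ?H)"
      by (rule conn_image[OF conn_mono[OF rq(3)]]) auto
    then show ?thesis
      unfolding S_def using isom_arcs[OF \<phi> sub is_path_arcs[OF p]]
      by (rule_tac conn_mono) (auto elim!: qarcsE)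
  qed
  have \<phi>S: "\<phi> a \<in> S \<longleftrightarrow> a \<in> ?H" if "a \<in> nds ?R" for a
    using inj_on_image_mem_iff[OF b(2) that HR] by (simp add: S_def)
  have iS: "isom \<phi> (subpath ?R ?H) (subpath p S)"
    unfolding isom_def subpath_simps
  proof (intro conjI ballI)
    show "bij_betw \<phi> ?H S" unfolding S_def using inj_on_subset[OF b(2) HR] by (simp add: bij_betw_def)
    fix a assume a: "a \<in> ?H"
    show "lab p (\<phi> a) = lab ?R a" using \<phi> a HR by (auto simp: isom_def)
    fix c assume c: "c \<in> ?H"
    have "(a, c) \<in> arcs ?R \<longleftrightarrow> (\<phi> a, \<phi> c) \<in> arcs p" using \<phi> subsetD[OF HR a] subsetD[OF HR c] unfolding isom_def by blast
    then show "(a, c) \<in> arcs ?R \<inter> ?H \<times> ?H \<longleftrightarrow> (\<phi> a, \<phi> c) \<in> arcs p \<inter> S \<times> S"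
      using a c by (auto simp: S_def)
  qed
  have \<psi>: "isom (\<phi> \<circ> shift r) D (subpath p S)" by (rule isom_trans[OF rq(2) iS])
  have "fits (subpath p S) (lab r v)"
    using isom_fits[OF H \<psi> D subpath_path[OF p S cS]] fits by simp
  then obtain x where x: "valid_marker p x" "mnodes p x = S" "mtype p x = bd r v"
    using fits_marker[OF H p S cS] path_typed[OF H r v] by blast
  have fS: "finite S" using S(1) is_path_finite[OF p] finite_subset by auto
  note cq = contract_qmap[OF p S cS, where m = "bd r v"]
  have qx: "qmove p x = contract p S (bd r v)" using x by (simp add: qmove_contract)
  have cm: "qmap (cmap S \<circ> \<phi>) ?R (contract p S (bd r v))"
    by (rule qmap_comp[OF H path_prepath[OF H R] isom_qmap[OF \<phi> R is_path_arcs[OF p]] cq(1)])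
  obtain f where f: "isom f (contract p S (bd r v)) r" "\<And>a. a \<in> nds ?R \<Longrightarrow> f ((cmap S \<circ> \<phi>) a) = rmap r v a"
  proof (rule qmap_unique[OF cm rq(1) sub])
    fix a c assume a: "a \<in> nds ?R" and c: "c \<in> nds ?R"
    have "\<phi> a = \<phi> c \<longleftrightarrow> a = c" using b(2) a c by (auto dest: inj_onD)
    then have "(cmap S \<circ> \<phi>) a = (cmap S \<circ> \<phi>) c \<longleftrightarrow> a = c \<or> a \<in> ?H \<and> c \<in> ?H"
      using cmap_eq_iff[OF fS S(2)] \<phi>S[OF a] \<phi>S[OF c] by simp
    moreover have "c \<in> ?H \<or> c \<noteq> v" "a \<in> ?H \<or> a \<noteq> v" using a c by (auto simp: refine_simps(1))
    ultimately show "(cmap S \<circ> \<phi>) a = (cmap S \<circ> \<phi>) c \<longleftrightarrow> rmap r v a = rmap r v c"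
      unfolding rq(4)[OF a] rq(4)[OF c] by auto
  next
    fix a assume a: "a \<in> nds ?R"
    have pa: "\<phi> a \<in> nds p" using a b by auto
    have "a \<in> nds r" if "a \<notin> ?H" using a that by (auto simp: refine_simps(1))
    then show "bd (contract p S (bd r v)) ((cmap S \<circ> \<phi>) a) = bd r (rmap r v a)"
      using cq(2)[OF pa] \<phi>S[OF a] rq(4)[OF a] refine_lab(2)[OF r] isom_bd[OF \<phi> a] by auto
  qed blast
  obtain w where w: "w \<in> nds D" using neD by auto
  then have wR: "shift r w \<in> nds ?R" "shift r w \<in> ?H" using HR by auto
  have "(cmap S \<circ> \<phi>) (shift r w) = Min S" using \<phi>S[OF wR(1)] wR(2) by (simp add: cmap_def)
  then have "f (Min S) = v" using f(2)[OF wR(1)] rq(4)[OF wR(1)] wR(2) by simp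
  then show ?thesis
    using x(1,2) f(1) \<psi> unfolding qx[symmetric] S_def[symmetric]
    by (intro exI[of _ x] exI[of _ f] exI[of _ "\<phi> \<circ> shift r"]) simp
qed

section \<open>Duality on isomorphism classes\<close>

definition piso :: "'v set \<Rightarrow> 'v hedge set \<Rightarrow> ('v pth \<times> 'v pth) set" where
  "piso V E = {(p, q). p \<in> paths V E \<and> q \<in> paths V E \<and> path_iso p q}"

lemma paths_iff: "p \<in> paths V E \<longleftrightarrow> is_path (bedges V E) p"
  by (simp add: paths_def)

lemma equiv_piso: "equiv (paths V E) (piso V E)"
proof (rule equivI)
  show "piso V E \<subseteq> paths V E \<times> paths V E" by (auto simp: piso_def)
  show "refl_on (paths V E) (piso V E)"
    by (rule refl_onI) (use isom_refl in \<open>auto simp: piso_def path_iso_isom\<close>)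
  show "sym (piso V E)"
    by (rule symI) (use isom_sym in \<open>force simp: piso_def path_iso_isom\<close>)
  show "trans (piso V E)"
    by (rule transI) (use isom_trans in \<open>force simp: piso_def path_iso_isom\<close>)
qed

lemma pclasses_quotient: "pclasses V E = paths V E // piso V E"
  by (simp add: pclasses_def piso_def)

definition cls :: "'v set \<Rightarrow> 'v hedge set \<Rightarrow> 'v pth \<Rightarrow> 'v pth set" where
  "cls V E p = piso V E `` {p}"

lemma cls_pclasses: "p \<in> paths V E \<Longrightarrow> cls V E p \<in> pclasses V E"
  unfolding cls_def pclasses_quotient by (rule quotientI)

lemma mem_class_iff:
  assumes "C \<in> pclasses V E"
  shows "p \<in> C \<longleftrightarrow> p \<in> paths V E \<and> C = cls V E p"
proof -
  obtain q where q: "q \<in> paths V E" "C = cls V E q"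
    using assms unfolding pclasses_quotient cls_def by (auto elim: quotientE)
  have "p \<in> C \<longleftrightarrow> (q, p) \<in> piso V E" by (simp add: q cls_def)
  also have "\<dots> \<longleftrightarrow> p \<in> paths V E \<and> C = cls V E p"
    using eq_equiv_class_iff[OF equiv_piso q(1), of p] q by (auto simp: cls_def piso_def)
  finally show ?thesis .
qed

lemma rep_class:
  assumes "C \<in> pclasses V E"
  shows "rep C \<in> C" "rep C \<in> paths V E" "is_path (bedges V E) (rep C)" "cls V E (rep C) = C"
proof -
  obtain q where q: "q \<in> paths V E" "C = cls V E q"
    using assms unfolding pclasses_quotient cls_def by (auto elim: quotientE)
  then have "q \<in> C" using mem_class_iff[OF assms] by simp
  then show r: "rep C \<in> C" unfolding rep_def by (rule someI[of "\<lambda>x. x \<in> C"])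
  show "rep C \<in> paths V E" "is_path (bedges V E) (rep C)" "cls V E (rep C) = C"
    using r mem_class_iff[OF assms, of "rep C"] paths_iff[of "rep C" V E] by auto
qed

lemma cls_eq_iff:
  assumes "p \<in> paths V E" "q \<in> paths V E"
  shows "cls V E p = cls V E q \<longleftrightarrow> (\<exists>f. isom f p q)"
  using eq_equiv_class_iff[OF equiv_piso assms] assms by (auto simp: cls_def piso_def path_iso_isom)

lemma mem_class_isom:
  assumes "C \<in> pclasses V E" "q \<in> paths V E"
  shows "q \<in> C \<longleftrightarrow> (\<exists>f. isom f q (rep C))"
  using mem_class_iff[OF assms(1), of q] cls_eq_iff[OF assms(2) rep_class(2)[OF assms(1)]]
    rep_class(4)[OF assms(1)] assms(2) by auto

definition moves :: "'v pth set \<Rightarrow> 'v pth set \<Rightarrow> marker set" where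
  "moves C \<sigma> = {x. valid_marker (rep C) x \<and> qmove (rep C) x \<in> \<sigma>}"

definition refinements :: "'v set \<Rightarrow> 'v hedge set \<Rightarrow> 'v pth set \<Rightarrow> 'v pth set \<Rightarrow> (nat \<times> 'v pth set) set" where
  "refinements V E \<sigma> C = {(v, D). v \<in> nds (rep \<sigma>) \<and> D \<in> pclasses V E \<and> fits (rep D) (lab (rep \<sigma>) v) \<and>
     refine (rep \<sigma>) v (rep D) \<in> C}"

lemma bij_betw_relation:
  assumes "\<And>x. x \<in> X \<Longrightarrow> \<exists>y\<in>Y. Z x y" "\<And>y. y \<in> Y \<Longrightarrow> \<exists>x\<in>X. Z x y"
    and "\<And>x x' y. x \<in> X \<Longrightarrow> x' \<in> X \<Longrightarrow> y \<in> Y \<Longrightarrow> Z x y \<Longrightarrow> Z x' y \<Longrightarrow> x = x'"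
    and "\<And>x y y'. x \<in> X \<Longrightarrow> y \<in> Y \<Longrightarrow> y' \<in> Y \<Longrightarrow> Z x y \<Longrightarrow> Z x y' \<Longrightarrow> y = y'"
  shows "\<exists>h. bij_betw h X Y"
proof -
  obtain h where h: "\<And>x. x \<in> X \<Longrightarrow> h x \<in> Y \<and> Z x (h x)" using assms(1) by metis
  have "inj_on h X"
  proof (rule inj_onI)
    fix x x' assume x: "x \<in> X" "x' \<in> X" "h x = h x'"
    show "x = x'" by (rule assms(3)[OF x(1,2)]) (use h[OF x(1)] h[OF x(2)] x(3) in auto)
  qed
  moreover have "h ` X = Y"
  proof (intro equalityI subsetI)
    fix y assume y: "y \<in> Y"
    then obtain x where x: "x \<in> X" "Z x y" using assms(2) by blast
    then have "h x = y" using assms(4)[OF x(1) _ y _ x(2)] h by blast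
    then show "y \<in> h ` X" using x by blast
  qed (use h in auto)
  ultimately show ?thesis by (auto simp: bij_betw_def)
qed

text \<open>The relation \<open>Z\<close> joins a marker \<open>x\<close> to \<open>(v, D)\<close>
  if some isomorphism from the refined path to \<open>rep C\<close> takes the inserted tree to the
  nodes contracted at \<open>x\<close>. Partners exist by \<open>refine_move\<close> and
  \<open>move_refine\<close>. They are unique because isomorphisms between two given paths are: the
  inserted tree then has a definite image, which fixes \<open>x\<close> by
  \<open>mnodes_inj\<close>, and conversely \<open>x\<close> fixes the node \<open>v\<close> and the
  class of the contracted subpath.\<close>

lemma moves_refinements:
  assumes H: "higraph V E" and C: "C \<in> pclasses V E" and \<sigma>: "\<sigma> \<in> pclasses V E"
  shows "\<exists>h. bij_betw h (moves C \<sigma>) (refinements V E \<sigma> C)"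
proof -
  let ?p = "rep C" and ?r = "rep \<sigma>"
  note p = rep_class(3)[OF C] and r = rep_class(3)[OF \<sigma>]
  define Z where "Z = (\<lambda>x (v, D). \<exists>\<phi>. isom \<phi> (refine ?r v (rep D)) ?p \<and> \<phi> ` shift ?r ` nds (rep D) = mnodes ?p x)"
  have rf: "\<exists>\<phi>. isom \<phi> (refine ?r v (rep D)) ?p" "is_path (bedges V E) (refine ?r v (rep D))"
    if "(v, D) \<in> refinements V E \<sigma> C" for v D
    using that mem_class_iff[OF C, of "refine ?r v (rep D)"] mem_class_isom[OF C, of "refine ?r v (rep D)"]
    by (auto simp: refinements_def paths_iff)
  have inv: "\<exists>f \<psi>. isom f (qmove ?p x) ?r \<and> f (Min (mnodes ?p x)) = v \<and> isom \<psi> (rep D) (subpath ?p (mnodes ?p x))"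
    if x: "valid_marker ?p x" and vD: "(v, D) \<in> refinements V E \<sigma> C" and z: "Z x (v, D)" for x v D
  proof -
    have D: "is_path (bedges V E) (rep D)" and v: "v \<in> nds ?r" "fits (rep D) (lab ?r v)"
      using vD rep_class(3) by (auto simp: refinements_def)
    obtain \<phi> where \<phi>: "isom \<phi> (refine ?r v (rep D)) ?p" "\<phi> ` shift ?r ` nds (rep D) = mnodes ?p x"
      using z by (auto simp: Z_def)
    obtain y f \<psi> where y: "valid_marker ?p y" "mnodes ?p y = \<phi> ` shift ?r ` nds (rep D)" "isom f (qmove ?p y) ?r"
        "f (Min (mnodes ?p y)) = v" "isom \<psi> (rep D) (subpath ?p (mnodes ?p y))"
      using move_refine[OF H p r D v \<phi>(1)] by auto
    have "y = x" using mnodes_inj[OF p y(1) x] y(2) \<phi>(2) by simp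
    then show ?thesis using y by blast
  qed
  show ?thesis
  proof (rule bij_betw_relation[where Z = Z])
    fix x assume "x \<in> moves C \<sigma>"
    then have x: "valid_marker ?p x" "qmove ?p x \<in> \<sigma>" by (auto simp: moves_def)
    then obtain f where f: "isom f (qmove ?p x) ?r"
      using mem_class_isom[OF \<sigma>, of "qmove ?p x"] move_path[OF H p x(1)] by (auto simp: paths_iff)
    note mp = mnodes_props[OF p x(1)]
    note sp = subpath_path[OF p mp(1-3)]
    define D where "D = cls V E (subpath ?p (mnodes ?p x))"
    have D: "D \<in> pclasses V E" unfolding D_def using sp by (intro cls_pclasses) (simp add: paths_iff)
    note Dp = rep_class(3)[OF D]
    have "subpath ?p (mnodes ?p x) \<in> D" using mem_class_iff[OF D] D_def sp by (simp add: paths_iff)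
    then obtain \<psi>0 where "isom \<psi>0 (subpath ?p (mnodes ?p x)) (rep D)"
      using mem_class_isom[OF D] sp by (auto simp: paths_iff)
    then obtain \<psi> where \<psi>: "isom \<psi> (rep D) (subpath ?p (mnodes ?p x))" using isom_sym by blast
    define v where "v = f (Min (mnodes ?p x))"
    obtain \<phi> where \<phi>: "isom \<phi> (refine ?r v (rep D)) ?p" "\<phi> ` shift ?r ` nds (rep D) = mnodes ?p x"
      using refine_move[OF H p x(1) r f Dp \<psi>] by (auto simp: v_def)
    note m = Min_mnodes_nds[OF p x(1)]
    have v: "v \<in> nds ?r" "lab ?r v = lab (qmove ?p x) (Min (mnodes ?p x))"
      using f m by (auto simp: v_def isom_def bij_betw_def)
    have fit: "fits (rep D) (lab ?r v)"
      unfolding v(2) isom_fits[OF H \<psi> Dp sp] by (rule marker_fits[OF H p x(1)])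
    have fpD: "fports (rep D) (nds (rep D)) = ports (lab ?r v)"
      using fit psrc_ptgt_iff[OF Dp] by (simp add: fits_def)
    have "is_path (bedges V E) (refine ?r v (rep D))"
      using isom_path[OF H isom_sym[OF \<phi>(1)] p refine_sub[OF H r Dp fpD]] .
    then have "refine ?r v (rep D) \<in> C"
      using mem_class_isom[OF C] \<phi>(1) by (auto simp: paths_iff)
    then have "(v, D) \<in> refinements V E \<sigma> C" using v(1) D fit by (simp add: refinements_def)
    moreover have "Z x (v, D)" using \<phi> by (auto simp: Z_def)
    ultimately show "\<exists>y\<in>refinements V E \<sigma> C. Z x y" by blast
  next
    fix z assume z: "z \<in> refinements V E \<sigma> C"
    obtain v D where vD: "z = (v, D)" by (cases z)
    have D: "D \<in> pclasses V E" and v: "v \<in> nds ?r" "fits (rep D) (lab ?r v)" using z vD by (auto simp: refinements_def)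
    obtain \<phi> where \<phi>: "isom \<phi> (refine ?r v (rep D)) ?p" using rf(1) z vD by blast
    obtain x f where x: "valid_marker ?p x" "mnodes ?p x = \<phi> ` shift ?r ` nds (rep D)" "isom f (qmove ?p x) ?r"
      using move_refine[OF H p r rep_class(3)[OF D] v \<phi>] by auto
    have "qmove ?p x \<in> \<sigma>"
      using mem_class_isom[OF \<sigma>] move_path[OF H p x(1)] x(3) by (auto simp: paths_iff)
    then have "x \<in> moves C \<sigma>" using x(1) by (simp add: moves_def)
    moreover have "Z x z" using \<phi> x(2) vD by (auto simp: Z_def)
    ultimately show "\<exists>x\<in>moves C \<sigma>. Z x z" by blast
  next
    fix x x' z assume x: "x \<in> moves C \<sigma>" "x' \<in> moves C \<sigma>" and z: "z \<in> refinements V E \<sigma> C" and Z: "Z x z" "Z x' z"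
    obtain v D where vD: "z = (v, D)" by (cases z)
    let ?R = "refine ?r v (rep D)"
    obtain \<phi> \<phi>' where \<phi>: "isom \<phi> ?R ?p" "\<phi> ` shift ?r ` nds (rep D) = mnodes ?p x"
        "isom \<phi>' ?R ?p" "\<phi>' ` shift ?r ` nds (rep D) = mnodes ?p x'"
      using Z vD by (auto simp: Z_def)
    have "\<phi> a = \<phi>' a" if "a \<in> shift ?r ` nds (rep D)" for a
      using isom_unique[OF rf(2) p \<phi>(1,3)] z vD that by (auto simp: refine_simps(1))
    then have "mnodes ?p x = mnodes ?p x'" unfolding \<phi>(2,4)[symmetric] by (rule image_cong[OF refl])
    then show "x = x'" using mnodes_inj[OF p] x by (auto simp: moves_def)
  next
    fix x z z' assume x: "x \<in> moves C \<sigma>" and z: "z \<in> refinements V E \<sigma> C" "z' \<in> refinements V E \<sigma> C" and Z: "Z x z" "Z x z'"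
    obtain v D v' D' where vD: "z = (v, D)" "z' = (v', D')" by (cases z; cases z')
    have xv: "valid_marker ?p x" using x by (simp add: moves_def)
    note mp = mnodes_props[OF p xv]
    obtain f \<psi> where f: "isom f (qmove ?p x) ?r" "f (Min (mnodes ?p x)) = v" "isom \<psi> (rep D) (subpath ?p (mnodes ?p x))"
      using inv[OF xv] z Z vD by blast
    obtain f' \<psi>' where f': "isom f' (qmove ?p x) ?r" "f' (Min (mnodes ?p x)) = v'"
        "isom \<psi>' (rep D') (subpath ?p (mnodes ?p x))"
      using inv[OF xv] z Z vD by blast
    note m = Min_mnodes_nds[OF p xv]
    have "v = v'" using isom_unique[OF move_path[OF H p xv] r f(1) f'(1) m] f(2) f'(2) by simp
    moreover have "D = D'"
    proof -
      have DD: "D \<in> pclasses V E" "D' \<in> pclasses V E" using z vD by (auto simp: refinements_def)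
      have "\<exists>h. isom h (rep D) (rep D')" using isom_trans[OF f(3) isom_sym[OF f'(3)]] by blast
      then show ?thesis
        using cls_eq_iff[OF rep_class(2)[OF DD(1)] rep_class(2)[OF DD(2)]] rep_class(4) DD by metis
    qed
    ultimately show "z = z'" using vD by simp
  qed
qed

lemma finite_moves: "C \<in> pclasses V E \<Longrightarrow> finite (moves C \<sigma>)"
  unfolding moves_def
  by (rule finite_subset[OF _ finite_markers[OF rep_class(3)]]) (auto dest: valid_markers)

lemma refinements_card:
  assumes "higraph V E" "C \<in> pclasses V E" "\<sigma> \<in> pclasses V E"
  shows "finite (refinements V E \<sigma> C)" "card (refinements V E \<sigma> C) = card (moves C \<sigma>)"
  using moves_refinements[OF assms] finite_moves[OF assms(2), of \<sigma>] bij_betw_finite bij_betw_same_card by metis+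

section \<open>Coefficients of the two maps modulo 2\<close>

lemma bdry_iff:
  assumes "a \<in> dga V E"
  shows "bdry V E a \<sigma> \<longleftrightarrow> \<sigma> \<in> pclasses V E \<and> odd (\<Sum>C\<in>{C. a C}. card (moves C \<sigma>))"
proof -
  have a: "finite {C. a C}" "\<And>C. a C \<Longrightarrow> C \<in> pclasses V E" using assms by (auto simp: dga_def)
  have "{(C, x). a C \<and> C \<in> pclasses V E \<and> x \<in> markers (rep C) \<and> valid_marker (rep C) x \<and> qmove (rep C) x \<in> \<sigma>} =
      Sigma {C. a C} (\<lambda>C. moves C \<sigma>)"
    using a(2) valid_markers by (auto simp: moves_def)
  moreover have "card (Sigma {C. a C} (\<lambda>C. moves C \<sigma>)) = (\<Sum>C\<in>{C. a C}. card (moves C \<sigma>))"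
    using a finite_moves[of _ V E] by (intro card_SigmaI) auto
  ultimately show ?thesis by (simp add: bdry_def)
qed

text \<open>The coefficient of \<open>C\<close> is computed from moves out of \<open>C\<close>, in
  place of refinements that lead into \<open>C\<close>.\<close>

lemma dlt_iff:
  assumes H: "higraph V E" and b: "b \<in> dga V E"
  shows "dlt V E b C \<longleftrightarrow> C \<in> pclasses V E \<and> odd (\<Sum>\<sigma>\<in>{\<sigma>. b \<sigma>}. card (moves C \<sigma>))"
proof (cases "C \<in> pclasses V E")
  case True
  have b: "finite {C. b C}" "\<And>C. b C \<Longrightarrow> C \<in> pclasses V E" using b by (auto simp: dga_def)
  have "{(\<sigma>, v, D). b \<sigma> \<and> \<sigma> \<in> pclasses V E \<and> v \<in> nds (rep \<sigma>) \<and> D \<in> pclasses V E \<and>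
        (if bmu (lab (rep \<sigma>) v) then boundary_path (rep D) \<and> plength (rep D) = 2 else pweight (rep D) = 2) \<and>
        psrc (rep D) = bsrc (lab (rep \<sigma>) v) \<and> ptgt (rep D) = btgt (lab (rep \<sigma>) v) \<and>
        refine (rep \<sigma>) v (rep D) \<in> C} = Sigma {\<sigma>. b \<sigma>} (\<lambda>\<sigma>. refinements V E \<sigma> C)"
    using b(2) unfolding refinements_def fits_def by blast
  moreover have "card (Sigma {\<sigma>. b \<sigma>} (\<lambda>\<sigma>. refinements V E \<sigma> C)) = (\<Sum>\<sigma>\<in>{\<sigma>. b \<sigma>}. card (moves C \<sigma>))"
    using b refinements_card[OF H True] by (subst card_SigmaI) auto
  ultimately show ?thesis unfolding dlt_def by simp
qed (simp add: dlt_def)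

text \<open>Composition over the field with two elements: the support of the inner value is the set
  of indices with odd multiplicity, and over the integers the composite is a sum of
  products.\<close>

lemma even_sum_odd_filter:
  fixes m n :: "'a \<Rightarrow> nat"
  assumes "finite S"
  shows "even (\<Sum>s\<in>{s\<in>S. odd (m s)}. n s) \<longleftrightarrow> even (\<Sum>s\<in>S. m s * n s)"
proof -
  have "{s\<in>S. odd (m s * n s)} = {s\<in>{s\<in>S. odd (m s)}. odd (n s)}" by auto
  then show ?thesis using assms by (simp add: even_sum_iff)
qed

text \<open>A second move acts on the concrete result of the first, while the matrix entry refers to
  the representative of its class; an isomorphism between the two matches their markers.\<close>

lemma moves_card_isom:
  assumes H: "higraph V E" and \<sigma>: "\<sigma> \<in> pclasses V E" and \<tau>: "\<tau> \<in> pclasses V E" and q: "q \<in> \<sigma>"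
  shows "card {y. valid_marker q y \<and> qmove q y \<in> \<tau>} = card (moves \<sigma> \<tau>)"
proof -
  have qp: "is_path (bedges V E) q" using mem_class_iff[OF \<sigma>] q by (simp add: paths_iff)
  note r = rep_class(3)[OF \<sigma>]
  obtain f where f: "isom f q (rep \<sigma>)" using mem_class_isom[OF \<sigma>] q qp by (auto simp: paths_iff)
  note f' = isom_sym[OF f]
  let ?f' = "inv_into (nds q) f"
  have mem: "qmove q' (map_marker g y) \<in> \<tau>" if q': "is_path (bedges V E) p'" "is_path (bedges V E) q'" "isom g p' q'"
      "valid_marker p' y" "qmove p' y \<in> \<tau>" for g p' q' y
  proof -
    obtain h where h: "isom h (qmove p' y) (qmove q' (map_marker g y))" using isom_move[OF H q'(3,1,2,4)] by auto
    have "qmove p' y \<in> paths V E" "qmove q' (map_marker g y) \<in> paths V E"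
      using move_path[OF H q'(1,4)] move_path[OF H q'(2) isom_marker(1)[OF H q'(3,1,2,4)]] by (auto simp: paths_iff)
    then show ?thesis using h cls_eq_iff mem_class_iff[OF \<tau>] q'(5) by metis
  qed
  have fb: "bij_betw f (nds q) (nds (rep \<sigma>))" using f by (simp add: isom_def)
  have "bij_betw (map_marker f) {y. valid_marker q y \<and> qmove q y \<in> \<tau>} (moves \<sigma> \<tau>)"
  proof (rule bij_betw_byWitness[where f' = "map_marker ?f'"])
    have c: "fst e \<in> nds q" "snd e \<in> nds q" if "e \<in> arcs q" for e using is_path_arcs[OF qp] that by auto
    have c': "fst e \<in> nds (rep \<sigma>)" "snd e \<in> nds (rep \<sigma>)" if "e \<in> arcs (rep \<sigma>)" for e using is_path_arcs[OF r] that by auto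
    show "\<forall>y\<in>{y. valid_marker q y \<and> qmove q y \<in> \<tau>}. map_marker ?f' (map_marker f y) = y"
      using bij_betw_inv_into_left[OF fb] c by (auto simp: valid_marker_def split: marker.splits)
    show "\<forall>y\<in>moves \<sigma> \<tau>. map_marker f (map_marker ?f' y) = y"
      using bij_betw_inv_into_right[OF fb] c' by (auto simp: moves_def valid_marker_def split: marker.splits)
    show "map_marker f ` {y. valid_marker q y \<and> qmove q y \<in> \<tau>} \<subseteq> moves \<sigma> \<tau>"
      using mem[OF qp r f] isom_marker(1)[OF H f qp r] by (auto simp: moves_def)
    show "map_marker ?f' ` moves \<sigma> \<tau> \<subseteq> {y. valid_marker q y \<and> qmove q y \<in> \<tau>}"
      using mem[OF r qp f'] isom_marker(1)[OF H f' r qp] by (auto simp: moves_def)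
  qed
  then show ?thesis by (rule bij_betw_same_card)
qed

text \<open>A finite range for sums over the intermediate class of two successive moves from
  \<open>C\<close>.\<close>

definition successors :: "'v set \<Rightarrow> 'v hedge set \<Rightarrow> 'v pth set \<Rightarrow> 'v pth set set" where
  "successors V E C = (\<lambda>x. cls V E (qmove (rep C) x)) ` {x. valid_marker (rep C) x}"

lemma finite_valid: "is_path BE p \<Longrightarrow> finite {x. valid_marker p x}"
  by (rule finite_subset[OF _ finite_markers]) (auto dest: valid_markers)

lemma successors_props:
  assumes H: "higraph V E" and C: "C \<in> pclasses V E"
  shows "finite (successors V E C)" "successors V E C \<subseteq> pclasses V E"
    and "\<sigma> \<in> pclasses V E \<Longrightarrow> moves C \<sigma> \<noteq> {} \<Longrightarrow> \<sigma> \<in> successors V E C"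
proof -
  note p = rep_class(3)[OF C]
  show "finite (successors V E C)" unfolding successors_def using finite_valid[OF p] by simp
  show "successors V E C \<subseteq> pclasses V E"
    unfolding successors_def using move_path[OF H p] by (auto simp: paths_iff intro: cls_pclasses)
  show "\<sigma> \<in> successors V E C" if "\<sigma> \<in> pclasses V E" "moves C \<sigma> \<noteq> {}"
    using that mem_class_iff[OF that(1)] by (auto simp: moves_def successors_def)
qed

text \<open>Grouping the double moves of \<open>double_even\<close> by the class of the intermediate
  path turns their number into an entry of the squared matrix. \<open>S\<close> may exceed the
  successors of \<open>C\<close>, since one set has to serve all classes in the support of a
  chain.\<close>

lemma double_sum_even:
  assumes H: "higraph V E" and C: "C \<in> pclasses V E" and \<tau>: "\<tau> \<in> pclasses V E"
    and S: "finite S" "S \<subseteq> pclasses V E" "successors V E C \<subseteq> S"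
  shows "even (\<Sum>\<sigma>\<in>S. card (moves C \<sigma>) * card (moves \<sigma> \<tau>))"
proof -
  let ?p = "rep C"
  note p = rep_class(3)[OF C]
  let ?X = "{x. valid_marker ?p x}"
  let ?Y = "\<lambda>x. {y. valid_marker (qmove ?p x) y \<and> qmove (qmove ?p x) y \<in> \<tau>}"
  have fX: "finite ?X" by (rule finite_valid[OF p])
  have inv: "(q \<in> \<tau>) = (q' \<in> \<tau>)"
    if "is_path (bedges V E) q" "is_path (bedges V E) q'" "isom h q q'" for q q' h
    using cls_eq_iff[of q V E q'] mem_class_iff[OF \<tau>] that by (auto simp: paths_iff)
  have "even (card {(x, y). valid_marker ?p x \<and> valid_marker (qmove ?p x) y \<and> qmove (qmove ?p x) y \<in> \<tau>})"
    by (rule double_even[OF H p]) (rule inv)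
  also have "{(x, y). valid_marker ?p x \<and> valid_marker (qmove ?p x) y \<and> qmove (qmove ?p x) y \<in> \<tau>} = Sigma ?X ?Y"
    by auto
  also have "card (Sigma ?X ?Y) = (\<Sum>x\<in>?X. card (?Y x))"
  proof (rule card_SigmaI[OF fX], rule ballI)
    fix x assume "x \<in> ?X"
    then have "is_path (bedges V E) (qmove ?p x)" using move_path[OF H p] by simp
    from finite_valid[OF this] show "finite (?Y x)" by (rule rev_finite_subset) auto
  qed
  also have "\<dots> = (\<Sum>x\<in>?X. card (moves (cls V E (qmove ?p x)) \<tau>))"
  proof (rule sum.cong[OF refl])
    fix x assume "x \<in> ?X"
    then have q: "qmove ?p x \<in> paths V E" using move_path[OF H p] by (simp add: paths_iff)
    then have "qmove ?p x \<in> cls V E (qmove ?p x)" using mem_class_iff[OF cls_pclasses[OF q]] by simp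
    then show "card (?Y x) = card (moves (cls V E (qmove ?p x)) \<tau>)"
      by (rule moves_card_isom[OF H cls_pclasses[OF q] \<tau>])
  qed
  also have "\<dots> = (\<Sum>\<sigma>\<in>S. \<Sum>x\<in>{x\<in>?X. cls V E (qmove ?p x) = \<sigma>}. card (moves (cls V E (qmove ?p x)) \<tau>))"
    using S(3) by (intro sum.group[symmetric, OF fX S(1)]) (auto simp: successors_def)
  also have "\<dots> = (\<Sum>\<sigma>\<in>S. card (moves C \<sigma>) * card (moves \<sigma> \<tau>))"
  proof (rule sum.cong[OF refl])
    fix \<sigma> assume s: "\<sigma> \<in> S"
    have "{x\<in>?X. cls V E (qmove ?p x) = \<sigma>} = moves C \<sigma>"
      using mem_class_iff[of \<sigma>] s S(2) move_path[OF H p] by (auto simp: moves_def paths_iff)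
    moreover have "(\<Sum>x\<in>{x\<in>?X. cls V E (qmove ?p x) = \<sigma>}. card (moves (cls V E (qmove ?p x)) \<tau>)) =
        (\<Sum>x\<in>{x\<in>?X. cls V E (qmove ?p x) = \<sigma>}. card (moves \<sigma> \<tau>))"
      by (rule sum.cong) auto
    ultimately show "(\<Sum>x\<in>{x\<in>?X. cls V E (qmove ?p x) = \<sigma>}. card (moves (cls V E (qmove ?p x)) \<tau>)) =
        card (moves C \<sigma>) * card (moves \<sigma> \<tau>)" by simp
  qed
  finally show ?thesis .
qed

text \<open>Both sides are the parity of the sum of \<open>card (moves C \<sigma>)\<close> over the
  supports of \<open>a\<close> and \<open>b\<close>, taken in the two orders of summation.\<close>

lemma pairing_bdry_dlt:
  assumes H: "higraph V E" and a: "a \<in> dga V E" and b: "b \<in> dga V E"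
  shows "pairing (bdry V E a) b = pairing a (dlt V E b)"
proof -
  have A: "finite {C. a C}" "\<And>C. a C \<Longrightarrow> C \<in> pclasses V E"
    and B: "finite {C. b C}" "\<And>C. b C \<Longrightarrow> C \<in> pclasses V E" using a b by (auto simp: dga_def)
  have "{\<sigma>. bdry V E a \<sigma> \<and> b \<sigma>} = {\<sigma>\<in>{\<sigma>. b \<sigma>}. odd (\<Sum>C\<in>{C. a C}. card (moves C \<sigma>))}"
    using bdry_iff[OF a] B by auto
  then have "pairing (bdry V E a) b \<longleftrightarrow> odd (\<Sum>\<sigma>\<in>{\<sigma>. b \<sigma>}. \<Sum>C\<in>{C. a C}. card (moves C \<sigma>))"
    by (simp add: pairing_def even_sum_iff[OF B(1)])
  also have "(\<Sum>\<sigma>\<in>{\<sigma>. b \<sigma>}. \<Sum>C\<in>{C. a C}. card (moves C \<sigma>)) = (\<Sum>C\<in>{C. a C}. \<Sum>\<sigma>\<in>{\<sigma>. b \<sigma>}. card (moves C \<sigma>))"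
    by (rule sum.swap)
  also have "odd \<dots> \<longleftrightarrow> pairing a (dlt V E b)"
  proof -
    have "{C. a C \<and> dlt V E b C} = {C\<in>{C. a C}. odd (\<Sum>\<sigma>\<in>{\<sigma>. b \<sigma>}. card (moves C \<sigma>))}"
      using dlt_iff[OF H b] A by auto
    then show ?thesis by (simp add: pairing_def even_sum_iff[OF A(1)])
  qed
  finally show ?thesis .
qed

lemma bdry_bdry:
  assumes H: "higraph V E" and a: "a \<in> dga V E"
  shows "bdry V E (bdry V E a) \<tau> = False"
proof (cases "\<tau> \<in> pclasses V E")
  case \<tau>: True
  let ?A = "{C. a C}"
  let ?m = "\<lambda>\<sigma>. \<Sum>C\<in>?A. card (moves C \<sigma>)"
  define S where "S = (\<Union>C\<in>?A. successors V E C)"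
  have A: "finite ?A" "\<And>C. a C \<Longrightarrow> C \<in> pclasses V E" using a by (auto simp: dga_def)
  have S: "finite S" "S \<subseteq> pclasses V E" using A successors_props(1,2)[OF H] by (auto simp: S_def)
  have supp: "{\<sigma>. bdry V E a \<sigma>} = {\<sigma>\<in>S. odd (?m \<sigma>)}"
  proof (intro equalityI subsetI)
    fix \<sigma> assume "\<sigma> \<in> {\<sigma>. bdry V E a \<sigma>}"
    then have s: "\<sigma> \<in> pclasses V E" "odd (?m \<sigma>)" using bdry_iff[OF a] by auto
    have "\<exists>C\<in>?A. moves C \<sigma> \<noteq> {}"
    proof (rule ccontr)
      assume "\<not> (\<exists>C\<in>?A. moves C \<sigma> \<noteq> {})"
      then have "?m \<sigma> = 0" by simp
      then show False using s(2) by simp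
    qed
    then have "\<sigma> \<in> S" using successors_props(3)[OF H A(2) s(1)] by (auto simp: S_def)
    then show "\<sigma> \<in> {\<sigma>\<in>S. odd (?m \<sigma>)}" using s(2) by simp
  next
    fix \<sigma> assume "\<sigma> \<in> {\<sigma>\<in>S. odd (?m \<sigma>)}"
    then show "\<sigma> \<in> {\<sigma>. bdry V E a \<sigma>}" using S(2) bdry_iff[OF a] by auto
  qed
  then have "finite {\<sigma>. bdry V E a \<sigma>}" using S(1) by simp
  then have ba: "bdry V E a \<in> dga V E" unfolding dga_def using bdry_iff[OF a] by blast
  have "even (\<Sum>\<sigma>\<in>{\<sigma>\<in>S. odd (?m \<sigma>)}. card (moves \<sigma> \<tau>)) \<longleftrightarrow> even (\<Sum>\<sigma>\<in>S. ?m \<sigma> * card (moves \<sigma> \<tau>))"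
    by (rule even_sum_odd_filter[OF S(1)])
  also have "(\<Sum>\<sigma>\<in>S. ?m \<sigma> * card (moves \<sigma> \<tau>)) = (\<Sum>C\<in>?A. \<Sum>\<sigma>\<in>S. card (moves C \<sigma>) * card (moves \<sigma> \<tau>))"
    unfolding sum_distrib_right by (rule sum.swap)
  also have "even \<dots>"
  proof (rule dvd_sum)
    fix C assume "C \<in> ?A"
    then show "even (\<Sum>\<sigma>\<in>S. card (moves C \<sigma>) * card (moves \<sigma> \<tau>))"
      by (intro double_sum_even[OF H A(2) \<tau> S]) (auto simp: S_def)
  qed
  finally show ?thesis unfolding bdry_iff[OF ba] supp by simp
qed (simp add: bdry_def)

text \<open>The support of \<open>dlt V E b\<close> is not bounded directly. A class \<sigma>
  contributes to the coefficient of \<open>C\<close> only if one of its refinements lies in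
  \<open>C\<close>, and by the bijection with moves it is then one of the finitely many successors
  of \<open>C\<close>; the rest is the count for \<open>bdry_bdry\<close> with the roles of the two
  ends exchanged.\<close>

lemma dlt_dlt:
  assumes H: "higraph V E" and b: "b \<in> dga V E"
  shows "dlt V E (dlt V E b) C = False"
proof (cases "C \<in> pclasses V E")
  case C: True
  let ?B = "{\<tau>. b \<tau>}" and ?S = "successors V E C"
  let ?m = "\<lambda>\<sigma>. \<Sum>\<tau>\<in>?B. card (moves \<sigma> \<tau>)"
  have B: "finite ?B" "\<And>C. b C \<Longrightarrow> C \<in> pclasses V E" using b by (auto simp: dga_def)
  note S = successors_props[OF H C]
  have "{(\<sigma>, v, D). dlt V E b \<sigma> \<and> \<sigma> \<in> pclasses V E \<and> v \<in> nds (rep \<sigma>) \<and> D \<in> pclasses V E \<and>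
        (if bmu (lab (rep \<sigma>) v) then boundary_path (rep D) \<and> plength (rep D) = 2 else pweight (rep D) = 2) \<and>
        psrc (rep D) = bsrc (lab (rep \<sigma>) v) \<and> ptgt (rep D) = btgt (lab (rep \<sigma>) v) \<and>
        refine (rep \<sigma>) v (rep D) \<in> C} = Sigma {\<sigma>. dlt V E b \<sigma> \<and> \<sigma> \<in> pclasses V E} (\<lambda>\<sigma>. refinements V E \<sigma> C)"
    unfolding refinements_def fits_def by blast
  also have "\<dots> = Sigma {\<sigma>\<in>?S. odd (?m \<sigma>)} (\<lambda>\<sigma>. refinements V E \<sigma> C)"
  proof -
    have "\<sigma> \<in> ?S" if "\<sigma> \<in> pclasses V E" "z \<in> refinements V E \<sigma> C" for \<sigma> z
    proof -
      have "card (refinements V E \<sigma> C) \<noteq> 0" using refinements_card(1)[OF H C that(1)] that(2) by auto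
      then have "card (moves C \<sigma>) \<noteq> 0" using refinements_card(2)[OF H C that(1)] by simp
      then have "moves C \<sigma> \<noteq> {}" by auto
      then show ?thesis using S(3)[OF that(1)] by simp
    qed
    then show ?thesis using S(2) dlt_iff[OF H b] by auto
  qed
  also have "card \<dots> = (\<Sum>\<sigma>\<in>{\<sigma>\<in>?S. odd (?m \<sigma>)}. card (moves C \<sigma>))"
    using S(1,2) refinements_card[OF H C] by (subst card_SigmaI) (auto intro!: sum.cong)
  finally have "dlt V E (dlt V E b) C \<longleftrightarrow> odd (\<Sum>\<sigma>\<in>{\<sigma>\<in>?S. odd (?m \<sigma>)}. card (moves C \<sigma>))"
    unfolding dlt_def[of V E "dlt V E b"] using C by simp
  moreover have "even (\<Sum>\<sigma>\<in>{\<sigma>\<in>?S. odd (?m \<sigma>)}. card (moves C \<sigma>)) \<longleftrightarrow> even (\<Sum>\<sigma>\<in>?S. ?m \<sigma> * card (moves C \<sigma>))"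
    by (rule even_sum_odd_filter[OF S(1)])
  moreover have "(\<Sum>\<sigma>\<in>?S. ?m \<sigma> * card (moves C \<sigma>)) = (\<Sum>\<tau>\<in>?B. \<Sum>\<sigma>\<in>?S. card (moves C \<sigma>) * card (moves \<sigma> \<tau>))"
    unfolding sum_distrib_right by (subst sum.swap) (simp add: mult.commute)
  moreover have "even \<dots>"
    by (rule dvd_sum) (use double_sum_even[OF H C B(2) S(1,2) subset_refl] in auto)
  ultimately show ?thesis by simp
qed (simp add: dlt_def)

theorem theorem4p8:
  fixes V :: "'v set" and E :: "'v hedge set"
  assumes "higraph V E"
  shows "(\<forall>a\<in>dga V E. \<forall>b\<in>dga V E. pairing (bdry V E a) b = pairing a (dlt V E b)) \<and>
         (\<forall>a\<in>dga V E. bdry V E (bdry V E a) = (\<lambda>_. False)) \<and>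
         (\<forall>b\<in>dga V E. dlt V E (dlt V E b) = (\<lambda>_. False))"
  using pairing_bdry_dlt[OF assms] bdry_bdry[OF assms] dlt_dlt[OF assms] by (auto simp: fun_eq_iff)

end
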